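(* Let $d\ge 2$ and let $p_t(x,\mathrm{d}\xi)$ be the transition kernel of a subcritical affine process on $\mathbb{S}_d^+$ with admissible parameters $(\alpha,b,B,m,\mu)$. Suppose that $$\int_{\{\|\xi\|>1\}}\log\|\xi\|\,m(\mathrm{d}\xi)<\infty.$$ Then there exists a unique invariant distribution $\pi$, i.e. a unique Borel probability measure $\pi$ on $\mathbb{S}_d^+$ such that $\int_{\mathbb{S}_d^+}p_t(x,\mathrm{d}\xi)\,\pi(\mathrm{d}x)=\pi(\mathrm{d}\xi)$ for all $t\ge 0$. Moreover, $p_t(x,\cdot)\to\pi$ weakly as $t\to\infty$ for each $x\in\mathbb{S}_d^+$, and $\pi$ has Laplace transform $$\int_{\mathbb{S}_d^+}\mathrm{e}^{-\langle u,x\rangle}\,\pi(\mathrm{d}x)=\exp\left(-\int_0^\infty F(\psi(s,u))\,\mathrm{d}s\right),\qquad u\in\mathbb{S}_d^+.$$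
   Context: Let $\mathbb{S}_d$ be the space of real symmetric $d\times d$ matrices with $\langle x,y\rangle=\mathrm{tr}(xy)$ and Frobenius norm $\|x\|=\langle x,x\rangle^{1/2}$; $\mathbb{S}_d^+$ is the cone of positive semidefinite matrices; $x\preceq y$ means $y-x\in\mathbb{S}_d^+$. An $\mathbb{S}_d^+$-valued measure $\eta$ on $\mathbb{S}_d^+\setminus\{0\}$ is a $d\times d$ matrix of signed measures with $\eta(A)\in\mathbb{S}_d^+$ for every Borel $A$ with $0\notin\overline{A}$. Admissible parameters $(\alpha,b,B,m,\mu)$: (i) $\alpha\in\mathbb{S}_d^+$; (ii) $b\in\mathbb{S}_d^+$ with $b\succeq(d-1)\alpha$; (iii) $m$ is a Borel measure on $\mathbb{S}_d^+\setminus\{0\}$ with $\int(\|\xi\|\wedge1)\,m(\mathrm{d}\xi)<\infty$; (iv) $\mu$ is an $\mathbb{S}_d^+$-valued sigma-finite measure on $\mathbb{S}_d^+\setminus\{0\}$ with $\int\|\xi\|\,\mathrm{tr}(\mu)(\mathrm{d}\xi)<\infty$, where $\mathrm{tr}(\mu)(A):=\mathrm{tr}(\mu(A))$; (v) $B:\mathbb{S}_d\to\mathbb{S}_d$ is linear with $\langle B(x),u\rangle\ge0$ for all $x,u\in\mathbb{S}_d^+$ with $\langle x,u\rangle=0$. $B^\top$ denotes the adjoint of $B$ with respect to $\langle\cdot,\cdot\rangle$. For $u\in\mathbb{S}_d^+$ put $$F(u)=\langle b,u\rangle-\int_{\mathbb{S}_d^+\setminus\{0\}}(\mathrm{e}^{-\langle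 u,\xi\rangle}-1)\,m(\mathrm{d}\xi),\quad R(u)=-2u\alpha u+B^\top(u)-\int_{\mathbb{S}_d^+\setminus\{0\}}(\mathrm{e}^{-\langle u,\xi\rangle}-1)\,\mu(\mathrm{d}\xi).$$ Known result (Cuchiero et al.): for admissible parameters there is a unique stochastically continuous transition kernel $p_t(x,\mathrm{d}\xi)$ on $\mathbb{S}_d^+$ with $p_t(x,\mathbb{S}_d^+)=1$ and $$\int_{\mathbb{S}_d^+}\mathrm{e}^{-\langle u,\xi\rangle}p_t(x,\mathrm{d}\xi)=\exp(-\phi(t,u)-\langle\psi(t,u),x\rangle),\quad t\ge0,\ x,u\in\mathbb{S}_d^+,$$ where $\phi,\psi$ are the unique solutions ($\psi$ with values in $\mathbb{S}_d^+$) of $\partial_t\phi(t,u)=F(\psi(t,u))$, $\phi(0,u)=0$, and $\partial_t\psi(t,u)=R(\psi(t,u))$, $\psi(0,u)=u$. This is the transition kernel of the affine process with parameters $(\alpha,b,B,m,\mu)$. Effective drift: the linear map $\widetilde{B}:\mathbb{S}_d\to\mathbb{S}_d$, $\widetilde{B}(x)=B(x)+\int_{\mathbb{S}_d^+\setminus\{0\}}\xi\,\langle x,\mu(\mathrm{d}\xi)\rangle$, where $\langle x,\mu(\mathrm{d}\xi)\rangle=\sum_{i,j}x_{ij}\mu_{ij}(\mathrm{d}\xi)$ (equivalently $\widetilde{B}^\top(u)=B^\top(u)+\int\langle u,\xi\rangle\mu(\mathrm{d}\xi)$). The process is called subcritical if every eigenvalue of $\widetilde{B}$ has strictly negative real part.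 *)

theory Defs
  imports "HOL-Probability.Probability"
begin

text \<open>
  Matrices are elements of \<^typ>\<open>real^'n^'n\<close>.  The library inner product and norm of this type are
  entrywise: the norm is the Frobenius norm, and on symmetric matrices the inner product is
  the trace of the product (lemma \<open>inner_sym_mats\<close> below).
\<close>

definition sym_mats :: "(real^'n^'n) set" where
  "sym_mats = {x. transpose x = x}"

definition psd_cone :: "(real^'n^'n) set" where
  "psd_cone = {x \<in> sym_mats. \<forall>v. 0 \<le> v \<bullet> (x *v v)}"

abbreviation psd_borel :: "(real^'n^'n) measure" where
  "psd_borel \<equiv> restrict_space borel psd_cone"

abbreviation psd0_borel :: "(real^'n^'n) measure" where
  "psd0_borel \<equiv> restrict_space borel (psd_cone - {0})"

lemma inner_sym_mats:
  fixes x y :: "real^'n^'n"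
  assumes "x \<in> sym_mats" "y \<in> sym_mats"
  shows "x \<bullet> y = trace (x ** y)"
proof -
  have y: "y $ k $ i = y $ i $ k" for i k
    using assms(2) unfolding sym_mats_def transpose_def vec_eq_iff by simp
  show ?thesis
    by (simp add: inner_vec_def trace_def matrix_matrix_mult_def y)
qed


section \<open>Matrix-valued measures\<close>

text \<open>
  A signed or matrix-valued measure on the punctured cone is a set function on the Borel sets
  that are bounded away from the origin.  It need not extend to all Borel sets, since its
  entries may have infinite positive and negative parts near the origin.
\<close>

definition away_sets :: "(real^'n^'n) set set" where
  "away_sets = {A \<in> sets borel. A \<subseteq> psd_cone - {0} \<and> 0 \<notin> closure A}"

definition signed_measure_away :: "((real^'n^'n) set \<Rightarrow> real) \<Rightarrow> bool" where
  "signed_measure_away \<nu> \<longleftrightarrow>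
     (\<forall>A::nat \<Rightarrow> (real^'n^'n) set.
        range A \<subseteq> away_sets \<and> disjoint_family A \<and> (\<Union>n. A n) \<in> away_sets \<longrightarrow>
        (\<lambda>n. \<nu> (A n)) sums \<nu> (\<Union>n. A n))"

definition psd_valued_measure :: "((real^'n^'n) set \<Rightarrow> real^'n^'n) \<Rightarrow> bool" where
  "psd_valued_measure \<eta> \<longleftrightarrow>
     (\<forall>i j. signed_measure_away (\<lambda>A. \<eta> A $ i $ j)) \<and> (\<forall>A\<in>away_sets. \<eta> A \<in> psd_cone)"

text \<open>
  The positive part in the Jordan decomposition of a signed measure, as a measure on all Borel
  subsets of the punctured cone; for nonnegative \<open>\<nu>\<close> it is the measure extending \<open>\<nu>\<close>.
\<close>

definition pos_variation :: "((real^'n^'n) set \<Rightarrow> real) \<Rightarrow> (real^'n^'n) measure" where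
  "pos_variation \<nu> = measure_of (psd_cone - {0}) (sets psd0_borel)
     (\<lambda>A. SUP E\<in>{E \<in> away_sets. E \<subseteq> A}. ennreal (\<nu> E))"

definition signed_integral ::
    "((real^'n^'n) set \<Rightarrow> real) \<Rightarrow> (real^'n^'n \<Rightarrow> 'b::{banach, second_countable_topology}) \<Rightarrow> 'b" where
  "signed_integral \<nu> f =
     (\<integral>\<xi>. f \<xi> \<partial>(pos_variation \<nu>)) - (\<integral>\<xi>. f \<xi> \<partial>(pos_variation (\<lambda>A. - \<nu> A)))"

definition trace_measure :: "((real^'n^'n) set \<Rightarrow> real^'n^'n) \<Rightarrow> (real^'n^'n) measure" where
  "trace_measure \<eta> = pos_variation (\<lambda>A. trace (\<eta> A))"

lemma away_sets_Int:
  assumes "E \<in> away_sets" "A \<in> sets borel"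
  shows "E \<inter> A \<in> away_sets"
  using assms closure_mono[of "E \<inter> A" E] unfolding away_sets_def by auto

lemma away_sets_UN:
  assumes "finite I" "\<And>i. i \<in> I \<Longrightarrow> E i \<in> away_sets"
  shows "(\<Union>i\<in>I. E i) \<in> away_sets"
  using assms by (induction I) (auto simp: away_sets_def)

lemma away_sets_empty: "{} \<in> away_sets"
  by (simp add: away_sets_def)

lemma sets_psd0_borel_D: "A \<in> sets psd0_borel \<Longrightarrow> A \<subseteq> psd_cone - {0}"
  by (auto simp: sets_restrict_space)

lemma away_sets_in_psd0_borel: "A \<in> away_sets \<Longrightarrow> A \<in> sets psd0_borel"
  by (auto simp: sets_restrict_space away_sets_def image_iff)

lemma signed_measure_away_sums:
  assumes "signed_measure_away \<nu>" "\<And>n. A n \<in> away_sets" "disjoint_family A"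
    "(\<Union>n::nat. A n) \<in> away_sets"
  shows "(\<lambda>n. \<nu> (A n)) sums \<nu> (\<Union>n. A n)"
  using assms unfolding signed_measure_away_def by blast

lemma signed_measure_away_empty:
  assumes "signed_measure_away \<nu>"
  shows "\<nu> {} = 0"
proof -
  have "(\<lambda>n::nat. \<nu> {}) sums \<nu> {}"
    using signed_measure_away_sums[OF assms, of "\<lambda>_. {}"]
    by (simp add: away_sets_empty disjoint_family_on_def)
  from sums_summable[OF this] show ?thesis
    by (simp add: summable_const_iff)
qed

lemma signed_measure_away_Un:
  assumes \<nu>: "signed_measure_away \<nu>" and E: "E \<in> away_sets" and F: "F \<in> away_sets"
    and disj: "E \<inter> F = {}"
  shows "\<nu> (E \<union> F) = \<nu> E + \<nu> F"
proof -
  define A where "A = binaryset E F"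
  have "(\<lambda>n. \<nu> (A n)) sums \<nu> (\<Union>n. A n)"
  proof (rule signed_measure_away_sums[OF \<nu>])
    show "A n \<in> away_sets" for n
      using E F by (simp add: A_def binaryset_def away_sets_empty)
    show "disjoint_family A"
      using disj by (auto simp: A_def binaryset_def disjoint_family_on_def)
    show "(\<Union>n. A n) \<in> away_sets"
      using E F by (auto simp: A_def UN_binaryset_eq away_sets_def)
  qed
  moreover have "(\<lambda>n. \<nu> (A n)) sums (\<nu> E + \<nu> F)"
    unfolding A_def by (rule binaryset_sums[where f = \<nu>, OF signed_measure_away_empty[OF \<nu>]])
  ultimately show ?thesis
    using sums_unique2 by (simp add: A_def UN_binaryset_eq) blast
qed

lemma ennreal_sum_le_sum: "ennreal (\<Sum>n<N. f n) \<le> (\<Sum>n<N::nat. ennreal (f n))"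
proof (induction N)
  case (Suc N)
  have "ennreal (a + b) \<le> ennreal a + ennreal b" for a b
    by (cases "0 \<le> a"; cases "0 \<le> b") (auto simp: ennreal_neg ennreal_leI)
  then have "ennreal (\<Sum>n<Suc N. f n) \<le> ennreal (\<Sum>n<N. f n) + ennreal (f N)"
    by simp
  also have "\<dots> \<le> (\<Sum>n<N. ennreal (f n)) + ennreal (f N)"
    by (intro add_right_mono Suc.IH)
  finally show ?case by simp
qed simp

text \<open>
  The set function in the definition of \<^const>\<open>pos_variation\<close> is a measure whenever \<open>\<nu>\<close> is
  a signed measure, so that definition never falls back to the default of \<^const>\<open>measure_of\<close>.
\<close>

lemma emeasure_pos_variation:
  fixes \<nu> :: "(real^'n^'n) set \<Rightarrow> real"
  assumes \<nu>: "signed_measure_away \<nu>" and A: "A \<in> sets psd0_borel"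
  shows "emeasure (pos_variation \<nu>) A = (SUP E\<in>{E \<in> away_sets. E \<subseteq> A}. ennreal (\<nu> E))"
proof -
  define f where "f = (\<lambda>A. SUP E\<in>{E \<in> away_sets. E \<subseteq> A}. ennreal (\<nu> E))"
  have upper: "ennreal (\<nu> E) \<le> f A" if "E \<in> away_sets" "E \<subseteq> A" for E A
    unfolding f_def using that by (intro SUP_upper) auto
  have mono: "f A \<le> f B" if "A \<subseteq> B" for A B
    unfolding f_def using that by (intro SUP_subset_mono) auto
  have f_empty: "f {} = 0"
  proof -
    have "{E \<in> away_sets. E \<subseteq> {}} = {{} :: (real^'n^'n) set}" using away_sets_empty by auto
    then show ?thesis
      unfolding f_def by (simp only: image_insert image_empty cSup_singleton signed_measure_away_empty[OF \<nu>] ennreal_0)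
  qed
  have super: "f A + f B \<le> f (A \<union> B)" if AB: "A \<inter> B = {}" for A B
  proof -
    have *: "ennreal (\<nu> E) + ennreal (\<nu> F) \<le> f (A \<union> B)"
      if E: "E \<in> away_sets" "E \<subseteq> A" and F: "F \<in> away_sets" "F \<subseteq> B" for E F
    proof -
      have EF: "E \<union> F \<in> away_sets" using E F by (auto simp: away_sets_def)
      have "\<nu> (E \<union> F) = \<nu> E + \<nu> F"
        using signed_measure_away_Un[OF \<nu>] E F AB by blast
      moreover have "ennreal (\<nu> (E \<union> F)) \<le> f (A \<union> B)" "ennreal (\<nu> E) \<le> f (A \<union> B)"
        "ennreal (\<nu> F) \<le> f (A \<union> B)"
        using E F EF by (auto intro!: upper)
      ultimately show ?thesis
        by (cases "0 \<le> \<nu> E"; cases "0 \<le> \<nu> F") (simp_all add: ennreal_neg)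
    qed
    have ne: "{E \<in> away_sets. E \<subseteq> X} \<noteq> {}" for X :: "(real^'n^'n) set"
      using away_sets_empty by blast
    have f_eq: "f X = (SUP E\<in>{E \<in> away_sets. E \<subseteq> X}. ennreal (\<nu> E))" for X
      by (simp add: f_def)
    have "f A + ennreal (\<nu> F) \<le> f (A \<union> B)" if F: "F \<in> away_sets" "F \<subseteq> B" for F
    proof -
      have "f A + ennreal (\<nu> F)
          = (SUP E\<in>{E \<in> away_sets. E \<subseteq> A}. ennreal (\<nu> E) + ennreal (\<nu> F))"
        unfolding f_eq[of A] by (rule ennreal_SUP_add_left[OF ne, symmetric])
      also have "\<dots> \<le> f (A \<union> B)"
        using F by (intro SUP_least *) auto
      finally show ?thesis .
    qed
    then have "(SUP F\<in>{F \<in> away_sets. F \<subseteq> B}. f A + ennreal (\<nu> F)) \<le> f (A \<union> B)"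
      by (intro SUP_least) simp
    then show ?thesis
      unfolding f_eq[of B] by (simp only: ennreal_SUP_add_right[OF ne])
  qed
  have "countably_additive (sets psd0_borel) f"
    unfolding countably_additive_def
  proof (intro allI impI antisym)
    fix A :: "nat \<Rightarrow> (real^'n^'n) set"
    assume rA: "range A \<subseteq> sets psd0_borel" and dA: "disjoint_family A"
    have "(\<Sum>n<N. f (A n)) \<le> f (\<Union>n<N. A n)" for N
    proof (induction N)
      case (Suc N)
      have "(\<Union>n<N. A n) \<inter> A N = {}"
      proof -
        have "A n \<inter> A N = {}" if "n < N" for n
          using dA that unfolding disjoint_family_on_def by simp
        then show ?thesis by blast
      qed
      from super[OF this] have "f (\<Union>n<N. A n) + f (A N) \<le> f (\<Union>n<Suc N. A n)"
        by (simp add: lessThan_Suc Un_commute)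
      moreover have "(\<Sum>n<Suc N. f (A n)) \<le> f (\<Union>n<N. A n) + f (A N)"
        using add_right_mono[OF Suc.IH] by simp
      ultimately show ?case by (rule order_trans[rotated])
    qed (simp add: f_empty)
    moreover have "f (\<Union>n<N. A n) \<le> f (\<Union>n. A n)" for N by (intro mono) blast
    ultimately have "(\<Sum>n<N. f (A n)) \<le> f (\<Union>n. A n)" for N
      by (rule order_trans)
    then show "(\<Sum>n. f (A n)) \<le> f (\<Union>n. A n)"
      by (intro suminf_le_const) simp_all
    show "f (\<Union>n. A n) \<le> (\<Sum>n. f (A n))"
    proof (subst f_def, rule SUP_least)
      fix E assume "E \<in> {E \<in> away_sets. E \<subseteq> (\<Union>n. A n)}"
      then have E: "E \<in> away_sets" "(\<Union>n. E \<inter> A n) = E" by auto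
      have EA: "E \<inter> A n \<in> away_sets" for n
      proof -
        obtain B where "B \<in> sets borel" "A n = (psd_cone - {0}) \<inter> B"
          using rA unfolding sets_restrict_space by blast
        moreover from this have "E \<inter> A n = E \<inter> B"
          using E(1) by (auto simp: away_sets_def)
        ultimately show ?thesis using away_sets_Int[OF E(1)] by simp
      qed
      have "(\<lambda>n. \<nu> (E \<inter> A n)) sums \<nu> (\<Union>n. E \<inter> A n)"
      proof (rule signed_measure_away_sums[OF \<nu> EA])
        show "disjoint_family (\<lambda>n. E \<inter> A n)"
          using dA by (auto simp: disjoint_family_on_def)
      qed (use E in simp)
      then have lim: "(\<lambda>N. ennreal (\<Sum>n<N. \<nu> (E \<inter> A n))) \<longlonglongrightarrow> ennreal (\<nu> E)"
        unfolding sums_def E(2) by (rule tendsto_ennrealI)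
      have "ennreal (\<Sum>n<N. \<nu> (E \<inter> A n)) \<le> (\<Sum>n. f (A n))" for N
      proof -
        have "ennreal (\<Sum>n<N. \<nu> (E \<inter> A n)) \<le> (\<Sum>n<N. ennreal (\<nu> (E \<inter> A n)))"
          by (rule ennreal_sum_le_sum)
        also have "\<dots> \<le> (\<Sum>n<N. f (A n))"
          by (intro sum_mono upper EA) auto
        also have "\<dots> \<le> (\<Sum>n. f (A n))"
          by (intro sum_le_suminf) auto
        finally show ?thesis .
      qed
      with lim show "ennreal (\<nu> E) \<le> (\<Sum>n. f (A n))"
        by (intro LIMSEQ_le_const2[OF lim]) auto
    qed
  qed
  moreover have "positive (sets psd0_borel) f"
    by (simp add: positive_def f_empty)
  moreover have "sigma_algebra (psd_cone - {0}) (sets psd0_borel)"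
    using sets.sigma_algebra_axioms[of psd0_borel] by (simp add: space_restrict_space)
  ultimately have "emeasure (measure_of (psd_cone - {0}) (sets psd0_borel) f) A = f A"
    using A by (intro emeasure_measure_of_sigma) auto
  then show ?thesis by (simp add: pos_variation_def f_def)
qed


section \<open>Linear maps on symmetric matrices\<close>

definition linear_on_sym :: "(real^'n^'n \<Rightarrow> real^'n^'n) \<Rightarrow> bool" where
  "linear_on_sym L \<longleftrightarrow>
     (\<forall>x\<in>sym_mats. L x \<in> sym_mats) \<and>
     (\<forall>x\<in>sym_mats. \<forall>y\<in>sym_mats. L (x + y) = L x + L y) \<and>
     (\<forall>c. \<forall>x\<in>sym_mats. L (c *\<^sub>R x) = c *\<^sub>R L x)"

definition sym_adjoint :: "(real^'n^'n \<Rightarrow> real^'n^'n) \<Rightarrow> real^'n^'n \<Rightarrow> real^'n^'n" where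
  "sym_adjoint L u = (THE w. w \<in> sym_mats \<and> (\<forall>x\<in>sym_mats. x \<bullet> w = L x \<bullet> u))"

text \<open>
  Eigenvalues are those of the complexification of \<open>L\<close>, which acts on complex symmetric
  matrices by \<open>x + \<i>y \<mapsto> L x + \<i> L y\<close>.
\<close>

definition complexify :: "(real^'n^'n \<Rightarrow> real^'n^'n) \<Rightarrow> complex^'n^'n \<Rightarrow> complex^'n^'n" where
  "complexify L z =
     (\<chi> i j. Complex (L (\<chi> k l. Re (z $ k $ l)) $ i $ j) (L (\<chi> k l. Im (z $ k $ l)) $ i $ j))"

definition sym_eigenvalue :: "(real^'n^'n \<Rightarrow> real^'n^'n) \<Rightarrow> complex \<Rightarrow> bool" where
  "sym_eigenvalue L c \<longleftrightarrow>
     (\<exists>z::complex^'n^'n. transpose z = z \<and> z \<noteq> 0 \<and> complexify L z = (\<chi> i j. c * z $ i $ j))"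


section \<open>Affine processes on the cone\<close>

definition admissible ::
    "real^'n^'n \<Rightarrow> real^'n^'n \<Rightarrow> (real^'n^'n \<Rightarrow> real^'n^'n) \<Rightarrow> (real^'n^'n) measure
      \<Rightarrow> ((real^'n^'n) set \<Rightarrow> real^'n^'n) \<Rightarrow> bool" where
  "admissible \<alpha> b B m \<mu> \<longleftrightarrow>
     \<alpha> \<in> psd_cone \<and>
     b \<in> psd_cone \<and> b - (real CARD('n) - 1) *\<^sub>R \<alpha> \<in> psd_cone \<and>
     sets m = sets psd0_borel \<and> (\<integral>\<^sup>+\<xi>. ennreal (min (norm \<xi>) 1) \<partial>m) < \<infinity> \<and>
     psd_valued_measure \<mu> \<and> sigma_finite_measure (trace_measure \<mu>) \<and>
       (\<integral>\<^sup>+\<xi>. ennreal (norm \<xi>) \<partial>(trace_measure \<mu>)) < \<infinity> \<and>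
     linear_on_sym B \<and> (\<forall>x\<in>psd_cone. \<forall>u\<in>psd_cone. x \<bullet> u = 0 \<longrightarrow> 0 \<le> B x \<bullet> u)"

definition F_fun :: "real^'n^'n \<Rightarrow> (real^'n^'n) measure \<Rightarrow> real^'n^'n \<Rightarrow> real" where
  "F_fun b m u = b \<bullet> u - (\<integral>\<xi>. (exp (- (u \<bullet> \<xi>)) - 1) \<partial>m)"

definition R_fun ::
    "real^'n^'n \<Rightarrow> (real^'n^'n \<Rightarrow> real^'n^'n) \<Rightarrow> ((real^'n^'n) set \<Rightarrow> real^'n^'n)
      \<Rightarrow> real^'n^'n \<Rightarrow> real^'n^'n" where
  "R_fun \<alpha> B \<mu> u =
     - 2 *\<^sub>R (u ** \<alpha> ** u) + sym_adjoint B u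
     - (\<chi> i j. signed_integral (\<lambda>A. \<mu> A $ i $ j) (\<lambda>\<xi>. exp (- (u \<bullet> \<xi>)) - 1))"

definition effective_drift ::
    "(real^'n^'n \<Rightarrow> real^'n^'n) \<Rightarrow> ((real^'n^'n) set \<Rightarrow> real^'n^'n)
      \<Rightarrow> real^'n^'n \<Rightarrow> real^'n^'n" where
  "effective_drift B \<mu> x =
     B x + (\<Sum>i\<in>UNIV. \<Sum>j\<in>UNIV. (x $ i $ j) *\<^sub>R signed_integral (\<lambda>A. \<mu> A $ i $ j) (\<lambda>\<xi>. \<xi>))"

definition subcritical ::
    "(real^'n^'n \<Rightarrow> real^'n^'n) \<Rightarrow> ((real^'n^'n) set \<Rightarrow> real^'n^'n) \<Rightarrow> bool" where
  "subcritical B \<mu> \<longleftrightarrow> (\<forall>c. sym_eigenvalue (effective_drift B \<mu>) c \<longrightarrow> Re c < 0)"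

definition riccati_solution ::
    "(real^'n^'n \<Rightarrow> real) \<Rightarrow> (real^'n^'n \<Rightarrow> real^'n^'n)
      \<Rightarrow> (real \<Rightarrow> real^'n^'n \<Rightarrow> real) \<Rightarrow> (real \<Rightarrow> real^'n^'n \<Rightarrow> real^'n^'n) \<Rightarrow> bool" where
  "riccati_solution F R \<phi> \<psi> \<longleftrightarrow>
     (\<forall>u\<in>psd_cone. \<phi> 0 u = 0 \<and> \<psi> 0 u = u \<and>
       (\<forall>t\<ge>0. \<psi> t u \<in> psd_cone \<and>
         ((\<lambda>s. \<phi> s u) has_real_derivative F (\<psi> t u)) (at t within {0..}) \<and>
         ((\<lambda>s. \<psi> s u) has_vector_derivative R (\<psi> t u)) (at t within {0..})))"

definition weakly_tendsto ::
    "('t \<Rightarrow> (real^'n^'n) measure) \<Rightarrow> (real^'n^'n) measure \<Rightarrow> 't filter \<Rightarrow> bool" where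
  "weakly_tendsto M N \<F> \<longleftrightarrow>
     (\<forall>f::real^'n^'n \<Rightarrow> real. continuous_on psd_cone f \<and> bounded (f ` psd_cone) \<longrightarrow>
       ((\<lambda>t. \<integral>\<xi>. f \<xi> \<partial>(M t)) \<longlongrightarrow> (\<integral>\<xi>. f \<xi> \<partial>N)) \<F>)"

text \<open>
  Transition kernels are conservative, start at the Dirac measure and satisfy the
  Chapman-Kolmogorov equations.
\<close>

definition transition_kernel :: "(real \<Rightarrow> real^'n^'n \<Rightarrow> (real^'n^'n) measure) \<Rightarrow> bool" where
  "transition_kernel p \<longleftrightarrow>
     (\<forall>t\<ge>0. p t \<in> psd_borel \<rightarrow>\<^sub>M prob_algebra psd_borel) \<and>
     (\<forall>x\<in>psd_cone. p 0 x = return psd_borel x) \<and>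
     (\<forall>s\<ge>0. \<forall>t\<ge>0. \<forall>x\<in>psd_cone. p (s + t) x = p s x \<bind> p t)"

definition stochastically_continuous ::
    "(real \<Rightarrow> real^'n^'n \<Rightarrow> (real^'n^'n) measure) \<Rightarrow> bool" where
  "stochastically_continuous p \<longleftrightarrow>
     (\<forall>t\<ge>0. \<forall>x\<in>psd_cone. weakly_tendsto (\<lambda>s. p s x) (p t x) (at t within {0..}))"

definition affine_kernel ::
    "real^'n^'n \<Rightarrow> real^'n^'n \<Rightarrow> (real^'n^'n \<Rightarrow> real^'n^'n) \<Rightarrow> (real^'n^'n) measure
      \<Rightarrow> ((real^'n^'n) set \<Rightarrow> real^'n^'n)
      \<Rightarrow> (real \<Rightarrow> real^'n^'n \<Rightarrow> real) \<Rightarrow> (real \<Rightarrow> real^'n^'n \<Rightarrow> real^'n^'n)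
      \<Rightarrow> (real \<Rightarrow> real^'n^'n \<Rightarrow> (real^'n^'n) measure) \<Rightarrow> bool" where
  "affine_kernel \<alpha> b B m \<mu> \<phi> \<psi> p \<longleftrightarrow>
     transition_kernel p \<and> stochastically_continuous p \<and>
     riccati_solution (F_fun b m) (R_fun \<alpha> B \<mu>) \<phi> \<psi> \<and>
     (\<forall>t\<ge>0. \<forall>x\<in>psd_cone. \<forall>u\<in>psd_cone.
       (\<integral>\<xi>. exp (- (u \<bullet> \<xi>)) \<partial>(p t x)) = exp (- \<phi> t u - \<psi> t u \<bullet> x))"

definition invariant_distribution ::
    "(real \<Rightarrow> real^'n^'n \<Rightarrow> (real^'n^'n) measure) \<Rightarrow> (real^'n^'n) measure \<Rightarrow> bool" where
  "invariant_distribution p \<pi> \<longleftrightarrow>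
     prob_space \<pi> \<and> sets \<pi> = sets psd_borel \<and> (\<forall>t\<ge>0. \<pi> \<bind> p t = \<pi>)"

end

theory Submission
  imports Defs
begin

text \<open>
  Everything rests on exponential decay of \<open>\<psi>\<close>, which needs neither the spectral theorem nor matrix
  exponentials: subcriticality and cross-positivity of the effective drift give a positive definite
  \<open>y\<close> with image \<open>-1\<close>, and \<open>y \<bullet> \<psi>(t, u)\<close> is then a Lyapunov function, because \<open>R(u)\<close> is at most the
  adjoint of the effective drift at \<open>u\<close>.  Decay bounds \<open>\<phi>(t, u)\<close> by
  \<open>const (\<bar>u\<bar> + \<integral> ln (1 + const \<bar>u\<bar> \<bar>\<xi>\<bar>) m(d\<xi>))\<close>, which is where the log-moment enters.  As this
  bound vanishes with \<open>u\<close>, the laws \<open>p\<^sub>t(x, \<cdot>)\<close> are tight; their Laplace transforms converge, and Laplace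
  transforms determine measures on the cone, so they converge weakly.  Invariance of the limit is the
  flow property of \<open>\<phi>\<close>, i.e. Chapman-Kolmogorov at \<open>x = 0\<close>.

  Tight sequences on a closed convex set have convergent subsequences because a continuous surjection
  from the line with a locally bounded Borel section reduces this to Helly's theorem on the line.
\<close>

section \<open>Weak compactness on closed convex sets\<close>

text \<open>That \<open>exp (- \<integral> F(\<psi>))\<close> is the Laplace transform of a
  probability measure is not clear beforehand. Compactness therefore produces the measure, and
  Laplace transforms only have to identify it.

  The logarithm has a simple origin. If \<psi> decays at rate \<delta>, a jump of size x contributes
  at time s about min 1 (a x exp (- \<delta> s)). This is 1 up to time ln (a x) / \<delta> and
  exponentially small afterwards, so its time integral is of order ln (1 + a x) / \<delta>.

  Two obstacles shape the estimates. First, R is nonlinear and is controlled only from above, in the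
  order of the cone; hence the Lyapunov function is a linear functional that is positive on the
  cone, and comparability of norm and trace there turns its decay into decay of the norm. Second,
  the entries of \<mu> are signed and their parts may be infinite near 0; hence positivity of its
  integrals is proved by comparing sums of nonnegative measures, and differences are formed only
  after integration against functions bounded by a multiple of the norm.\<close>

definition wave :: "real \<Rightarrow> real" where
  "wave t = max 0 (min 1 (1 / 2 - cos (pi * t)))"

lemma wave_bounds: "0 \<le> wave t" "wave t \<le> 1"
  by (auto simp: wave_def)

lemma cos_pi_periodic: "cos (pi * (2 * real k + x)) = cos (pi * x)"
proof -
  have "cos (pi * (2 * real k + x)) = cos (pi * x + 2 * real k * pi)"
    by (simp add: algebra_simps)
  also have "\<dots> = cos (pi * x)"
    by (simp add: cos_add mult.commute[of _ pi] mult.left_commute[of _ pi] flip: mult.assoc)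
       (metis cos_2npi mult.commute mult.left_commute sin_2npi mult_zero_right diff_zero mult.right_neutral)
  finally show ?thesis .
qed

lemma wave_periodic: "wave (2 * real k + x) = wave x"
  by (simp add: wave_def cos_pi_periodic)

text \<open>The plateaus are the reason for clipping: the cosine is at least 1/2 on the first third
  of its half-period and at most -1/2 on the last third. So \<open>wave\<close> tells whether a
  ternary expansion starts with 0 or with 2.\<close>

lemma wave_low: "wave x = 0" if "0 \<le> x" "x \<le> 1 / 3"
proof -
  have "cos (pi / 3) \<le> cos (pi * x)"
    using that by (intro cos_monotone_0_pi_le) (auto simp: field_simps)
  then show ?thesis by (simp add: wave_def cos_60)
qed

lemma wave_high: "wave x = 1" if "2 / 3 \<le> x" "x \<le> 1"
proof -
  have "cos (pi * x) \<le> cos (pi - pi / 3)"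
    using that by (intro cos_monotone_0_pi_le) (auto simp: field_simps)
  also have "\<dots> = - 1 / 2" by (subst cos_pi_minus) (simp add: cos_60)
  finally show ?thesis by (simp add: wave_def)
qed

section \<open>Ternary and binary digits\<close>

definition ternary :: "(nat \<Rightarrow> real) \<Rightarrow> real" where
  "ternary c = (\<Sum>m. 2 * c m / 3 ^ Suc m)"

lemma ternary_sum:
  assumes "range c \<subseteq> {0, 1}"
  shows "summable (\<lambda>m. 2 * c m / 3 ^ Suc m)" and "0 \<le> ternary c" and "ternary c \<le> 1"
proof -
  have c: "0 \<le> c m" "c m \<le> 1" for m
    using assms[unfolded subset_iff, rule_format, of "c m"] by auto
  have g: "(\<lambda>m. 2 / 3 * (1 / 3) ^ m :: real) sums (2 / 3 * (1 / (1 - 1 / 3)))"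
    by (intro sums_mult geometric_sums) simp
  have le: "2 * c m / 3 ^ Suc m \<le> 2 / 3 * (1 / 3) ^ m" for m
    using c[of m] by (simp add: field_simps)
  show s: "summable (\<lambda>m. 2 * c m / 3 ^ Suc m)"
    by (rule summable_comparison_test'[OF sums_summable[OF g], of 0]) (use le c in auto)
  show "0 \<le> ternary c"
    unfolding ternary_def by (intro suminf_nonneg s) (use c in auto)
  have "ternary c \<le> (\<Sum>m. 2 / 3 * (1 / 3) ^ m)"
    unfolding ternary_def by (intro suminf_le s sums_summable[OF g] le)
  also have "\<dots> = 1" using sums_unique[OF g] by simp
  finally show "ternary c \<le> 1" .
qed

text \<open>Multiplication by 3 shifts the digits. The digit that leaves is 0 or 2, a multiple of
  the period of \<open>wave\<close>.\<close>

lemma ternary_Suc: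
  assumes "range c \<subseteq> {0, 1}"
  shows "3 * ternary c = 2 * c 0 + ternary (\<lambda>m. c (Suc m))"
proof -
  have s: "summable (\<lambda>m. 2 * c (Suc m) / 3 ^ Suc m)"
    using ternary_sum(1)[of "\<lambda>m. c (Suc m)"] assms by auto
  have "ternary c = 2 * c 0 / 3 + (\<Sum>m. 2 * c (Suc m) / 3 ^ Suc (Suc m))"
    unfolding ternary_def using suminf_split_head[OF ternary_sum(1)[OF assms]] by simp
  also have "(\<Sum>m. 2 * c (Suc m) / 3 ^ Suc (Suc m)) = (\<Sum>m. 1 / 3 * (2 * c (Suc m) / 3 ^ Suc m))"
    by simp
  also have "\<dots> = 1 / 3 * ternary (\<lambda>m. c (Suc m))"
    unfolding ternary_def by (intro suminf_mult s)
  finally show ?thesis by simp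
qed

text \<open>Multiplying by \<open>3 ^ m\<close> moves m digits into the integer part, which stays
  even because every digit is 0 or 2; periodicity then removes it. N has to be arbitrary for the
  induction and later is the half-width of the cube.\<close>

lemma wave_ternary:
  assumes "range c \<subseteq> {0, 1}"
  shows "wave (3 ^ m * (2 * real N + ternary c)) = c m"
  using assms
proof (induction m arbitrary: c N)
  case 0
  have "range (\<lambda>m. c (Suc m)) \<subseteq> {0, 1}" using 0 by auto
  note t = ternary_sum[OF this] and S = ternary_Suc[OF 0]
  consider "c 0 = 0" | "c 0 = 1" using 0 by auto
  then show ?case
    by cases (use t S wave_low[of "ternary c"] wave_high[of "ternary c"] in \<open>auto simp: wave_periodic\<close>)
next
  case (Suc m)
  have r: "range (\<lambda>m. c (Suc m)) \<subseteq> {0, 1}" using Suc.prems by auto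
  obtain n where n: "c 0 = real n"
    using Suc.prems by (metis insert_iff of_nat_0 of_nat_1 rangeI singletonD subsetD)
  have "3 * (2 * real N + ternary c) = 2 * real (3 * N + n) + ternary (\<lambda>m. c (Suc m))"
    using ternary_Suc[OF Suc.prems] n by simp
  then have "3 ^ Suc m * (2 * real N + ternary c)
      = 3 ^ m * (2 * real (3 * N + n) + ternary (\<lambda>m. c (Suc m)))"
    by (metis mult.assoc power_Suc2)
  then show ?case by (simp only: Suc.IH[OF r])
qed

definition binary_digit :: "nat \<Rightarrow> real \<Rightarrow> real" where
  "binary_digit k y = real_of_int \<lfloor>2 ^ Suc k * y\<rfloor> - 2 * real_of_int \<lfloor>2 ^ k * y\<rfloor>"

lemma binary_digit_range: "binary_digit k y \<in> {0, 1}"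
proof -
  define z where "z = 2 ^ k * y"
  have "\<lfloor>2 * z\<rfloor> - 2 * \<lfloor>z\<rfloor> \<in> {0, 1}" by simp linarith
  then show ?thesis by (auto simp: binary_digit_def z_def mult.assoc) 
qed

text \<open>The digits telescope to the truncations of y; the condition \<open>y < 1\<close> makes
  the initial integer part vanish.\<close>

lemma binary_digit_sums:
  assumes "0 \<le> y" "y < 1"
  shows "(\<lambda>k. binary_digit k y / 2 ^ Suc k) sums y"
proof -
  have "(\<Sum>k<n. binary_digit k y / 2 ^ Suc k) = real_of_int \<lfloor>2 ^ n * y\<rfloor> / 2 ^ n" for n
  proof (induction n)
    case 0
    then show ?case using assms by (simp add: floor_eq_iff)
  next
    case (Suc n)
    then show ?case by (simp add: binary_digit_def field_simps)
  qed
  moreover have "(\<lambda>n. real_of_int \<lfloor>2 ^ n * y\<rfloor> / 2 ^ n) \<longlonglongrightarrow> y"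
  proof (rule tendsto_sandwich[OF always_eventually always_eventually])
    have "(\<lambda>n. y - (1 / 2) ^ n) \<longlonglongrightarrow> y - 0"
      by (intro tendsto_intros) simp
    then show "(\<lambda>n. y - (1 / 2) ^ n) \<longlonglongrightarrow> y" by simp
    show "\<forall>n. real_of_int \<lfloor>2 ^ n * y\<rfloor> / 2 ^ n \<le> y"
      by (simp add: field_simps of_int_floor_le)
    show "\<forall>n. y - (1 / 2) ^ n \<le> real_of_int \<lfloor>2 ^ n * y\<rfloor> / 2 ^ n"
    proof
      fix n
      have "2 ^ n * y - 1 \<le> real_of_int \<lfloor>2 ^ n * y\<rfloor>" by linarith
      then have "(2 ^ n * y - 1) / 2 ^ n \<le> real_of_int \<lfloor>2 ^ n * y\<rfloor> / 2 ^ n"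
        by (intro divide_right_mono) auto
      then show "y - (1 / 2) ^ n \<le> real_of_int \<lfloor>2 ^ n * y\<rfloor> / 2 ^ n"
        by (simp add: diff_divide_distrib power_one_over)
    qed
  qed simp
  ultimately show ?thesis by (simp add: sums_def)
qed

text \<open>Coordinate i of the curve: \<open>prod_encode\<close> allots to it ternary positions of
  its own, and the digits found there serve as binary digits.\<close>

definition wave_series :: "nat \<Rightarrow> real \<Rightarrow> real" where
  "wave_series i t = (\<Sum>k. wave (3 ^ prod_encode (k, i) * t) / 2 ^ Suc k)"

lemma continuous_on_wave_series: "continuous_on UNIV (wave_series i)"
proof -
  have "summable (\<lambda>k. (1 / 2) ^ Suc k :: real)"
    by (simp add: summable_geometric)
  then have "uniform_limit UNIV (\<lambda>n t. \<Sum>k<n. wave (3 ^ prod_encode (k, i) * t) / 2 ^ Suc k)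
      (wave_series i) sequentially"
    unfolding wave_series_def
    by (intro Weierstrass_m_test[of UNIV _ "\<lambda>k. (1 / 2) ^ Suc k"])
       (use wave_bounds in \<open>auto simp: power_one_over field_simps\<close>)
  then show ?thesis
    by (rule uniform_limit_theorem[rotated])
       (auto intro!: always_eventually continuous_intros simp: wave_def)
qed

text \<open>
  A Schoenberg-type space-filling curve: on \<open>[2N, 2N + 1]\<close> it covers the cube \<open>[-N, N]\<^sup>D\<close>, because
  the ternary digits of the parameter encode the binary digits of all the coordinates and
  \<open>t / 2 - arccos (cos (pi * t)) / (2 * pi)\<close> is constantly \<open>N\<close> there.
\<close>

definition space_filling :: "real \<Rightarrow> 'a::euclidean_space" where
  "space_filling t = (\<Sum>b\<in>Basis. ((t / 2 - arccos (cos (pi * t)) / (2 * pi))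
      * (2 * wave_series (to_nat_on Basis b) t - 1)) *\<^sub>R b)"

text \<open>The summand 1 in N makes N positive and \<open>norm x < N\<close> strict, so the
  rescaled coordinates stay below 1, as their binary expansion requires.\<close>

definition space_section :: "'a::euclidean_space \<Rightarrow> real" where
  "space_section x = (let N = nat \<lceil>norm x\<rceil> + 1 in 2 * real N +
     ternary (\<lambda>m. binary_digit (fst (prod_decode m))
       ((x \<bullet> from_nat_into Basis (snd (prod_decode m)) / real N + 1) / 2)))"

lemma continuous_on_space_filling: "continuous_on UNIV space_filling"
  unfolding space_filling_def
  by (intro continuous_intros continuous_on_subset[OF continuous_on_wave_series] continuous_on_arccos) auto

text \<open>Linear growth carries tightness over to the line. The 5 consists of twice 2, for
  rounding the norm up and for the added 1 in N, and of 1 for the ternary part.\<close>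

lemma space_section_bounds: "0 \<le> space_section x" "space_section x \<le> 2 * norm x + 5"
proof -
  define n where "n = nat \<lceil>norm x\<rceil>"
  define T where "T = ternary (\<lambda>m. binary_digit (fst (prod_decode m))
       ((x \<bullet> from_nat_into Basis (snd (prod_decode m)) / real (n + 1) + 1) / 2))"
  have "0 \<le> T" "T \<le> 1"
    unfolding T_def by (intro ternary_sum; use binary_digit_range in blast)+
  moreover have "real n \<le> norm x + 1"
    using of_int_ceiling_le_add_one[of "norm x"] norm_ge_zero[of x]
    unfolding n_def by (auto simp del: norm_ge_zero)
  moreover have "space_section x = 2 * real n + 2 + T"
    by (simp add: space_section_def n_def T_def Let_def)
  ultimately show "0 \<le> space_section x" "space_section x \<le> 2 * norm x + 5"
    using of_nat_0_le_iff[of n] by linarith+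
qed

lemma space_filling_section: "space_filling (space_section x) = (x :: 'a::euclidean_space)"
proof -
  define N where "N = nat \<lceil>norm x\<rceil> + 1"
  define y where "y b = (x \<bullet> b / real N + 1) / 2" for b
  define c where "c m = binary_digit (fst (prod_decode m)) (y (from_nat_into Basis (snd (prod_decode m))))" for m
  have c: "range c \<subseteq> {0, 1}" using binary_digit_range by (auto simp: c_def)
  define t where "t = space_section x"
  have t: "t = 2 * real N + ternary c"
    unfolding t_def space_section_def N_def c_def y_def Let_def by (rule refl)
  have N: "0 < real N" "norm x < real N" 
  proof -
    have "real N = real (nat \<lceil>norm x\<rceil>) + 1" unfolding N_def by (simp only: of_nat_add of_nat_1)
    then show "0 < real N" "norm x < real N"
      using real_nat_ceiling_ge[of "norm x"] of_nat_0_le_iff[of "nat \<lceil>norm x\<rceil>"] by linarith+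
  qed
  have b: "wave_series (to_nat_on Basis b) t = y b" if "b \<in> Basis" for b
  proof -
    have "\<bar>x \<bullet> b\<bar> < real N" using Basis_le_norm[OF that, of x] N by simp
    then have "0 \<le> y b" "y b < 1" using N(1) by (auto simp: y_def field_simps)
    then have "(\<lambda>k. binary_digit k (y b) / 2 ^ Suc k) sums y b" by (rule binary_digit_sums)
    moreover have "wave (3 ^ prod_encode (k, to_nat_on Basis b) * t) = binary_digit k (y b)" for k
      using wave_ternary[OF c, of "prod_encode (k, to_nat_on Basis b)" N] that
      by (simp add: t c_def countable_finite)
    ultimately show ?thesis by (simp add: wave_series_def sums_iff)
  qed
  have "cos (pi * t) = cos (pi * ternary c)" by (simp add: t cos_pi_periodic)
  then have "arccos (cos (pi * t)) = pi * ternary c"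
    using ternary_sum(2,3)[OF c] by (simp add: arccos_cos)
  then have "t / 2 - arccos (cos (pi * t)) / (2 * pi) = real N" by (simp add: t field_simps)
  then have "space_filling t = (\<Sum>b\<in>Basis. (real N * (2 * y b - 1)) *\<^sub>R b)"
    unfolding space_filling_def by (intro sum.cong) (simp_all add: b)
  also have "\<dots> = (\<Sum>b\<in>Basis. (x \<bullet> b) *\<^sub>R b)"
    using N(1) by (intro sum.cong) (simp_all add: y_def field_simps)
  finally show ?thesis by (simp add: euclidean_representation t_def)
qed

lemma borel_measurable_space_section: "space_section \<in> borel_measurable borel"
  unfolding space_section_def ternary_def binary_digit_def Let_def by measurable

text \<open>The laws travel to the line along the section, which only has to be Borel, and the limit
  returns along a continuous left inverse of it. Test functions are composed with the latter alone,
  so weak convergence on the line applies to them.\<close>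

lemma prokhorov_closed_convex:
  fixes K :: "'a::euclidean_space set" and M :: "nat \<Rightarrow> 'a measure"
  assumes K: "closed K" "convex K" "K \<noteq> {}"
    and M: "\<And>n. prob_space (M n)" and sets_M: "\<And>n. sets (M n) = sets (restrict_space borel K)"
    and tight: "\<And>e. 0 < e \<Longrightarrow> \<exists>r. \<forall>n. measure (M n) {x \<in> K. r < norm x} < e"
  obtains r N where "strict_mono (r :: nat \<Rightarrow> nat)" "prob_space N"
    "sets N = sets (restrict_space borel K)"
    "\<And>f::'a \<Rightarrow> real. continuous_on K f \<Longrightarrow> bounded (f ` K) \<Longrightarrow>
       (\<lambda>n. \<integral>x. f x \<partial>M (r n)) \<longlonglongrightarrow> (\<integral>x. f x \<partial>N)"
proof -
  have space_M: "space (M n) = K" for n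
    using sets_eq_imp_space_eq[OF sets_M[of n]] by (simp add: space_restrict_space)
  have s_meas: "space_section \<in> borel_measurable (M n)" for n
    unfolding measurable_cong_sets[OF sets_M refl]
    by (intro measurable_restrict_space1 borel_measurable_space_section)
  define Q where "Q n = distr (M n) borel space_section" for n
  have Q: "real_distribution (Q n)" for n
    unfolding Q_def by (intro prob_space.real_distribution_distr M s_meas)
  have "tight Q"
    unfolding tight_def
  proof (intro conjI allI impI Q)
    fix e :: real assume "0 < e"
    then obtain r where r: "\<And>n. measure (M n) {x \<in> K. r < norm x} < e" using tight by blast
    \<comment> \<open>A point of norm at most r has its section value in [0, 2 r + 5]. Taking
      \<open>max r 0\<close> keeps b above -1 even for negative r.\<close>
    define b where "b = 2 * max r 0 + 5"
    have "1 - e < measure (Q n) {-1<..b}" for n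
    proof -
      interpret prob_space "M n" by (rule M)
      have m: "{x \<in> K. r < norm x} \<in> sets (M n)"
        unfolding sets_M by (auto simp: sets_restrict_space image_iff intro!: bexI[of _ "{x. r < norm x}"])
      have "measure (M n) (space (M n) - {x \<in> K. r < norm x})
          \<le> measure (M n) (space_section -` {-1<..b} \<inter> space (M n))"
      proof (rule finite_measure_mono)
        show "space (M n) - {x \<in> K. r < norm x} \<subseteq> space_section -` {- 1<..b} \<inter> space (M n)"
        proof
          fix x assume "x \<in> space (M n) - {x \<in> K. r < norm x}"
          then show "x \<in> space_section -` {- 1<..b} \<inter> space (M n)"
            using space_section_bounds[of x] by (auto simp: b_def space_M)
        qed
      qed (use s_meas in \<open>measurable\<close>)
      then show ?thesis
        using r[of n] prob_compl[OF m] by (simp add: Q_def measure_distr[OF s_meas])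
    qed
    then show "\<exists>a b. a < b \<and> (\<forall>n. 1 - e < measure (Q n) {a<..b})"
      by (intro exI[of _ "-1"] exI[of _ b]) (auto simp: b_def)
  qed
  from tight_imp_convergent_subsubsequence[OF this strict_mono_id]
  obtain r q where r: "strict_mono (r :: nat \<Rightarrow> nat)" and q: "real_distribution q"
    and conv: "weak_conv_m (Q \<circ> id \<circ> r) q" by blast
  \<comment> \<open>The limit law may charge parameters at which the curve lies outside K. The
    metric projection, continuous because K is convex and closed, brings them back and fixes the
    points of K.\<close>
  define g where "g t = closest_point K (space_filling t)" for t
  have g: "continuous_on UNIV g"
    unfolding g_def using continuous_on_closest_point[OF K(2,1,3)] continuous_on_space_filling
    by (intro continuous_on_compose2[of UNIV "closest_point K" UNIV space_filling]) auto
  have gK: "g t \<in> K" for t unfolding g_def by (intro closest_point_in_set K)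
  have gs: "g (space_section x) = x" if "x \<in> K" for x
    using that by (simp add: g_def space_filling_section closest_point_self)
  have g_meas: "g \<in> measurable q (restrict_space borel K)"
    unfolding measurable_cong_sets[OF real_distribution.events_eq_borel[OF q] refl]
    using gK g by (intro measurable_restrict_space2 borel_measurable_continuous_onI) auto
  define N where "N = distr q (restrict_space borel K) g"
  show thesis
  proof
    show "prob_space N"
      unfolding N_def using q g_meas by (intro prob_space.prob_space_distr real_distribution.axioms)
    fix f :: "'a \<Rightarrow> real" assume f: "continuous_on K f" "bounded (f ` K)"
    have f_meas: "f \<in> borel_measurable (restrict_space borel K)"
      by (rule borel_measurable_continuous_on_restrict[OF f(1)])
    have fg: "continuous_on UNIV (\<lambda>t. f (g t))"
      using gK by (intro continuous_on_compose2[OF f(1) g]) auto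
    obtain C where C: "\<And>x. x \<in> K \<Longrightarrow> norm (f x) \<le> C"
      using f(2) by (auto simp: bounded_iff)
    have "(\<lambda>n. \<integral>t. f (g t) \<partial>(Q \<circ> id \<circ> r) n) \<longlonglongrightarrow> (\<integral>t. f (g t) \<partial>q)"
      by (rule weak_conv_imp_integral_bdd_continuous_conv[of _ _ _ C])
         (use Q q conv fg C gK in \<open>auto simp: continuous_on_eq_continuous_at comp_def\<close>)
    moreover have "(\<integral>t. f (g t) \<partial>Q n) = (\<integral>x. f x \<partial>M n)" for n
      unfolding Q_def
      using borel_measurable_continuous_onI[OF fg]
      by (subst integral_distr[OF s_meas]) (auto intro!: Bochner_Integration.integral_cong simp: space_M gs)
    moreover have "(\<integral>x. f x \<partial>N) = (\<integral>t. f (g t) \<partial>q)"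
      unfolding N_def by (rule integral_distr[OF g_meas f_meas])
    ultimately show "(\<lambda>n. \<integral>x. f x \<partial>M (r n)) \<longlonglongrightarrow> (\<integral>x. f x \<partial>N)" by simp
  qed (use r in \<open>auto simp: N_def\<close>)
qed

section \<open>Positive semidefinite matrices\<close>

definition outer :: "real^'n \<Rightarrow> real^'n^'n" where
  "outer v = (\<chi> i j. v $ i * v $ j)"

lemma sym_mats_iff: "x \<in> sym_mats \<longleftrightarrow> (\<forall>i j. x $ i $ j = x $ j $ i)"
  unfolding sym_mats_def transpose_def vec_eq_iff by auto

lemma subspace_sym_mats: "subspace sym_mats"
  by (auto simp: subspace_def sym_mats_iff)

lemmas sym_mats_add = subspace_add[OF subspace_sym_mats]
  and sym_mats_diff = subspace_diff[OF subspace_sym_mats]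
  and sym_mats_scaleR = subspace_scale[OF subspace_sym_mats]

lemma inner_outer: "x \<bullet> outer v = v \<bullet> (x *v v)"
  by (simp add: inner_vec_def outer_def matrix_vector_mult_def sum_distrib_left mult_ac)

text \<open>In this form every condition is linear in x, so the cone is a subspace cut by closed
  half-spaces.\<close>

lemma psd_cone_iff: "x \<in> psd_cone \<longleftrightarrow> x \<in> sym_mats \<and> (\<forall>v. 0 \<le> x \<bullet> outer v)"
  by (simp add: psd_cone_def inner_outer)

lemma psd_cone_sym: "x \<in> psd_cone \<Longrightarrow> x \<in> sym_mats"
  by (simp add: psd_cone_iff)

lemma psd_cone_0: "0 \<in> psd_cone"
  by (simp add: psd_cone_iff sym_mats_iff)

lemma psd_cone_add: "x \<in> psd_cone \<Longrightarrow> y \<in> psd_cone \<Longrightarrow> x + y \<in> psd_cone"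
  by (simp add: psd_cone_iff sym_mats_add inner_add_left)

lemma psd_cone_scaleR: "x \<in> psd_cone \<Longrightarrow> 0 \<le> c \<Longrightarrow> c *\<^sub>R x \<in> psd_cone"
  by (simp add: psd_cone_iff sym_mats_scaleR)

lemma outer_scaleR: "outer (c *\<^sub>R v) = c\<^sup>2 *\<^sub>R outer v"
  by (simp add: outer_def vec_eq_iff power2_eq_square)

lemma outer_0: "outer 0 = 0"
  by (simp add: outer_def vec_eq_iff)

lemma outer_inner_outer: "outer w \<bullet> outer v = (w \<bullet> v)\<^sup>2"
  by (simp add: inner_vec_def outer_def power2_eq_square sum_product mult_ac)

lemma outer_psd: "outer v \<in> psd_cone"
  by (simp add: psd_cone_iff outer_inner_outer) (simp add: sym_mats_iff outer_def)

lemma norm_outer: "norm (outer v) = (norm v)\<^sup>2"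
  by (simp add: norm_eq_sqrt_inner[of "outer v"] outer_inner_outer power2_norm_eq_inner)

lemma mat_1_inner: "x \<bullet> mat 1 = trace x"
proof -
  have "(\<Sum>j\<in>UNIV. x $ i $ j * (if i = j then 1 else 0)) = x $ i $ i" for i
    by (simp add: if_distrib[of "\<lambda>t. _ * t"] cong: if_cong)
  then show ?thesis by (simp add: inner_vec_def mat_def trace_def)
qed

lemma mat_1_outer: "mat 1 \<bullet> outer v = (norm v)\<^sup>2"
  by (simp add: inner_outer power2_norm_eq_inner)

lemma mat_1_psd: "mat 1 \<in> psd_cone"
  by (simp add: psd_cone_iff mat_1_outer) (auto simp: sym_mats_iff mat_def)

lemma closed_psd_cone: "closed (psd_cone :: (real^'n^'n) set)"
proof -
  have "psd_cone = (\<Inter>i j. {x::real^'n^'n. x $ i $ j = x $ j $ i}) \<inter> (\<Inter>v. {x. 0 \<le> x \<bullet> outer v})"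
    by (auto simp: psd_cone_iff sym_mats_iff)
  moreover have "closed \<dots>"
    by (intro closed_Int closed_INT ballI closed_Collect_eq closed_Collect_le continuous_intros)
  ultimately show ?thesis by simp
qed

lemma convex_psd_cone: "convex psd_cone"
  by (auto simp: convex_def intro!: psd_cone_add psd_cone_scaleR)

section \<open>Rank-one decompositions and self-duality of the cone\<close>

lemma matrix_mult_axis: "((x::real^'n^'n) *v axis a 1) $ i = x $ i $ a"
  by (simp add: matrix_vector_mult_basis column_def)

text \<open>This is the quadratic form at v plus t times the a-th unit vector; its nonnegativity for
  all t controls row a of x.\<close>

lemma psd_quadratic:
  fixes x :: "real^'n^'n"
  assumes "x \<in> psd_cone"
  shows "0 \<le> v \<bullet> (x *v v) + 2 * t * (x $ a \<bullet> v) + t\<^sup>2 * x $ a $ a"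
proof -
  have sym: "x $ i $ j = x $ j $ i" for i j using assms by (simp add: psd_cone_iff sym_mats_iff)
  have 1: "axis a 1 \<bullet> (x *v v) = x $ a \<bullet> v"
    by (simp add: inner_axis inner_commute[of "axis a 1"]) (simp add: matrix_vector_mult_def inner_vec_def)
  have 2: "v \<bullet> (x *v axis a 1) = x $ a \<bullet> v"
    by (simp add: inner_vec_def matrix_mult_axis sym[of _ a] mult.commute)
  have 3: "axis a 1 \<bullet> (x *v axis a 1) = x $ a $ a"
    by (simp add: inner_axis inner_commute[of "axis a 1"] matrix_mult_axis)
  have "0 \<le> (v + t *\<^sub>R axis a 1) \<bullet> (x *v (v + t *\<^sub>R axis a 1))"
    using assms by (simp add: psd_cone_def)
  also have "\<dots> = v \<bullet> (x *v v) + 2 * t * (x $ a \<bullet> v) + t\<^sup>2 * x $ a $ a"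
    by (simp add: matrix_vector_right_distrib matrix_vector_mult_scaleR inner_add_left inner_add_right
        1 2 3 power2_eq_square algebra_simps)
  finally show ?thesis .
qed

text \<open>The induction step is one step of a Cholesky factorisation.\<close>

lemma psd_sum_outer_aux:
  fixes x :: "real^'n^'n"
  assumes "finite S" "x \<in> psd_cone" "\<And>i j. i \<notin> S \<Longrightarrow> x $ i $ j = 0"
  shows "\<exists>w. x = (\<Sum>k\<in>S. outer (w k))"
  using assms
proof (induction S arbitrary: x rule: finite_induct)
  case empty
  then show ?case by (simp add: vec_eq_iff)
next
  case (insert a S)
  have sym: "x $ i $ j = x $ j $ i" for i j using insert.prems by (simp add: psd_cone_iff sym_mats_iff)
  define d where "d = x $ a $ a"
  have d: "0 \<le> d" using psd_quadratic[OF insert.prems(1), of 0 1 a] by (simp add: d_def)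
  \<comment> \<open>For a zero pivot, division by zero gives r = 0. The elimination step remains
    correct because row a then vanishes, by \<open>row0\<close>.\<close>
  define r where "r = (1 / sqrt d) *\<^sub>R x $ a"
  have sq: "outer r = (1 / d) *\<^sub>R outer (x $ a)"
    using d by (simp add: r_def outer_scaleR power_divide)
  \<comment> \<open>With pivot 0 the quadratic is affine in t and nonnegative everywhere, so its
    slope is 0. The t chosen for the contradiction would bring it down to -1.\<close>
  have row0: "x $ a $ j = 0" if "d = 0" for j
  proof -
    define q where "q = axis j 1 \<bullet> (x *v axis j 1)"
    have q: "0 \<le> q + 2 * t * x $ a $ j" for t
      using psd_quadratic[OF insert.prems(1), of "axis j 1" t a] that by (simp add: d_def q_def inner_axis)
    show ?thesis
    proof (rule ccontr)
      assume "x $ a $ j \<noteq> 0"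
      then have e: "- (q + 1) / 2 / x $ a $ j * x $ a $ j = - (q + 1) / 2"
        by (rule nonzero_eq_divide_eq[THEN iffD1, OF _ refl])
      from q[of "- (q + 1) / 2 / x $ a $ j"] have "0 \<le> q + 2 * (- (q + 1) / 2 / x $ a $ j * x $ a $ j)"
        by (simp only: mult.assoc)
      then show False unfolding e by (simp add: field_simps)
    qed
  qed
  define x' where "x' = x - outer r"
  have "x' \<in> psd_cone"
  proof -
    have "0 \<le> x' \<bullet> outer v" for v
    proof -
      have "x' \<bullet> outer v = v \<bullet> (x *v v) - (x $ a \<bullet> v)\<^sup>2 / d"
        by (simp add: x'_def sq inner_diff_left inner_outer[of x] outer_inner_outer)
      also have "\<dots> \<ge> 0"
      proof (cases "d = 0")
        case True
        then show ?thesis using insert.prems(1) by (simp add: psd_cone_def)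
      next
        case False
        \<comment> \<open>The quadratic is minimal at t = - s / d, and its minimum is the quadratic
          form of the Schur complement.\<close>
        define s where "s = x $ a \<bullet> v"
        have "2 * (- s / d) * s + (- s / d)\<^sup>2 * d = - (s\<^sup>2 / d)"
          using False by (simp add: power2_eq_square)
        then show ?thesis
          using psd_quadratic[OF insert.prems(1), of v "- s / d" a]
          unfolding s_def[symmetric] d_def[symmetric] by linarith
      qed
      finally show ?thesis .
    qed
    then show ?thesis
      using psd_cone_sym[OF insert.prems(1)] psd_cone_sym[OF outer_psd[of r]]
      by (simp add: psd_cone_iff x'_def sym_mats_diff)
  qed
  moreover have "x' $ i $ j = 0" if "i \<notin> S" for i j
  proof (cases "i = a")
    case True
    have "x' $ a $ j = x $ a $ j - x $ a $ a * x $ a $ j / d"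
      by (simp add: x'_def sq) (simp add: outer_def)
    then show ?thesis using row0[of j] True by (cases "d = 0") (auto simp: d_def)
  next
    case False
    then have "x $ i $ j = 0" "x $ a $ i = 0" using insert.prems(2)[of i] that sym[of a i] by auto
    then show ?thesis by (simp add: x'_def sq) (simp add: outer_def)
  qed
  ultimately obtain w where w: "x' = (\<Sum>k\<in>S. outer (w k))" using insert.IH by blast
  have "x = (\<Sum>k\<in>insert a S. outer ((w(a := r)) k))"
  proof -
    have "(\<Sum>k\<in>S. outer ((w(a := r)) k)) = (\<Sum>k\<in>S. outer (w k))"
      using insert.hyps by (intro sum.cong) auto
    then show ?thesis using insert.hyps w unfolding x'_def by (simp add: diff_eq_eq add.commute)
  qed
  then show ?case by blast
qed

lemma psd_sum_outer:
  assumes "(x::real^'n^'n) \<in> psd_cone"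
  obtains w :: "'n \<Rightarrow> real^'n" where "x = (\<Sum>k\<in>(UNIV::'n set). outer (w k))"
  using psd_sum_outer_aux[OF finite[of UNIV] assms] by auto

text \<open>One half of self-duality: splitting u into rank-one terms reduces the claim to the
  defining inequality for x.\<close>

lemma inner_psd_nonneg:
  fixes x u :: "real^'n^'n"
  assumes "x \<in> psd_cone" "u \<in> psd_cone"
  shows "0 \<le> x \<bullet> u"
proof -
  obtain w :: "'n \<Rightarrow> real^'n" where w: "u = (\<Sum>k\<in>UNIV. outer (w k))" by (rule psd_sum_outer[OF assms(2)])
  have "0 \<le> x \<bullet> outer (w k)" for k using assms(1) unfolding psd_cone_iff by blast
  then show ?thesis unfolding w inner_sum_right by (intro sum_nonneg)
qed

text \<open>Norm and trace agree on rank-one terms; the norm is subadditive and the trace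
  additive.\<close>

lemma norm_le_trace:
  fixes x :: "real^'n^'n"
  assumes "x \<in> psd_cone"
  shows "norm x \<le> trace x"
proof -
  obtain w :: "'n \<Rightarrow> real^'n" where w: "x = (\<Sum>k\<in>UNIV. outer (w k))" by (rule psd_sum_outer[OF assms])
  have "norm x \<le> (\<Sum>k\<in>UNIV. norm (outer (w k)))" unfolding w by (rule norm_sum)
  also have "\<dots> = x \<bullet> mat 1"
    unfolding w by (simp add: inner_commute[of _ "mat 1"] inner_sum_right mat_1_outer norm_outer)
  finally show ?thesis by (simp add: mat_1_inner)
qed

lemma congruence_psd:
  assumes "u \<in> sym_mats" "\<alpha> \<in> psd_cone"
  shows "u ** \<alpha> ** u \<in> psd_cone"
proof -
  have t: "transpose u = u" "transpose \<alpha> = \<alpha>"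
    using assms by (auto simp: sym_mats_def psd_cone_def)
  have "v \<bullet> ((u ** \<alpha> ** u) *v v) = (u *v v) \<bullet> (\<alpha> *v (u *v v))" for v
    using dot_lmul_matrix[of v u] t(1)
    by (simp flip: matrix_vector_mul_assoc) (metis dot_lmul_matrix vector_transpose_matrix)
  moreover have "transpose (u ** \<alpha> ** u) = u ** \<alpha> ** u"
    by (simp add: matrix_transpose_mul t matrix_mul_assoc)
  ultimately show ?thesis using assms by (simp add: psd_cone_def sym_mats_def)
qed

text \<open>Compactness of the unit sphere makes strict positivity uniform, and homogeneity of
  degree 2 extends the bound to all vectors.\<close>

lemma posdef_lower_bound:
  fixes y :: "real^'n^'n"
  assumes "y \<in> sym_mats" "\<And>v. v \<noteq> 0 \<Longrightarrow> 0 < y \<bullet> outer v"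
  obtains c where "0 < c" "y - c *\<^sub>R mat 1 \<in> psd_cone"
proof -
  have "compact (sphere (0::real^'n) 1)" "sphere (0::real^'n) 1 \<noteq> {}" by auto
  moreover have "continuous_on (sphere 0 1) (\<lambda>v. y \<bullet> outer v)"
    unfolding outer_def inner_vec_def by (auto intro!: continuous_intros)
  ultimately obtain v0 where v0: "norm v0 = 1" "\<And>v. norm v = 1 \<Longrightarrow> y \<bullet> outer v0 \<le> y \<bullet> outer v"
    using continuous_attains_inf[of "sphere (0::real^'n) 1" "\<lambda>v. y \<bullet> outer v"] by auto
  define c where "c = y \<bullet> outer v0"
  have "0 \<le> (y - c *\<^sub>R mat 1) \<bullet> outer v" for v
  proof (cases "v = 0")
    case False
    have "c \<le> y \<bullet> outer ((1 / norm v) *\<^sub>R v)" using False by (simp add: c_def v0(2))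
    also have "\<dots> = (y \<bullet> outer v) / (norm v)\<^sup>2" by (simp add: outer_scaleR power_divide)
    finally show ?thesis using False by (simp add: inner_diff_left mat_1_outer field_simps)
  qed (simp add: outer_0)
  then have "y - c *\<^sub>R mat 1 \<in> psd_cone"
    using assms(1) psd_cone_sym[OF mat_1_psd] by (simp only: psd_cone_iff) (intro conjI allI sym_mats_diff sym_mats_scaleR, auto)
  moreover have "0 < c" using v0(1) assms(2)[of v0] unfolding c_def by force
  ultimately show ?thesis using that by blast
qed

section \<open>Uniqueness of Laplace transforms on the cone\<close>

text \<open>Indicators of closed sets are limits of continuous functions of the distance.\<close>

lemma measure_eqI_bounded_continuous:
  fixes P Q :: "'a::metric_space measure"
  assumes P: "prob_space P" "sets P = sets borel" and Q: "prob_space Q" "sets Q = sets borel"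
    and eq: "\<And>h::'a \<Rightarrow> real. continuous_on UNIV h \<Longrightarrow> bounded (range h) \<Longrightarrow> (\<integral>x. h x \<partial>P) = (\<integral>x. h x \<partial>Q)"
  shows "P = Q"
proof -
  interpret P: prob_space P by fact
  interpret Q: prob_space Q by fact
  have lim: "(\<lambda>n. \<integral>x. max 0 (1 - real n * infdist x S) \<partial>M) \<longlonglongrightarrow> measure M S"
    if M: "prob_space M" "sets M = sets borel" and S: "closed S" "S \<noteq> {}" for M :: "'a measure" and S
  proof -
    interpret prob_space M by fact
    have [measurable_cong]: "sets M = sets borel" by fact
    have [measurable]: "S \<in> sets borel" using S by simp
    have "(\<lambda>n. \<integral>x. max 0 (1 - real n * infdist x S) \<partial>M) \<longlonglongrightarrow> (\<integral>x. indicator S x \<partial>M)"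
    proof (rule integral_dominated_convergence[where w = "\<lambda>_. 1"])
      have "(\<lambda>n. max 0 (1 - real n * infdist x S)) \<longlonglongrightarrow> indicator S x" for x
      proof (cases "x \<in> S")
        case False
        then have d: "0 < infdist x S"
          using S by (metis in_closed_iff_infdist_zero infdist_nonneg order_le_less)
        obtain n0 :: nat where n0: "1 / infdist x S < real n0" using reals_Archimedean2 by blast
        have "max 0 (1 - real n * infdist x S) = 0" if "n \<ge> n0" for n
        proof -
          have "1 \<le> real n0 * infdist x S" using n0 d by (simp add: field_simps)
          also have "\<dots> \<le> real n * infdist x S" using that d by (intro mult_right_mono) auto
          finally show ?thesis by simp
        qed
        then show ?thesis using False
          by (intro tendsto_eventually) (auto simp: eventually_sequentially)
      qed simp
      then show "AE x in M. (\<lambda>n. max 0 (1 - real n * infdist x S)) \<longlonglongrightarrow> indicator S x" by simp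
      show "AE x in M. norm (max 0 (1 - real n * infdist x S)) \<le> 1" for n
        by (auto simp: infdist_nonneg)
      show "(\<lambda>x. max 0 (1 - real n * infdist x S)) \<in> borel_measurable M" for n
        using M(2) by (simp add: measurable_cong_sets[OF M(2) refl])
          (intro borel_measurable_continuous_onI continuous_intros)
    qed auto
    then show ?thesis using sets_eq_imp_space_eq[OF M(2)] by simp
  qed
  have closed: "emeasure P S = emeasure Q S" if S: "closed S" for S
  proof (cases "S = {}")
    case False
    have "(\<integral>x. max 0 (1 - real n * infdist x S) \<partial>P) = (\<integral>x. max 0 (1 - real n * infdist x S) \<partial>Q)" for n
    proof (rule eq)
      show "bounded (range (\<lambda>x. max 0 (1 - real n * infdist x S)))"
        unfolding bounded_iff by (intro exI[of _ 1]) (auto simp: infdist_nonneg)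
    qed (intro continuous_intros)
    then have "measure P S = measure Q S"
      using lim[OF P S False] lim[OF Q S False] LIMSEQ_unique by auto
    then show ?thesis by (simp add: P.emeasure_eq_measure Q.emeasure_eq_measure)
  qed simp
  show ?thesis
  proof (rule measure_eqI_generator_eq[where E = "Collect closed" and \<Omega> = UNIV and A = "\<lambda>_. UNIV"])
    show "Int_stable (Collect closed :: 'a set set)" by (auto simp: Int_stable_def)
    show "sets P = sigma_sets UNIV (Collect closed)" "sets Q = sigma_sets UNIV (Collect closed)"
      using P(2) Q(2) by (auto simp: borel_eq_closed)
  qed (use closed in auto)
qed

section \<open>The algebra spanned by the exponentials\<close>

inductive laplace_sum :: "(real^'n^'n \<Rightarrow> real) \<Rightarrow> bool" where
  exp: "u \<in> psd_cone \<Longrightarrow> laplace_sum (\<lambda>x. c * exp (- (u \<bullet> x)))"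
| add: "laplace_sum f \<Longrightarrow> laplace_sum g \<Longrightarrow> laplace_sum (\<lambda>x. f x + g x)"

lemma laplace_sum_const: "laplace_sum (\<lambda>x. c)"
  using laplace_sum.exp[OF psd_cone_0, of c] by simp

lemma laplace_sum_sum: "finite I \<Longrightarrow> (\<And>i. i \<in> I \<Longrightarrow> laplace_sum (f i)) \<Longrightarrow> laplace_sum (\<lambda>x. \<Sum>i\<in>I. f i x)"
  by (induction I rule: finite_induct) (simp_all add: laplace_sum_const laplace_sum.add)

lemma laplace_sum_exp_mult:
  assumes "laplace_sum f" "u \<in> psd_cone"
  shows "laplace_sum (\<lambda>x. (c * exp (- (u \<bullet> x))) * f x)"
  using assms(1)
proof induction
  case (exp v d)
  have "(\<lambda>x. (c * exp (- (u \<bullet> x))) * (d * exp (- (v \<bullet> x)))) = (\<lambda>x. (c * d) * exp (- ((u + v) \<bullet> x)))"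
    by (simp add: inner_add_left exp_add exp_diff exp_minus field_simps)
  then show ?case by (simp only: laplace_sum.exp[OF psd_cone_add[OF assms(2) exp]])
next
  case (add f g)
  from laplace_sum.add[OF add.IH] show ?case by (simp add: algebra_simps)
qed

text \<open>Exponents add and the cone is closed under addition, so the span of the exponentials is
  an algebra and contains all polynomials in finitely many of them.\<close>

lemma laplace_sum_mult:
  assumes "laplace_sum f" "laplace_sum g"
  shows "laplace_sum (\<lambda>x. f x * g x)"
  using assms(1)
proof induction
  case (exp u c)
  then show ?case by (rule laplace_sum_exp_mult[OF assms(2)])
next
  case (add f h)
  from laplace_sum.add[OF add.IH] show ?case by (simp add: algebra_simps)
qed

text \<open>Finitely many exponentials that separate the points of the cone and map it into a
  compact cube, where polynomials are uniformly dense in the continuous functions. The matrices in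
  the exponents are of rank one, hence in the cone, and span the symmetric matrices.\<close>

definition laplace_coords :: "real^'n^'n \<Rightarrow> real^'n^'n" where
  "laplace_coords x = (\<chi> i j. exp (- (outer (axis i 1 + axis j 1) \<bullet> x)))"

text \<open>Polarisation: the exponent at (i, j) is x_ii + 2 x_ij + x_jj, and for i = j this is 4
  x_ii, which explains the quarters.\<close>

definition laplace_coords_inv :: "real^'n^'n \<Rightarrow> real^'n^'n" where
  "laplace_coords_inv z =
     (\<chi> i j. (- ln (z $ i $ j) + ln (z $ i $ i) / 4 + ln (z $ j $ j) / 4) / 2)"

lemma laplace_coords_inv:
  assumes "x \<in> sym_mats"
  shows "laplace_coords_inv (laplace_coords x) = x"
proof -
  have sym: "x $ i $ j = x $ j $ i" for i j using assms by (simp add: sym_mats_iff)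
  have "outer (axis i 1 + axis j 1) \<bullet> x = x $ i $ i + 2 * x $ i $ j + x $ j $ j" for i j
  proof -
    have "outer (axis i 1 + axis j 1) \<bullet> x = (axis i 1 + axis j 1) \<bullet> (x *v (axis i 1 + axis j 1))"
      by (simp add: inner_commute[of _ x] inner_outer)
    also have "\<dots> = x $ i $ i + 2 * x $ i $ j + x $ j $ j"
      by (simp add: matrix_vector_right_distrib inner_add_left inner_add_right
          inner_commute[of "axis _ _"] inner_axis matrix_mult_axis sym[of j i])
    finally show ?thesis .
  qed
  then show ?thesis
    by (simp add: vec_eq_iff laplace_coords_inv_def laplace_coords_def field_simps)
qed

lemma Basis_matrixE:
  fixes b :: "real^'n^'n"
  assumes "b \<in> Basis"
  obtains i j where "b = axis i (axis j 1)"
  using assms unfolding Basis_vec_def by auto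

lemma laplace_sum_polynomial:
  fixes p :: "real^'n^'n \<Rightarrow> real"
  assumes "real_polynomial_function p"
  shows "laplace_sum (\<lambda>x. p (laplace_coords x))"
  using assms
proof induction
  case (linear f)
  interpret bounded_linear f by fact
  have "(\<lambda>x. f (laplace_coords x)) = (\<lambda>x. \<Sum>b\<in>Basis. (laplace_coords x \<bullet> b) * f b)"
    by (rule ext, subst (1) euclidean_representation[symmetric]) (simp add: sum scale)
  moreover have "laplace_sum (\<lambda>x. (laplace_coords x \<bullet> b) * f b)" if bB: "b \<in> Basis" for b :: "real^'n^'n"
  proof -
    obtain i j where b: "b = axis i (axis j 1)" by (rule Basis_matrixE[OF bB])
    have "(\<lambda>x. (laplace_coords x \<bullet> b) * f b) = (\<lambda>x. f b * exp (- (outer (axis i 1 + axis j 1) \<bullet> x)))"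
      by (simp add: b inner_axis laplace_coords_def mult.commute)
    then show ?thesis by (simp only:) (rule laplace_sum.exp[OF outer_psd])
  qed
  ultimately show ?case by (simp only:) (intro laplace_sum_sum finite_Basis)
qed (auto intro: laplace_sum_const laplace_sum.add laplace_sum_mult)

lemma sets_psd_borel: "A \<in> sets psd_borel \<longleftrightarrow> A \<in> sets borel \<and> A \<subseteq> psd_cone"
  using borel_closed[OF closed_psd_cone] by (subst sets_restrict_space_iff) auto

lemma space_psd_borel: "sets M = sets psd_borel \<Longrightarrow> space M = psd_cone"
  using sets_eq_imp_space_eq[of M psd_borel] by (simp add: space_restrict_space)

lemma borel_measurable_psd_borel:
  assumes "sets M = sets psd_borel" "f \<in> borel_measurable borel"
  shows "f \<in> borel_measurable M"
  unfolding measurable_cong_sets[OF assms(1) refl] by (rule measurable_restrict_space1[OF assms(2)])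

lemma integrable_psd_exp:
  assumes "prob_space M" "sets M = sets psd_borel" "u \<in> psd_cone"
  shows "integrable M (\<lambda>x. exp (- (u \<bullet> x)))"
proof -
  interpret prob_space M by fact
  have "(\<lambda>x. exp (- (u \<bullet> x))) \<in> borel_measurable M"
    by (rule borel_measurable_psd_borel[OF assms(2)]) simp
  then show ?thesis
    by (rule integrable_const_bound[of _ 1, rotated])
       (use assms in \<open>auto simp: space_psd_borel inner_psd_nonneg\<close>)
qed

lemma measurable_laplace_coords: "laplace_coords \<in> borel_measurable borel"
  unfolding laplace_coords_def by (intro borel_measurable_continuous_onI continuous_intros)

lemma measurable_laplace_coords_inv:
  "(laplace_coords_inv :: real^'n^'n \<Rightarrow> real^'n^'n) \<in> borel_measurable borel"
proof -
  have [measurable]: "(\<lambda>z::real^'n^'n. z $ i $ j) \<in> borel_measurable borel" for i j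
    by (intro borel_measurable_continuous_onI continuous_intros)
  have "(\<lambda>z::real^'n^'n. laplace_coords_inv z \<bullet> b) \<in> borel_measurable borel" if bB: "b \<in> Basis"
    for b :: "real^'n^'n"
  proof -
    obtain i j where b: "b = axis i (axis j 1)" by (rule Basis_matrixE[OF bB])
    show ?thesis by (simp add: b inner_axis laplace_coords_inv_def)
  qed
  then show ?thesis by (rule borel_measurable_euclidean_space[THEN iffD2, rule_format])
qed

text \<open>The cone is not compact, so the measures are moved into the cube. There polynomials
  approximate every continuous function, which makes the two images equal, and the measurable left
  inverse of the coordinates transports the equality back.\<close>

lemma psd_laplace_unique:
  fixes P Q :: "(real^'n^'n) measure"
  assumes P: "prob_space P" "sets P = sets psd_borel" and Q: "prob_space Q" "sets Q = sets psd_borel"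
    and eq: "\<And>u. u \<in> psd_cone \<Longrightarrow> (\<integral>x. exp (- (u \<bullet> x)) \<partial>P) = (\<integral>x. exp (- (u \<bullet> x)) \<partial>Q)"
  shows "P = Q"
proof -
  have lap: "integrable P f \<and> integrable Q f \<and> (\<integral>x. f x \<partial>P) = (\<integral>x. f x \<partial>Q)" if "laplace_sum f" for f
    using that
  proof induction
    case (exp u c)
    then show ?case using integrable_psd_exp[OF P] integrable_psd_exp[OF Q] eq by simp
  qed auto
  note meas = borel_measurable_psd_borel[OF _ measurable_laplace_coords]
  define C where "C = cbox (0::real^'n^'n) (\<chi> i j. 1)"
  have C: "laplace_coords x \<in> C" if "x \<in> psd_cone" for x
    using that inner_psd_nonneg[OF outer_psd]
    by (auto simp: C_def mem_box Basis_vec_def inner_axis laplace_coords_def)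
  have conv: "(\<integral>x. h (laplace_coords x) \<partial>P) = (\<integral>x. h (laplace_coords x) \<partial>Q)"
    if h: "continuous_on UNIV h" for h :: "real^'n^'n \<Rightarrow> real"
  proof -
    have "\<bar>(\<integral>x. h (laplace_coords x) \<partial>P) - (\<integral>x. h (laplace_coords x) \<partial>Q)\<bar> \<le> e" if "0 < e" for e
    proof -
      have e: "0 < e / 2" using that by simp
      obtain g where g: "real_polynomial_function g" "\<And>z. z \<in> C \<Longrightarrow> \<bar>h z - g z\<bar> < e / 2"
        using Stone_Weierstrass_real_polynomial_function[of C h "e / 2"] e
          continuous_on_subset[OF h] unfolding C_def by (metis compact_cbox subset_UNIV)
      have g_lap: "laplace_sum (\<lambda>x. g (laplace_coords x))" by (rule laplace_sum_polynomial[OF g(1)])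
      have "\<bar>(\<integral>x. h (laplace_coords x) \<partial>M) - (\<integral>x. g (laplace_coords x) \<partial>M)\<bar> \<le> e / 2"
        if M: "prob_space M" "sets M = sets psd_borel" "integrable M (\<lambda>x. g (laplace_coords x))" for M
      proof -
        interpret prob_space M by fact
        have m: "(\<lambda>x. h (laplace_coords x)) \<in> borel_measurable M"
          by (rule measurable_compose[OF meas[OF M(2)] borel_measurable_continuous_onI[OF h]])
        obtain c where c: "\<And>z. z \<in> C \<Longrightarrow> \<bar>h z\<bar> \<le> c"
          using compact_imp_bounded[OF compact_continuous_image[OF continuous_on_subset[OF h, of C]]]
          unfolding C_def bounded_iff by (auto simp: compact_cbox)
        have i: "integrable M (\<lambda>x. h (laplace_coords x))"
          by (rule integrable_const_bound[of _ c]) (use m c C M(2) in \<open>auto simp: space_psd_borel\<close>)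
        have "\<bar>(\<integral>x. h (laplace_coords x) \<partial>M) - (\<integral>x. g (laplace_coords x) \<partial>M)\<bar>
            = \<bar>\<integral>x. h (laplace_coords x) - g (laplace_coords x) \<partial>M\<bar>"
          by (simp add: Bochner_Integration.integral_diff[OF i M(3)])
        also have "\<dots> \<le> (\<integral>x. \<bar>h (laplace_coords x) - g (laplace_coords x)\<bar> \<partial>M)"
          by (rule integral_abs_bound)
        also have "\<dots> \<le> (\<integral>x. e / 2 \<partial>M)"
          using C g(2) i M by (intro integral_mono) (auto simp: space_psd_borel less_imp_le)
        finally show ?thesis by (simp add: prob_space)
      qed
      from this[OF P] this[OF Q] lap[OF g_lap] show ?thesis by linarith
    qed
    from field_le_epsilon[of "\<bar>_\<bar>" 0, simplified, OF this] show ?thesis by simp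
  qed
  have "distr P borel laplace_coords = distr Q borel laplace_coords"
  proof (rule measure_eqI_bounded_continuous)
    fix h :: "real^'n^'n \<Rightarrow> real" assume h: "continuous_on UNIV h"
    show "(\<integral>x. h x \<partial>distr P borel laplace_coords) = (\<integral>x. h x \<partial>distr Q borel laplace_coords)"
      using conv[OF h] borel_measurable_continuous_onI[OF h]
      by (simp add: integral_distr meas P(2) Q(2))
  qed (use P Q meas in \<open>auto intro!: prob_space.prob_space_distr\<close>)
  note push = this
  \<comment> \<open>On the cone the two coordinate maps cancel, so A is the preimage of a Borel set
    under \<open>laplace_coords\<close>.\<close>
  have push_emeasure: "emeasure M A = emeasure (distr M borel laplace_coords) (laplace_coords_inv -` A)"
    if M: "sets M = sets psd_borel" and A: "A \<in> sets M" for M A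
  proof -
    have AK: "A \<in> sets borel" "A \<subseteq> psd_cone" using A unfolding M sets_psd_borel by auto
    have "laplace_coords_inv -` A \<in> sets borel"
      using measurable_sets[OF measurable_laplace_coords_inv AK(1)] by simp
    moreover have "laplace_coords -` laplace_coords_inv -` A \<inter> space M = A"
      using AK(2) by (auto simp: space_psd_borel[OF M] laplace_coords_inv psd_cone_sym)
    ultimately show ?thesis by (simp add: emeasure_distr meas[OF M])
  qed
  show ?thesis
  proof (rule measure_eqI)
    show "emeasure P A = emeasure Q A" if "A \<in> sets P" for A
      using push_emeasure[OF P(2) that] push_emeasure[OF Q(2), of A] that P(2) Q(2) push by simp
  qed (use P(2) Q(2) in simp)
qed

section \<open>Integration against matrix-valued measures\<close>

lemma sets_pos_variation: "sets (pos_variation \<nu>) = sets psd0_borel"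
proof -
  have "sigma_sets (psd_cone - {0}) (sets psd0_borel) = sets (psd0_borel :: (real^'n^'n) measure)"
    using sets.sigma_sets_eq[of "psd0_borel :: (real^'n^'n) measure"] by (simp add: space_restrict_space)
  then show ?thesis
    unfolding pos_variation_def by (subst sets_measure_of) (use sets_psd0_borel_D in auto)
qed

lemma space_pos_variation: "space (pos_variation \<nu>) = psd_cone - {0}"
  using sets_eq_imp_space_eq[OF sets_pos_variation[of \<nu>]] by (simp add: space_restrict_space)

lemma signed_measure_away_uminus: "signed_measure_away \<nu> \<Longrightarrow> signed_measure_away (\<lambda>A. - \<nu> A)"
  unfolding signed_measure_away_def by (auto intro!: sums_minus)

lemma signed_measure_away_trace:
  "psd_valued_measure \<eta> \<Longrightarrow> signed_measure_away (\<lambda>A. trace (\<eta> A))"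
  unfolding psd_valued_measure_def signed_measure_away_def trace_def by (auto intro!: sums_sum)

lemma away_sets_norm:
  assumes "E \<in> away_sets"
  obtains e where "0 < e" "\<And>x. x \<in> E \<Longrightarrow> e \<le> norm x"
proof -
  have "0 \<notin> closure E" using assms by (simp add: away_sets_def)
  then obtain e where "0 < e" "\<And>x. x \<in> E \<Longrightarrow> e \<le> dist x 0"
    unfolding closure_approachable by force
  then show ?thesis using that by auto
qed

lemma away_sets_norm_ge:
  fixes A :: "(real^'n^'n) set"
  assumes "A \<in> sets psd0_borel" "0 < e"
  shows "A \<inter> {x. e \<le> norm x} \<in> away_sets"
proof -
  have "psd_cone - {0::real^'n^'n} \<in> sets borel" using borel_closed[OF closed_psd_cone] by auto
  then have "A \<in> sets borel" "A \<subseteq> psd_cone - {0}"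
    using assms(1) by (simp_all add: sets_restrict_space_iff)
  moreover have "closure (A \<inter> {x. e \<le> norm x}) \<subseteq> {x. e \<le> norm x}"
    by (intro closure_minimal closed_Collect_le continuous_intros) auto
  then have "0 \<notin> closure (A \<inter> {x. e \<le> norm x})" using assms(2) by auto
  ultimately show ?thesis by (auto simp: away_sets_def)
qed

text \<open>A signed combination of the measures could subtract infinities, so the inequality is
  kept between two nonnegative sums. Both are additive, homogeneous and continuous along increasing
  sequences, which is why testing on sets suffices.\<close>

lemma nn_integral_sum_measures_mono:
  fixes c d :: "'k \<Rightarrow> real"
  assumes I: "finite I" and M: "\<And>k. k \<in> I \<Longrightarrow> sets (M k) = sets N"
    and le: "\<And>A. A \<in> sets N \<Longrightarrow>
      (\<Sum>k\<in>I. ennreal (c k) * emeasure (M k) A) \<le> (\<Sum>k\<in>I. ennreal (d k) * emeasure (M k) A)"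
    and f: "f \<in> borel_measurable N"
  shows "(\<Sum>k\<in>I. ennreal (c k) * (\<integral>\<^sup>+x. f x \<partial>M k)) \<le> (\<Sum>k\<in>I. ennreal (d k) * (\<integral>\<^sup>+x. f x \<partial>M k))"
  using f
proof (induct rule: borel_measurable_induct)
  case (cong f g)
  have "(\<integral>\<^sup>+x. f x \<partial>M k) = (\<integral>\<^sup>+x. g x \<partial>M k)" if "k \<in> I" for k
    using cong(3) sets_eq_imp_space_eq[OF M[OF that]] by (intro nn_integral_cong) simp
  then show ?case using cong(4) by simp
next
  case (set A)
  have "(\<integral>\<^sup>+x. indicator A x \<partial>M k) = emeasure (M k) A" if "k \<in> I" for k
    using set M[OF that] by simp
  then show ?case using le[OF set] by simp
next
  case (mult u a)
  have "(\<integral>\<^sup>+x. a * u x \<partial>M k) = a * (\<integral>\<^sup>+x. u x \<partial>M k)" if "k \<in> I" for k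
    using mult(2) by (intro nn_integral_cmult) (simp add: measurable_cong_sets[OF M[OF that] refl])
  then have "(\<Sum>k\<in>I. ennreal (b k) * (\<integral>\<^sup>+x. a * u x \<partial>M k))
      = a * (\<Sum>k\<in>I. ennreal (b k) * (\<integral>\<^sup>+x. u x \<partial>M k))" for b
    unfolding sum_distrib_left by (intro sum.cong) (simp_all add: mult_ac)
  then show ?case using mult(4) by (simp add: mult_left_mono)
next
  case (add u v)
  have "(\<integral>\<^sup>+x. v x + u x \<partial>M k) = (\<integral>\<^sup>+x. v x \<partial>M k) + (\<integral>\<^sup>+x. u x \<partial>M k)" if "k \<in> I" for k
    using add(1,4) by (intro nn_integral_add) (simp_all add: measurable_cong_sets[OF M[OF that] refl])
  then have "(\<Sum>k\<in>I. ennreal (b k) * (\<integral>\<^sup>+x. v x + u x \<partial>M k))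
      = (\<Sum>k\<in>I. ennreal (b k) * (\<integral>\<^sup>+x. v x \<partial>M k)) + (\<Sum>k\<in>I. ennreal (b k) * (\<integral>\<^sup>+x. u x \<partial>M k))" for b
    unfolding sum.distrib[symmetric] by (intro sum.cong) (simp_all add: distrib_left)
  then show ?case using add_mono[OF add(7) add(3)] by simp
next
  case (seq U)
  have "(\<lambda>i. \<integral>\<^sup>+x. U i x \<partial>M k) \<longlonglongrightarrow> (\<integral>\<^sup>+x. (SUP i. U i) x \<partial>M k)" if "k \<in> I" for k
  proof -
    have "(\<integral>\<^sup>+x. (SUP i. U i) x \<partial>M k) = (SUP i. \<integral>\<^sup>+x. U i x \<partial>M k)"
      unfolding SUP_apply using seq(1,4)
      by (intro nn_integral_monotone_convergence_SUP) (simp_all add: measurable_cong_sets[OF M[OF that] refl])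
    moreover have "incseq (\<lambda>i. \<integral>\<^sup>+x. U i x \<partial>M k)"
      using seq(4) by (auto simp: incseq_def le_fun_def intro!: nn_integral_mono)
    ultimately show ?thesis using LIMSEQ_SUP by metis
  qed
  then have lim: "(\<lambda>i. \<Sum>k\<in>I. ennreal (b k) * (\<integral>\<^sup>+x. U i x \<partial>M k))
      \<longlonglongrightarrow> (\<Sum>k\<in>I. ennreal (b k) * (\<integral>\<^sup>+x. (SUP i. U i) x \<partial>M k))" for b
    by (intro tendsto_sum ennreal_tendsto_cmult) auto
  show ?case by (rule LIMSEQ_le[OF lim lim]) (use seq(3) in auto)
qed

section \<open>Jordan parts of the entries of a matrix-valued measure\<close>

locale psd_measure =
  fixes \<mu> :: "(real^'n^'n) set \<Rightarrow> real^'n^'n"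
  assumes psd_valued: "psd_valued_measure \<mu>"
    and trace_integrable: "(\<integral>\<^sup>+\<xi>. ennreal (norm \<xi>) \<partial>trace_measure \<mu>) < \<infinity>"
begin

abbreviation entry :: "'n \<Rightarrow> 'n \<Rightarrow> (real^'n^'n) set \<Rightarrow> real" where
  "entry i j \<equiv> \<lambda>A. \<mu> A $ i $ j"

lemma signed_entry: "signed_measure_away (entry i j)"
  using psd_valued by (simp add: psd_valued_measure_def)

lemma value_psd: "E \<in> away_sets \<Longrightarrow> \<mu> E \<in> psd_cone"
  using psd_valued by (simp add: psd_valued_measure_def)

text \<open>Through this bound the first moment of the single measure \<open>trace_measure\<close>
  controls the Jordan parts of all entries.\<close>

lemma entry_le_trace:
  assumes "E \<in> away_sets"
  shows "\<bar>entry i j E\<bar> \<le> trace (\<mu> E)"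
  using Finite_Cartesian_Product.norm_nth_le[of "\<mu> E $ i" j]
    Finite_Cartesian_Product.norm_nth_le[of "\<mu> E" i] norm_le_trace[OF value_psd[OF assms]]
  by simp

lemma sets_trace_measure: "sets (trace_measure \<mu>) = sets psd0_borel"
  by (simp add: trace_measure_def sets_pos_variation)

lemma trace_measure_finite:
  assumes "E \<in> away_sets"
  shows "emeasure (trace_measure \<mu>) E < \<infinity>"
proof -
  obtain e where e: "0 < e" "\<And>x. x \<in> E \<Longrightarrow> e \<le> norm x" using away_sets_norm[OF assms] by blast
  have E: "E \<in> sets (trace_measure \<mu>)"
    using away_sets_in_psd0_borel[OF assms] by (simp add: sets_trace_measure)
  have "ennreal e * emeasure (trace_measure \<mu>) E = (\<integral>\<^sup>+x. ennreal e * indicator E x \<partial>trace_measure \<mu>)"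
    using E by (simp add: nn_integral_cmult_indicator)
  also have "\<dots> \<le> (\<integral>\<^sup>+x. ennreal (norm x) \<partial>trace_measure \<mu>)"
    using e by (intro nn_integral_mono) (auto simp: indicator_def intro!: ennreal_leI)
  also have "\<dots> < \<infinity>" by (rule trace_integrable)
  finally show ?thesis using e(1) by (auto simp: ennreal_mult_less_top less_top[symmetric] ennreal_mult_eq_top_iff)
qed

lemma variation_le_trace_measure:
  assumes "signed_measure_away \<nu>" "\<And>E. E \<in> away_sets \<Longrightarrow> \<nu> E \<le> trace (\<mu> E)"
  shows "pos_variation \<nu> \<le> trace_measure \<mu>"
proof (subst le_measure)
  show "\<forall>A\<in>sets (pos_variation \<nu>). emeasure (pos_variation \<nu>) A \<le> emeasure (trace_measure \<mu>) A"
    unfolding trace_measure_def sets_pos_variation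
    using assms(2) signed_measure_away_trace[OF psd_valued]
    by (auto simp: emeasure_pos_variation assms(1) intro!: SUP_mono ennreal_leI)
qed (simp add: sets_trace_measure sets_pos_variation)

text \<open>Indexing the Jordan parts by (i, j, sign) turns matrix integrals into finite sums over
  one type; True marks the positive part.\<close>

definition half :: "'n \<times> 'n \<times> bool \<Rightarrow> (real^'n^'n) measure" where
  "half k = (case k of (i, j, s) \<Rightarrow> pos_variation (if s then entry i j else (\<lambda>A. - entry i j A)))"

lemma sets_half: "sets (half k) = sets psd0_borel"
  by (auto simp: half_def sets_pos_variation split: prod.split)

lemma space_half: "space (half k) = psd_cone - {0}"
  by (auto simp: half_def space_pos_variation split: prod.split)

lemma half_le: "half k \<le> trace_measure \<mu>"
  unfolding half_def
  by (cases k) (auto intro!: variation_le_trace_measure signed_entry signed_measure_away_uminus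
      dest!: entry_le_trace simp: abs_le_iff)

lemma half_finite:
  assumes "E \<in> away_sets"
  shows "emeasure (half k) E < \<infinity>"
proof -
  have "emeasure (half k) E \<le> emeasure (trace_measure \<mu>) E"
    using half_le[of k] away_sets_in_psd0_borel[OF assms]
    by (subst (asm) le_measure) (auto simp: sets_half sets_trace_measure)
  also have "\<dots> < \<infinity>" by (rule trace_measure_finite[OF assms])
  finally show ?thesis .
qed

text \<open>For F inside E, \<nu> F is \<nu> E minus \<nu> (E - F), hence at most \<nu> E plus the
  negative variation of E. The supremum over F gives one inequality, and replacing \<nu> by its
  negative gives the other. Finiteness away from 0 permits the subtraction.\<close>

lemma half_jordan:
  assumes E: "E \<in> away_sets"
  shows "measure (half (i, j, True)) E - measure (half (i, j, False)) E = entry i j E"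
proof -
  have aux: "measure (pos_variation \<nu>) E \<le> \<nu> E + measure (pos_variation (\<lambda>A. - \<nu> A)) E"
    if \<nu>: "signed_measure_away \<nu>" and fin: "emeasure (pos_variation \<nu>) E < \<infinity>"
      "emeasure (pos_variation (\<lambda>A. - \<nu> A)) E < \<infinity>" for \<nu>
  proof -
    note E' = away_sets_in_psd0_borel[OF E]
    let ?n = "measure (pos_variation (\<lambda>A. - \<nu> A)) E"
    have "ennreal (\<nu> F) \<le> ennreal (\<nu> E + ?n)" if F: "F \<in> away_sets" "F \<subseteq> E" for F
    proof -
      have D: "E - F \<in> away_sets"
        using away_sets_Int[OF E, of "- F"] F by (auto simp: away_sets_def Diff_eq)
      have "\<nu> E = \<nu> F + \<nu> (E - F)"
        using signed_measure_away_Un[OF \<nu> F(1) D] F(2) by (simp add: Un_absorb1)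
      moreover have "ennreal (- \<nu> (E - F)) \<le> emeasure (pos_variation (\<lambda>A. - \<nu> A)) E"
        using D by (subst emeasure_pos_variation[OF signed_measure_away_uminus[OF \<nu>] E']) (auto intro!: SUP_upper)
      then have "- \<nu> (E - F) \<le> ?n"
        using fin(2) by (simp add: emeasure_eq_ennreal_measure less_top)
      ultimately show ?thesis by (intro ennreal_leI) simp
    qed
    then have "emeasure (pos_variation \<nu>) E \<le> ennreal (\<nu> E + ?n)"
      by (subst emeasure_pos_variation[OF \<nu> E']) (auto intro!: SUP_least)
    \<comment> \<open>\<open>ennreal\<close> sends negative reals to 0, so the sign has to be known
      before returning to an inequality between reals.\<close>
    moreover have "0 \<le> \<nu> E + ?n"
    proof -
      have "ennreal (- \<nu> E) \<le> emeasure (pos_variation (\<lambda>A. - \<nu> A)) E"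
        using E by (subst emeasure_pos_variation[OF signed_measure_away_uminus[OF \<nu>] E']) (auto intro!: SUP_upper)
      then have "- \<nu> E \<le> ?n"
        using fin(2) by (simp add: emeasure_eq_ennreal_measure less_top)
      then show ?thesis by simp
    qed
    ultimately show ?thesis
      using fin(1) by (simp add: emeasure_eq_ennreal_measure less_top)
  qed
  have "measure (half (i, j, True)) E \<le> entry i j E + measure (half (i, j, False)) E"
    using aux[OF signed_entry] half_finite[OF E, of "(i, j, True)"] half_finite[OF E, of "(i, j, False)"]
    by (simp add: half_def)
  moreover have "measure (half (i, j, False)) E \<le> - entry i j E + measure (half (i, j, True)) E"
    using aux[OF signed_measure_away_uminus[OF signed_entry[of i j]]]
      half_finite[OF E, of "(i, j, True)"] half_finite[OF E, of "(i, j, False)"]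
    by (simp add: half_def)
  ultimately show ?thesis by simp
qed

lemma signed_integral_half:
  "signed_integral (entry i j) f = (\<integral>\<xi>. f \<xi> \<partial>half (i, j, True)) - (\<integral>\<xi>. f \<xi> \<partial>half (i, j, False))"
  by (simp add: signed_integral_def half_def)

lemma integrable_half:
  fixes f :: "real^'n^'n \<Rightarrow> 'b::{banach, second_countable_topology}"
  assumes "f \<in> borel_measurable borel" "\<And>\<xi>. \<xi> \<in> psd_cone \<Longrightarrow> norm (f \<xi>) \<le> C * norm \<xi>"
  shows "integrable (half k) f"
proof (rule integrableI_bounded)
  show "f \<in> borel_measurable (half k)"
    unfolding measurable_cong_sets[OF sets_half refl] by (rule measurable_restrict_space1[OF assms(1)])
  have m: "(\<lambda>\<xi>. ennreal (norm \<xi>)) \<in> borel_measurable (half k)"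
    unfolding measurable_cong_sets[OF sets_half refl] by (rule measurable_restrict_space1) simp
  have "(\<integral>\<^sup>+\<xi>. ennreal (norm (f \<xi>)) \<partial>half k) \<le> (\<integral>\<^sup>+\<xi>. ennreal \<bar>C\<bar> * ennreal (norm \<xi>) \<partial>half k)"
  proof (rule nn_integral_mono)
    fix \<xi> assume "\<xi> \<in> space (half k)"
    then have "norm (f \<xi>) \<le> C * norm \<xi>" using assms(2) by (simp add: space_half)
    also have "\<dots> \<le> \<bar>C\<bar> * norm \<xi>" by (intro mult_right_mono) auto
    finally show "ennreal (norm (f \<xi>)) \<le> ennreal \<bar>C\<bar> * ennreal (norm \<xi>)"
      by (simp add: ennreal_leI flip: ennreal_mult)
  qed
  also have "\<dots> = ennreal \<bar>C\<bar> * (\<integral>\<^sup>+\<xi>. ennreal (norm \<xi>) \<partial>half k)" by (rule nn_integral_cmult[OF m])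
  also have "(\<integral>\<^sup>+\<xi>. ennreal (norm \<xi>) \<partial>half k) \<le> (\<integral>\<^sup>+\<xi>. ennreal (norm \<xi>) \<partial>trace_measure \<mu>)"
    by (rule nn_integral_mono_measure[OF _ half_le]) (simp add: sets_half sets_trace_measure)
  finally show "(\<integral>\<^sup>+\<xi>. ennreal (norm (f \<xi>)) \<partial>half k) < \<infinity>"
    using trace_integrable by (auto simp: ennreal_mult_less_top mult_left_mono elim!: order.strict_trans1)
qed

text \<open>Pairing with y makes \<mu> a scalar set function that is nonnegative on sets away from
  0. Its positive and negative contributions stay on opposite sides of an inequality until f, being
  integrable, makes both finite.\<close>

lemma matrix_integral_nonneg:
  fixes f :: "real^'n^'n \<Rightarrow> real"
  assumes y: "y \<in> psd_cone" and f: "f \<in> borel_measurable borel"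
    and bounds: "\<And>\<xi>. \<xi> \<in> psd_cone \<Longrightarrow> 0 \<le> f \<xi>" "\<And>\<xi>. \<xi> \<in> psd_cone \<Longrightarrow> f \<xi> \<le> C * norm \<xi>"
  shows "0 \<le> y \<bullet> (\<chi> i j. signed_integral (entry i j) f)"
proof -
  \<comment> \<open>With these signs, y paired with the matrix of integrals becomes one sum over the
    Jordan parts.\<close>
  define e where "e k = (case k of (i, j, s) \<Rightarrow> if s then y $ i $ j else - (y $ i $ j))" for k :: "'n \<times> 'n \<times> bool"
  have e_sum: "(\<Sum>k\<in>UNIV. e k * g k) = (\<Sum>i\<in>UNIV. \<Sum>j\<in>UNIV. y $ i $ j * (g (i, j, True) - g (i, j, False)))" for g
  proof -
    have "(\<Sum>k\<in>UNIV. e k * g k) = (\<Sum>k\<in>UNIV \<times> UNIV \<times> UNIV. e k * g k)" by simp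
    also have "\<dots> = (\<Sum>i\<in>UNIV. \<Sum>j\<in>UNIV. \<Sum>s\<in>UNIV. e (i, j, s) * g (i, j, s))"
      unfolding sum.cartesian_product by (intro sum.cong) auto
    also have "\<dots> = (\<Sum>i\<in>UNIV. \<Sum>j\<in>UNIV. y $ i $ j * (g (i, j, True) - g (i, j, False)))"
      by (simp add: UNIV_bool e_def algebra_simps)
    finally show ?thesis .
  qed
  have e_split: "e k = max 0 (e k) - max 0 (- e k)" for k by auto
  have away: "(\<Sum>k\<in>UNIV. ennreal (max 0 (- e k)) * emeasure (half k) E)
      \<le> (\<Sum>k\<in>UNIV. ennreal (max 0 (e k)) * emeasure (half k) E)" if E: "E \<in> away_sets" for E
  proof -
    have "0 \<le> y \<bullet> \<mu> E" by (rule inner_psd_nonneg[OF y value_psd[OF E]])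
    also have "\<dots> = (\<Sum>k\<in>UNIV. e k * measure (half k) E)"
      by (simp add: e_sum half_jordan[OF E] inner_vec_def)
    also have "\<dots> = (\<Sum>k\<in>UNIV. max 0 (e k) * measure (half k) E) - (\<Sum>k\<in>UNIV. max 0 (- e k) * measure (half k) E)"
      by (subst e_split) (simp only: left_diff_distrib sum_subtractf)
    finally have "(\<Sum>k\<in>UNIV. max 0 (- e k) * measure (half k) E) \<le> (\<Sum>k\<in>UNIV. max 0 (e k) * measure (half k) E)"
      by simp
    moreover have "(\<Sum>k\<in>UNIV. ennreal (max 0 (b k)) * emeasure (half k) E)
        = ennreal (\<Sum>k\<in>UNIV. max 0 (b k) * measure (half k) E)" for b
    proof -
      have "emeasure (half k) E = ennreal (measure (half k) E)" for k
        using half_finite[OF E, of k] by (intro emeasure_eq_ennreal_measure) (simp add: less_top)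
      then show ?thesis by (simp add: ennreal_mult sum_nonneg flip: sum_ennreal)
    qed
    ultimately show ?thesis by (simp add: ennreal_leI)
  qed
  \<comment> \<open>A Borel set is exhausted by its parts outside shrinking balls around 0, and
    every part \<open>half k\<close> is continuous along this increasing sequence.\<close>
  have all: "(\<Sum>k\<in>UNIV. ennreal (max 0 (- e k)) * emeasure (half k) A)
      \<le> (\<Sum>k\<in>UNIV. ennreal (max 0 (e k)) * emeasure (half k) A)"
    if A: "A \<in> sets psd0_borel" for A
  proof -
    define B where "B n = A \<inter> {x. 1 / real (Suc n) \<le> norm x}" for n
    have B: "B n \<in> away_sets" for n unfolding B_def by (intro away_sets_norm_ge A) simp
    have "incseq B"
    proof (rule incseq_SucI)
      fix n
      have "1 / real (Suc (Suc n)) \<le> 1 / real (Suc n)" by (intro divide_left_mono) auto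
      then show "B n \<subseteq> B (Suc n)" unfolding B_def by (auto intro: order_trans)
    qed
    have "(\<Union>n. B n) = A"
    proof -
      have "\<exists>n. x \<in> B n" if "x \<in> A" for x
      proof -
        have "0 < norm x" using that sets_psd0_borel_D[OF A] by auto
        from nat_approx_posE[OF this] obtain n where "1 / real (Suc n) < norm x" by auto
        then show ?thesis using that by (auto simp: B_def intro!: exI[of _ n])
      qed
      then show ?thesis by (auto simp: B_def)
    qed
    then have "(\<lambda>n. emeasure (half k) (B n)) \<longlonglongrightarrow> emeasure (half k) A" for k
      using Lim_emeasure_incseq[of B "half k"] \<open>incseq B\<close> B away_sets_in_psd0_borel
      by (auto simp: sets_half image_subset_iff)
    then have lim: "(\<lambda>n. \<Sum>k\<in>UNIV. ennreal (b k) * emeasure (half k) (B n))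
        \<longlonglongrightarrow> (\<Sum>k\<in>UNIV. ennreal (b k) * emeasure (half k) A)" for b
      by (intro tendsto_sum ennreal_tendsto_cmult) auto
    show ?thesis by (rule LIMSEQ_le[OF lim lim]) (use away[OF B] in auto)
  qed
  have f_meas: "f \<in> borel_measurable psd0_borel" by (rule measurable_restrict_space1[OF f])
  have nn: "(\<Sum>k\<in>UNIV. ennreal (max 0 (- e k)) * (\<integral>\<^sup>+\<xi>. ennreal (f \<xi>) \<partial>half k))
      \<le> (\<Sum>k\<in>UNIV. ennreal (max 0 (e k)) * (\<integral>\<^sup>+\<xi>. ennreal (f \<xi>) \<partial>half k))"
    by (rule nn_integral_sum_measures_mono[OF _ sets_half all]) (use f_meas in auto)
  have int: "integrable (half k) f" for k
    by (rule integrable_half[OF f, of C]) (use bounds in auto)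
  have pos: "AE \<xi> in half k. 0 \<le> f \<xi>" for k
    by (rule AE_I2) (use bounds(1) in \<open>simp add: space_half\<close>)
  have "(\<Sum>k\<in>UNIV. ennreal (max 0 (b k)) * (\<integral>\<^sup>+\<xi>. ennreal (f \<xi>) \<partial>half k))
      = ennreal (\<Sum>k\<in>UNIV. max 0 (b k) * (\<integral>\<xi>. f \<xi> \<partial>half k))" for b
    using integral_nonneg_AE[OF pos]
    by (simp add: nn_integral_eq_integral[OF int pos] ennreal_mult sum_nonneg flip: sum_ennreal)
  with nn have "ennreal (\<Sum>k\<in>UNIV. max 0 (- e k) * (\<integral>\<xi>. f \<xi> \<partial>half k))
      \<le> ennreal (\<Sum>k\<in>UNIV. max 0 (e k) * (\<integral>\<xi>. f \<xi> \<partial>half k))" by simp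
  then have "(\<Sum>k\<in>UNIV. max 0 (- e k) * (\<integral>\<xi>. f \<xi> \<partial>half k)) \<le> (\<Sum>k\<in>UNIV. max 0 (e k) * (\<integral>\<xi>. f \<xi> \<partial>half k))"
    using integral_nonneg_AE[OF pos] by (subst (asm) ennreal_le_iff) (auto intro!: sum_nonneg)
  then have "0 \<le> (\<Sum>k\<in>UNIV. e k * (\<integral>\<xi>. f \<xi> \<partial>half k))"
    by (subst e_split) (simp only: left_diff_distrib sum_subtractf)
  then show ?thesis by (simp add: e_sum inner_vec_def signed_integral_half)
qed

lemma signed_integral_inner:
  "signed_integral (entry i j) (\<lambda>\<xi>. u \<bullet> \<xi>) = u \<bullet> signed_integral (entry i j) (\<lambda>\<xi>. \<xi>)"
proof -
  have "integrable (half k) (\<lambda>\<xi>. \<xi>)" for k by (rule integrable_half[of _ 1]) auto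
  then show ?thesis by (simp add: signed_integral_half inner_diff_right)
qed

lemma signed_integral_sym_mats: "signed_integral (entry i j) (\<lambda>\<xi>. \<xi>) \<in> sym_mats"
proof -
  have int: "integrable (half k) (\<lambda>\<xi>. \<xi>)" for k by (rule integrable_half[of _ 1]) auto
  have comp: "(\<integral>\<xi>. \<xi> \<partial>half k) $ a $ b = (\<integral>\<xi>. \<xi> $ a $ b \<partial>half k)" for k a b
    using integral_inner_left[OF int, of k "axis a (axis b 1)"] by (simp add: inner_axis)
  have "(\<integral>\<xi>. \<xi> \<partial>half k) \<in> sym_mats" for k
    unfolding sym_mats_iff comp
    by (intro allI Bochner_Integration.integral_cong refl)
       (use psd_cone_sym in \<open>auto simp: space_half sym_mats_iff\<close>)
  then show ?thesis unfolding signed_integral_half by (intro sym_mats_diff)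
qed

end

section \<open>A Lyapunov equation for cross-positive maps\<close>

lemma linear_on_symD:
  assumes "linear_on_sym L"
  shows "x \<in> sym_mats \<Longrightarrow> L x \<in> sym_mats"
    and "x \<in> sym_mats \<Longrightarrow> y \<in> sym_mats \<Longrightarrow> L (x + y) = L x + L y"
    and "x \<in> sym_mats \<Longrightarrow> L (c *\<^sub>R x) = c *\<^sub>R L x"
    and "L 0 = 0"
proof -
  show "x \<in> sym_mats \<Longrightarrow> L x \<in> sym_mats" "x \<in> sym_mats \<Longrightarrow> y \<in> sym_mats \<Longrightarrow> L (x + y) = L x + L y"
    and s: "x \<in> sym_mats \<Longrightarrow> L (c *\<^sub>R x) = c *\<^sub>R L x" for x c
    using assms by (auto simp: linear_on_sym_def)
  show "L 0 = 0" using s[of 0 0] subspace_0[OF subspace_sym_mats] by simp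
qed

text \<open>Composing with this projection extends a map that is linear only on
  \<open>sym_mats\<close> to a linear map on all matrices.\<close>

definition sym_part :: "real^'n^'n \<Rightarrow> real^'n^'n" where
  "sym_part x = (1 / 2) *\<^sub>R (x + transpose x)"

lemma linear_transpose: "linear (transpose :: real^'n^'n \<Rightarrow> real^'n^'n)"
  by (intro linearI) (simp_all add: transpose_def vec_eq_iff)

lemma linear_sym_part: "linear sym_part"
  unfolding sym_part_def
  by (intro linear_compose_scale_right linear_compose_add linear_transpose linear_id[unfolded id_def])

lemma sym_part_sym: "sym_part x \<in> sym_mats"
  by (simp add: sym_part_def sym_mats_iff transpose_def add.commute)

lemma sym_part_id: "x \<in> sym_mats \<Longrightarrow> sym_part x = x"
  by (simp add: sym_part_def sym_mats_def flip: scaleR_2)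

text \<open>The bridge from the spectral condition on the complexified map to injectivity of l - L
  for real l.\<close>

lemma sym_eigenvalue_real:
  assumes "linear_on_sym L" "x \<in> sym_mats" "x \<noteq> 0" "L x = l *\<^sub>R x"
  shows "sym_eigenvalue L (complex_of_real l)"
  unfolding sym_eigenvalue_def
proof (intro exI conjI)
  let ?z = "\<chi> i j. complex_of_real (x $ i $ j)"
  show "transpose ?z = ?z" using assms(2) by (simp add: transpose_def vec_eq_iff sym_mats_iff)
  show "?z \<noteq> 0" using assms(3) by (simp add: vec_eq_iff)
  have z: "(\<chi> i j. Im (?z $ i $ j)) = (0 :: real^'a^'a)" "(\<chi> i j. Re (?z $ i $ j)) = x"
    by (simp_all add: vec_eq_iff)
  show "complexify L ?z = (\<chi> i j. complex_of_real l * ?z $ i $ j)"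
    unfolding complexify_def z linear_on_symD(4)[OF assms(1)] assms(4)
    by (simp add: complex_eq_iff vec_eq_iff)
qed

text \<open>
  The solution \<open>X l\<close> of \<open>l X - L X = 1\<close> is positive definite for large \<open>l\<close>.  Decreasing \<open>l\<close> to 0
  it never reaches the boundary of the cone: there \<open>X l \<bullet> v v\<^sup>T = 0\<close> for some \<open>v\<close>, and cross-positivity
  would give \<open>0 \<le> L (X l) \<bullet> v v\<^sup>T = - \<bar>v\<bar>\<^sup>2\<close>.
\<close>

lemma cross_positive_lyapunov:
  fixes L :: "real^'n^'n \<Rightarrow> real^'n^'n"
  assumes L: "linear_on_sym L"
    and cross: "\<And>x u. x \<in> psd_cone \<Longrightarrow> u \<in> psd_cone \<Longrightarrow> x \<bullet> u = 0 \<Longrightarrow> 0 \<le> L x \<bullet> u"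
    and eig: "\<And>l. sym_eigenvalue L (complex_of_real l) \<Longrightarrow> l < 0"
  obtains y where "y \<in> sym_mats" "\<And>v. v \<noteq> 0 \<Longrightarrow> 0 < y \<bullet> outer v" "L y = - mat 1"
proof -
  note Ls = linear_on_symD[OF L]
  \<comment> \<open>A is L on symmetric matrices and minus the identity on antisymmetric ones. On
    the latter \<open>l *\<^sub>R x - A x\<close> is (l + 1) x, so no kernel arises there for l
    \<ge> 0.\<close>
  define A where "A x = L (sym_part x) + (sym_part x - x)" for x
  have A: "linear A"
    unfolding A_def
    by (intro linearI) (simp_all add: linear_add[OF linear_sym_part] linear_scale[OF linear_sym_part] Ls sym_part_sym algebra_simps scaleR_add_right)
  have A_sym: "A x = L x" if "x \<in> sym_mats" for x using that by (simp add: A_def sym_part_id)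
  have sym: "x \<in> sym_mats" if "0 \<le> l" "l *\<^sub>R x - A x \<in> sym_mats" for x l
  proof -
    have "l *\<^sub>R x - A x = (l *\<^sub>R sym_part x - L (sym_part x)) + (l + 1) *\<^sub>R (x - sym_part x)"
      by (simp add: A_def algebra_simps)
    moreover have "l *\<^sub>R sym_part x - L (sym_part x) \<in> sym_mats"
      by (intro sym_mats_diff sym_mats_scaleR Ls sym_part_sym)
    ultimately have "(l + 1) *\<^sub>R (x - sym_part x) \<in> sym_mats"
      using sym_mats_diff[OF that(2)] by fastforce
    then have "(1 / (l + 1)) *\<^sub>R ((l + 1) *\<^sub>R (x - sym_part x)) \<in> sym_mats" by (rule sym_mats_scaleR)
    then have "x - sym_part x \<in> sym_mats" using that(1) by simp
    from sym_mats_add[OF this sym_part_sym[of x]] show ?thesis by simp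
  qed
  define G where "G l x = l *\<^sub>R x - A x" for l x
  have G: "linear (G l)" for l
    unfolding G_def using A by (intro linear_compose_sub linear_compose_scale_right linear_id[unfolded id_def])
  have G_inj: "inj (G l)" if l: "0 \<le> l" for l
  proof (subst linear_injective_0[OF G], intro allI impI)
    fix x assume x: "G l x = 0"
    then have s: "x \<in> sym_mats" using sym[OF l, of x] subspace_0[OF subspace_sym_mats] by (simp add: G_def)
    show "x = 0"
    proof (rule ccontr)
      assume "x \<noteq> 0"
      moreover have "L x = l *\<^sub>R x" using x A_sym[OF s] by (simp add: G_def)
      ultimately show False using eig[OF sym_eigenvalue_real[OF L s]] l by force
    qed
  qed
  have "\<exists>x. G l x = mat 1" if "0 \<le> l" for l
    using linear_injective_imp_surjective[OF G G_inj[OF that]] by (metis surj_def)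
  then obtain X where X: "\<And>l. 0 \<le> l \<Longrightarrow> G l (X l) = mat 1" by metis
  have X_sym: "X l \<in> sym_mats" if "0 \<le> l" for l
    using sym[OF that, of "X l"] X[OF that] psd_cone_sym[OF mat_1_psd] by (simp add: G_def)
  have LX: "L (X l) = l *\<^sub>R X l - mat 1" if "0 \<le> l" for l
    using X[OF that] A_sym[OF X_sym[OF that]] by (simp add: G_def algebra_simps)
  have X_cont: "continuous_on {0..} X"
    unfolding continuous_on_iff
  proof (intro ballI allI impI)
    fix l e :: real assume l: "l \<in> {0..}" and e: "0 < e"
    obtain c where c: "0 < c" "\<And>x. c * norm x \<le> norm (G l x)"
      using linear_inj_bounded_below_pos[OF G G_inj] l by auto
    \<comment> \<open>The resolvent identity below bounds c times the norm of X k - X l by \<bar>l -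
      k\<bar> times the norm of X k. For \<bar>l - k\<bar> < c / 2 half of the left side absorbs the
      difference, whence 2 / c; the added 1 keeps K positive.\<close>
    define K where "K = 2 / c * norm (X l) + 1"
    have K: "0 < K" using c(1) by (simp add: K_def add_nonneg_pos)
    show "\<exists>d>0. \<forall>k\<in>{0..}. dist k l < d \<longrightarrow> dist (X k) (X l) < e"
    proof (intro exI[of _ "min (c / 2) (e / K)"] conjI ballI impI)
      show "0 < min (c / 2) (e / K)" using c(1) e K by simp
      fix k :: real assume k: "k \<in> {0..}" "dist k l < min (c / 2) (e / K)"
      have "G l (X k - X l) = (l - k) *\<^sub>R X k"
      proof -
        have "G l (X k - X l) = G l (X k) - G k (X k) + (G k (X k) - G l (X l))"
          by (simp add: linear_diff[OF G])
        also have "\<dots> = (l - k) *\<^sub>R X k" using X k(1) l by (simp add: G_def algebra_simps)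
        finally show ?thesis .
      qed
      then have "c * norm (X k - X l) \<le> \<bar>l - k\<bar> * norm (X k)"
        using c(2)[of "X k - X l"] by simp
      also have "\<dots> \<le> \<bar>l - k\<bar> * (norm (X l) + norm (X k - X l))"
        using norm_triangle_sub[of "X k" "X l"] by (intro mult_left_mono) auto
      also have "\<dots> \<le> \<bar>l - k\<bar> * norm (X l) + c / 2 * norm (X k - X l)"
        using k(2) mult_right_mono[of "\<bar>l - k\<bar>" "c / 2" "norm (X k - X l)"]
        by (simp add: distrib_left dist_real_def abs_minus_commute)
      finally have "norm (X k - X l) \<le> \<bar>l - k\<bar> * (2 / c * norm (X l))"
        using c(1) by (simp add: field_simps)
      also have "\<dots> \<le> \<bar>l - k\<bar> * K" by (intro mult_left_mono) (auto simp: K_def)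
      also have "\<dots> < e" using k(2) K by (simp add: dist_real_def abs_minus_commute field_simps)
      finally show "dist (X k) (X l) < e" by (simp add: dist_norm)
    qed
  qed
  define pd where "pd = {x::real^'n^'n. \<forall>v. v \<noteq> 0 \<longrightarrow> 0 < x \<bullet> outer v}"
  define S where "S = {l \<in> {0..}. X l \<in> pd}"
  have pd_iff: "X l \<in> pd \<longleftrightarrow> X l \<in> psd_cone" if l: "0 \<le> l" for l
  proof
    assume "X l \<in> pd"
    then show "X l \<in> psd_cone"
      using X_sym[OF l] by (simp add: pd_def psd_cone_iff) (metis inner_zero_right less_imp_le order_refl outer_0)
  next
    assume psd: "X l \<in> psd_cone"
    show "X l \<in> pd"
      unfolding pd_def
    proof (clarify, rule ccontr)
      fix v :: "real^'n" assume v: "v \<noteq> 0" and "\<not> 0 < X l \<bullet> outer v"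
      then have z: "X l \<bullet> outer v = 0" using psd by (simp add: psd_cone_iff antisym not_less)
      have "0 \<le> L (X l) \<bullet> outer v" by (rule cross[OF psd outer_psd z])
      then show False using v by (simp add: LX[OF l] inner_diff_left z mat_1_outer)
    qed
  qed
  have "closedin (top_of_set {0..}) S"
  proof -
    have "S = {0..} \<inter> X -` psd_cone" using pd_iff by (auto simp: S_def)
    then show ?thesis using continuous_closedin_preimage[OF X_cont closed_psd_cone] by simp
  qed
  \<comment> \<open>A positive definite X l dominates c times the identity, so moving it by less
    than c in norm keeps it positive definite.\<close>
  moreover have "openin (top_of_set {0..}) S"
  proof -
    show ?thesis
    proof (subst openin_euclidean_subtopology_iff, intro conjI ballI)
      fix l assume "l \<in> S"
      then have l: "l \<in> {0..}" "X l \<in> pd" by (auto simp: S_def)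
      then obtain c where c: "0 < c" "X l - c *\<^sub>R mat 1 \<in> psd_cone"
        using posdef_lower_bound[OF X_sym, of l] unfolding pd_def by auto
      obtain d where d: "0 < d" "\<And>k. k \<in> {0..} \<Longrightarrow> dist k l < d \<Longrightarrow> dist (X k) (X l) < c"
        using X_cont l(1) c(1) unfolding continuous_on_iff by blast
      have "k \<in> S" if k: "k \<in> {0..}" "dist k l < d" for k
      proof -
        have "0 < X k \<bullet> outer v" if v: "v \<noteq> 0" for v
        proof -
          have "\<bar>(X k - X l) \<bullet> outer v\<bar> \<le> norm (X k - X l) * norm (outer v)"
            by (rule Cauchy_Schwarz_ineq2)
          also have "\<dots> < c * (norm v)\<^sup>2"
            using d(2)[OF k] v by (simp add: norm_outer dist_norm)
          finally have "- ((X k - X l) \<bullet> outer v) < c * (norm v)\<^sup>2" by simp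
          moreover have "0 \<le> (X l - c *\<^sub>R mat 1) \<bullet> outer v" using c(2) by (simp add: psd_cone_iff)
          ultimately show ?thesis by (simp add: inner_diff_left mat_1_outer)
        qed
        then show ?thesis using k(1) by (simp add: S_def pd_def)
      qed
      then show "\<exists>e>0. \<forall>k\<in>{0..}. dist k l < e \<longrightarrow> k \<in> S" using d(1) by blast
    qed (auto simp: S_def)
  qed
  moreover have "S \<noteq> {}"
  proof -
    obtain K where K: "0 < K" "\<And>x. norm (A x) \<le> K * norm x" using linear_bounded_pos[OF A] by blast
    \<comment> \<open>The first term bounds the norm of X l by 2 / l times that of the identity. The
      second then brings the norm of A (X l) down to 1/2, so l X l = 1 + A (X l) is a small
      perturbation of the identity.\<close>
    define l where "l = 2 * K + 4 * K * norm (mat 1 :: real^'n^'n) + 1"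
    have l: "0 < l" "2 * K \<le> l" "4 * K * norm (mat 1 :: real^'n^'n) \<le> l"
      using K(1) by (auto simp: l_def add_nonneg_pos)
    have eq: "l *\<^sub>R X l = mat 1 + A (X l)" using X[of l] l(1) by (simp add: G_def algebra_simps)
    have "l * norm (X l) \<le> norm (mat 1 :: real^'n^'n) + K * norm (X l)"
      using norm_triangle_ineq[of "mat 1" "A (X l)"] K(2)[of "X l"] l(1) by (simp flip: eq)
    also have "K * norm (X l) \<le> l / 2 * norm (X l)" using l(2) by (intro mult_right_mono) auto
    finally have "l * norm (X l) \<le> 2 * norm (mat 1 :: real^'n^'n)" by simp
    then have "K * (l * norm (X l)) \<le> K * (2 * norm (mat 1 :: real^'n^'n))" using K(1) by (intro mult_left_mono) auto
    then have "l * (K * norm (X l)) \<le> l / 2" using l(3) by (simp add: mult_ac)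
    then have "K * norm (X l) \<le> 1 / 2" using l(1) by (simp add: field_simps)
    then have AX: "norm (A (X l)) \<le> 1 / 2" using K(2)[of "X l"] by simp
    have "0 < X l \<bullet> outer v" if "v \<noteq> 0" for v
    proof -
      have "\<bar>A (X l) \<bullet> outer v\<bar> \<le> norm (A (X l)) * norm (outer v)" by (rule Cauchy_Schwarz_ineq2)
      also have "\<dots> \<le> 1 / 2 * (norm v)\<^sup>2" using mult_right_mono[OF AX, of "(norm v)\<^sup>2"] by (simp add: norm_outer)
      finally have "- (A (X l) \<bullet> outer v) \<le> 1 / 2 * (norm v)\<^sup>2" by simp
      moreover have "l * (X l \<bullet> outer v) = (norm v)\<^sup>2 + A (X l) \<bullet> outer v"
        using arg_cong[OF eq, of "\<lambda>x. x \<bullet> outer v"] by (simp add: inner_add_left mat_1_outer)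
      moreover have "0 < (norm v)\<^sup>2" using that by simp
      ultimately have "0 < l * (X l \<bullet> outer v)" by linarith
      then show ?thesis using l(1) by (simp add: zero_less_mult_iff)
    qed
    then have "l \<in> S" using l(1) by (simp add: S_def pd_def)
    then show ?thesis by blast
  qed
  ultimately have "S = {0..}"
    using connected_clopen[of "{0::real..}"] connected_iff_interval[of "{0::real..}"] by auto
  then have "X 0 \<in> pd" by (auto simp: S_def)
  then show thesis using that[of "X 0"] X_sym[of 0] LX[of 0] by (simp add: pd_def)
qed

section \<open>Decay of the Riccati flow\<close>

lemma inner_transpose: "transpose x \<bullet> transpose y = x \<bullet> (y :: real^'n^'n)"
  unfolding inner_vec_def transpose_def by (simp, subst sum.swap, rule refl)

lemma inner_sym_part: "x \<in> sym_mats \<Longrightarrow> x \<bullet> sym_part w = x \<bullet> w"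
  using inner_transpose[of x w] by (simp add: sym_part_def sym_mats_def inner_add_right)

text \<open>The witness is the symmetric part of the ordinary adjoint of L after projection. It is
  unique because the difference of two candidates is symmetric and may be tested against
  itself.\<close>

lemma sym_adjoint_works:
  assumes "linear_on_sym L" "x \<in> sym_mats"
  shows "x \<bullet> sym_adjoint L u = L x \<bullet> u"
proof -
  note Ls = linear_on_symD[OF assms(1)]
  have lin: "linear (\<lambda>x. L (sym_part x))"
    by (intro linearI) (simp_all add: linear_add[OF linear_sym_part] linear_scale[OF linear_sym_part] Ls sym_part_sym)
  define w where "w = sym_part (adjoint (\<lambda>x. L (sym_part x)) u)"
  have w: "w \<in> sym_mats \<and> (\<forall>x\<in>sym_mats. x \<bullet> w = L x \<bullet> u)"
    unfolding w_def using adjoint_works[OF lin] by (simp add: sym_part_sym inner_sym_part sym_part_id)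
  have uniq: "v = w" if v: "v \<in> sym_mats \<and> (\<forall>x\<in>sym_mats. x \<bullet> v = L x \<bullet> u)" for v
  proof -
    have d: "v - w \<in> sym_mats" using v w by (auto intro: sym_mats_diff)
    have "(v - w) \<bullet> v = (v - w) \<bullet> w" using v w d by simp
    then have "(v - w) \<bullet> (v - w) = 0" by (simp only: inner_diff_right)
    then show ?thesis by simp
  qed
  have "sym_adjoint L u = w"
    unfolding sym_adjoint_def by (rule the_equality, rule w, erule uniq)
  then show ?thesis using w assms(2) by simp
qed

text \<open>In the interior the derivative is two-sided; at the endpoint 0 continuity is
  enough.\<close>

lemma nonincreasing_halfline:
  fixes f :: "real \<Rightarrow> real"
  assumes "\<And>t. 0 \<le> t \<Longrightarrow> (f has_real_derivative f' t) (at t within {0..})"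
    and "\<And>t. 0 \<le> t \<Longrightarrow> f' t \<le> 0" "0 \<le> a" "a \<le> t"
  shows "f t \<le> f a"
proof (rule DERIV_nonpos_imp_decreasing_open[OF assms(4)])
  fix x assume x: "a < x" "x < t"
  then have "at x within {0..} = at x" using assms(3) by (intro at_within_interior) simp
  then show "\<exists>y. (f has_real_derivative y) (at x) \<and> y \<le> 0"
    using assms(1,2)[of x] x assms(3) by auto
next
  have "continuous_on {0..} f"
    using assms(1) by (intro DERIV_continuous_on) auto
  then show "continuous_on {a..t} f" by (rule continuous_on_subset) (use assms(3) in auto)
qed

lemma inner_psd_bound:
  fixes u \<xi> :: "real^'n^'n"
  assumes "u \<in> psd_cone" "\<xi> \<in> psd_cone"
  shows "\<bar>exp (- (u \<bullet> \<xi>)) - 1\<bar> \<le> norm u * norm \<xi>" "\<bar>u \<bullet> \<xi>\<bar> \<le> norm u * norm \<xi>"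
proof -
  show 1: "\<bar>u \<bullet> \<xi>\<bar> \<le> norm u * norm \<xi>" by (rule Cauchy_Schwarz_ineq2)
  have "0 \<le> u \<bullet> \<xi>" by (rule inner_psd_nonneg[OF assms])
  then show "\<bar>exp (- (u \<bullet> \<xi>)) - 1\<bar> \<le> norm u * norm \<xi>"
    using exp_ge_add_one_self[of "- (u \<bullet> \<xi>)"] 1 by simp
qed

section \<open>Jump integrals in the effective drift and in the Riccati field\<close>

context psd_measure
begin

lemma signed_integral_add:
  fixes f g :: "real^'n^'n \<Rightarrow> real"
  assumes "f \<in> borel_measurable borel" "\<And>\<xi>. \<xi> \<in> psd_cone \<Longrightarrow> \<bar>f \<xi>\<bar> \<le> C * norm \<xi>"
    and "g \<in> borel_measurable borel" "\<And>\<xi>. \<xi> \<in> psd_cone \<Longrightarrow> \<bar>g \<xi>\<bar> \<le> C * norm \<xi>"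
  shows "signed_integral (entry i j) (\<lambda>\<xi>. f \<xi> + g \<xi>) = signed_integral (entry i j) f + signed_integral (entry i j) g"
proof -
  have "integrable (half k) f" "integrable (half k) g" for k
    using assms by (auto intro!: integrable_half[of _ C])
  then show ?thesis by (simp add: signed_integral_half)
qed

text \<open>In pairings the drift involves only scalar integrals of
  \<open>u \<bullet> \<xi>\<close>, which can be compared with those in \<open>R_fun\<close> under
  one integral sign.\<close>

lemma effective_drift_inner:
  "effective_drift B \<mu> x \<bullet> u = B x \<bullet> u + x \<bullet> (\<chi> i j. signed_integral (entry i j) (\<lambda>\<xi>. u \<bullet> \<xi>))"
proof -
  have "(\<Sum>i\<in>UNIV. \<Sum>j\<in>UNIV. (x $ i $ j) *\<^sub>R signed_integral (entry i j) (\<lambda>\<xi>. \<xi>)) \<bullet> u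
      = x \<bullet> (\<chi> i j. signed_integral (entry i j) (\<lambda>\<xi>. u \<bullet> \<xi>))"
  proof -
    have "x \<bullet> (\<chi> i j. g i j) = (\<Sum>i\<in>UNIV. \<Sum>j\<in>UNIV. x $ i $ j * g i j)" for g :: "'n \<Rightarrow> 'n \<Rightarrow> real"
      by (simp add: inner_vec_def)
    then show ?thesis
      by (simp only: inner_sum_right inner_scaleR_right signed_integral_inner inner_commute[of _ u])
  qed
  then show ?thesis by (simp add: effective_drift_def inner_add_left)
qed

lemma linear_effective_drift:
  assumes B: "linear_on_sym B"
  shows "linear_on_sym (effective_drift B \<mu>)"
  unfolding linear_on_sym_def
proof (intro conjI ballI allI)
  note Bs = linear_on_symD[OF B]
  fix x :: "real^'n^'n" assume x: "x \<in> sym_mats"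
  show "effective_drift B \<mu> x \<in> sym_mats"
    unfolding effective_drift_def
    by (intro sym_mats_add Bs x subspace_sum[OF subspace_sym_mats] sym_mats_scaleR signed_integral_sym_mats)
  show "effective_drift B \<mu> (x + y) = effective_drift B \<mu> x + effective_drift B \<mu> y" if "y \<in> sym_mats" for y
    using x that by (simp add: effective_drift_def Bs scaleR_add_left sum.distrib)
  show "effective_drift B \<mu> (c *\<^sub>R x) = c *\<^sub>R effective_drift B \<mu> x" for c
    using x by (simp add: effective_drift_def Bs scaleR_add_right scaleR_sum_right)
qed

text \<open>The jumps add the integral of the nonnegative function \<open>u \<bullet> \<xi>\<close>,
  paired with x in the cone, to what B contributes.\<close>

lemma effective_drift_cross_positive:
  assumes "\<And>x u. x \<in> psd_cone \<Longrightarrow> u \<in> psd_cone \<Longrightarrow> x \<bullet> u = 0 \<Longrightarrow> 0 \<le> B x \<bullet> u"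
    and "x \<in> psd_cone" "u \<in> psd_cone" "x \<bullet> u = 0"
  shows "0 \<le> effective_drift B \<mu> x \<bullet> u"
proof -
  have "0 \<le> x \<bullet> (\<chi> i j. signed_integral (entry i j) (\<lambda>\<xi>. u \<bullet> \<xi>))"
    by (rule matrix_integral_nonneg[OF assms(2), of _ "norm u"])
       (use inner_psd_bound(2)[OF assms(3)] inner_psd_nonneg[OF assms(3)] in \<open>auto simp: abs_le_iff\<close>)
  then show ?thesis using assms(1)[OF assms(2-4)] by (simp add: effective_drift_inner)
qed

text \<open>The two sides differ by y paired with 2 u \<alpha> u and with the \<mu>-integral of exp
  (- z) - 1 + z at z = \<open>u \<bullet> \<xi>\<close>. Both are nonnegative, by self-duality of
  the cone and by the tangent inequality for exp.\<close>

lemma R_fun_le_effective_drift: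
  assumes B: "linear_on_sym B" and \<alpha>: "\<alpha> \<in> psd_cone" and y: "y \<in> psd_cone" and u: "u \<in> psd_cone"
  shows "y \<bullet> R_fun \<alpha> B \<mu> u \<le> effective_drift B \<mu> y \<bullet> u"
proof -
  have "0 \<le> y \<bullet> (u ** \<alpha> ** u)"
    by (intro inner_psd_nonneg y congruence_psd psd_cone_sym[OF u] \<alpha>)
  moreover have "0 \<le> y \<bullet> (\<chi> i j. signed_integral (entry i j) (\<lambda>\<xi>. u \<bullet> \<xi> + (exp (- (u \<bullet> \<xi>)) - 1)))"
  proof (rule matrix_integral_nonneg[OF y, of _ "norm u"])
    fix \<xi> :: "real^'n^'n" assume \<xi>: "\<xi> \<in> psd_cone"
    show "0 \<le> u \<bullet> \<xi> + (exp (- (u \<bullet> \<xi>)) - 1)"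
      using exp_ge_add_one_self[of "- (u \<bullet> \<xi>)"] by simp
    show "u \<bullet> \<xi> + (exp (- (u \<bullet> \<xi>)) - 1) \<le> norm u * norm \<xi>"
    proof -
      have "exp (- (u \<bullet> \<xi>)) \<le> 1" using inner_psd_nonneg[OF u \<xi>] by simp
      then show ?thesis using inner_psd_bound(2)[OF u \<xi>] by linarith
    qed
  qed simp
  moreover have "(\<chi> i j. signed_integral (entry i j) (\<lambda>\<xi>. u \<bullet> \<xi> + (exp (- (u \<bullet> \<xi>)) - 1)))
      = (\<chi> i j. signed_integral (entry i j) (\<lambda>\<xi>. u \<bullet> \<xi>))
        + (\<chi> i j. signed_integral (entry i j) (\<lambda>\<xi>. exp (- (u \<bullet> \<xi>)) - 1))"
    using signed_integral_add[of "\<lambda>\<xi>. u \<bullet> \<xi>" "norm u" "\<lambda>\<xi>. exp (- (u \<bullet> \<xi>)) - 1"] inner_psd_bound[OF u]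
    by (simp add: vec_eq_iff)
  ultimately show ?thesis
    unfolding R_fun_def effective_drift_inner
    by (simp add: inner_add_right inner_diff_right sym_adjoint_works[OF B psd_cone_sym[OF y]])
qed

end

locale affine_process = psd_measure \<mu>
  for \<alpha> b :: "real^'n^'n"
    and B :: "real^'n^'n \<Rightarrow> real^'n^'n"
    and m :: "(real^'n^'n) measure"
    and \<mu> :: "(real^'n^'n) set \<Rightarrow> real^'n^'n"
    and \<phi> :: "real \<Rightarrow> real^'n^'n \<Rightarrow> real"
    and \<psi> :: "real \<Rightarrow> real^'n^'n \<Rightarrow> real^'n^'n"
    and p :: "real \<Rightarrow> real^'n^'n \<Rightarrow> (real^'n^'n) measure" +
  assumes adm: "admissible \<alpha> b B m \<mu>"
    and kernel: "affine_kernel \<alpha> b B m \<mu> \<phi> \<psi> p"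
    and subcrit: "subcritical B \<mu>"
    and log_moment: "(\<integral>\<^sup>+\<xi>\<in>{\<xi>. norm \<xi> > 1}. ennreal (ln (norm \<xi>)) \<partial>m) < \<infinity>"
begin

lemma \<psi>_psd: "u \<in> psd_cone \<Longrightarrow> 0 \<le> t \<Longrightarrow> \<psi> t u \<in> psd_cone"
  and \<psi>_0: "u \<in> psd_cone \<Longrightarrow> \<psi> 0 u = u"
  and \<psi>_deriv: "u \<in> psd_cone \<Longrightarrow> 0 \<le> t \<Longrightarrow>
    ((\<lambda>s. \<psi> s u) has_vector_derivative R_fun \<alpha> B \<mu> (\<psi> t u)) (at t within {0..})"
  and \<phi>_0: "u \<in> psd_cone \<Longrightarrow> \<phi> 0 u = 0"
  and \<phi>_deriv: "u \<in> psd_cone \<Longrightarrow> 0 \<le> t \<Longrightarrow>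
    ((\<lambda>s. \<phi> s u) has_real_derivative F_fun b m (\<psi> t u)) (at t within {0..})"
  using kernel by (auto simp: affine_kernel_def riccati_solution_def)

text \<open>On the cone, pairing with y is equivalent to the norm: it is at least c times the norm
  because y dominates c times the identity, and at most \<open>norm y\<close> times the
  norm.\<close>

lemma \<psi>_decay:
  obtains C \<delta> where "0 < C" "0 < \<delta>"
    "\<And>u t. u \<in> psd_cone \<Longrightarrow> 0 \<le> t \<Longrightarrow> norm (\<psi> t u) \<le> C * norm u * exp (- (\<delta> * t))"
proof -
  have B: "linear_on_sym B" and \<alpha>: "\<alpha> \<in> psd_cone"
    and cross: "\<And>x u. x \<in> psd_cone \<Longrightarrow> u \<in> psd_cone \<Longrightarrow> x \<bullet> u = 0 \<Longrightarrow> 0 \<le> B x \<bullet> u"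
    using adm by (auto simp: admissible_def)
  have eig: "l < 0" if "sym_eigenvalue (effective_drift B \<mu>) (complex_of_real l)" for l
    using subcrit that unfolding subcritical_def by force
  obtain y where y: "y \<in> sym_mats" "\<And>v. v \<noteq> 0 \<Longrightarrow> 0 < y \<bullet> outer v" and Ly: "effective_drift B \<mu> y = - mat 1"
    using cross_positive_lyapunov[OF linear_effective_drift[OF B] effective_drift_cross_positive[OF cross] eig] by blast
  obtain c where c: "0 < c" "y - c *\<^sub>R mat 1 \<in> psd_cone" using posdef_lower_bound[OF y] by blast
  have y_psd: "y \<in> psd_cone"
    using psd_cone_add[OF c(2) psd_cone_scaleR[OF mat_1_psd, of c]] c(1) by simp
  have ny: "0 < norm y"
  proof -
    have "y \<noteq> 0"
    proof
      assume "y = 0"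
      then show False using y(2)[of "axis undefined 1"] by (simp add: axis_eq_0_iff)
    qed
    then show ?thesis by simp
  qed
  \<comment> \<open>The trace dominates the norm, hence also \<open>y \<bullet> x\<close> divided by
    \<open>norm y\<close>; this turns the bound - trace on the derivative into -\<delta> times the
    functional.\<close>
  define \<delta> where "\<delta> = 1 / norm y"
  have \<delta>: "0 < \<delta>" using ny by (simp add: \<delta>_def)
  have lower: "c * norm x \<le> y \<bullet> x" if "x \<in> psd_cone" for x
  proof -
    have "c * norm x \<le> c * trace x" using norm_le_trace[OF that] c(1) by (intro mult_left_mono) auto
    also have "\<dots> \<le> y \<bullet> x"
      using inner_psd_nonneg[OF c(2) that] by (simp add: inner_diff_left inner_commute[of "mat 1"] mat_1_inner)
    finally show ?thesis .
  qed
  have upper: "\<delta> * (y \<bullet> x) \<le> trace x" if "x \<in> psd_cone" for x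
  proof -
    have "y \<bullet> x \<le> norm y * norm x" by (rule norm_cauchy_schwarz)
    also have "\<dots> \<le> norm y * trace x" using norm_le_trace[OF that] by (intro mult_left_mono) auto
    finally show ?thesis using ny by (simp add: \<delta>_def field_simps)
  qed
  show thesis
  proof (rule that[of "norm y / c" \<delta>])
    fix u :: "real^'n^'n" and t :: real assume u: "u \<in> psd_cone" and t: "0 \<le> t"
    \<comment> \<open>Gronwall's argument: the weight exp (\<delta> t) cancels the rate of decay, so
      W cannot increase.\<close>
    define W where "W t = exp (\<delta> * t) * (y \<bullet> \<psi> t u)" for t
    define W' where "W' t = exp (\<delta> * t) * (\<delta> * (y \<bullet> \<psi> t u) + y \<bullet> R_fun \<alpha> B \<mu> (\<psi> t u))" for t
    have "(W has_real_derivative W' s) (at s within {0..})" if "0 \<le> s" for s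
    proof -
      have "((\<lambda>t. y \<bullet> \<psi> t u) has_real_derivative y \<bullet> R_fun \<alpha> B \<mu> (\<psi> s u)) (at s within {0..})"
        using bounded_linear.has_vector_derivative[OF bounded_linear_inner_right \<psi>_deriv[OF u that]]
        by (simp add: has_real_derivative_iff_has_vector_derivative)
      then show ?thesis
        unfolding W_def W'_def by (auto intro!: derivative_eq_intros simp: algebra_simps)
    qed
    moreover have "W' s \<le> 0" if "0 \<le> s" for s
    proof -
      have "y \<bullet> R_fun \<alpha> B \<mu> (\<psi> s u) \<le> - trace (\<psi> s u)"
        using R_fun_le_effective_drift[OF B \<alpha> y_psd \<psi>_psd[OF u that]]
        by (simp add: Ly inner_commute[of "mat 1"] mat_1_inner)
      then have "\<delta> * (y \<bullet> \<psi> s u) + y \<bullet> R_fun \<alpha> B \<mu> (\<psi> s u) \<le> 0" using upper[OF \<psi>_psd[OF u that]] by linarith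
      then show ?thesis by (simp add: W'_def mult_le_0_iff)
    qed
    ultimately have "W t \<le> W 0" by (rule nonincreasing_halfline[of W W' 0 t]) (use t in auto)
    then have W: "exp (\<delta> * t) * (y \<bullet> \<psi> t u) \<le> norm y * norm u"
      using norm_cauchy_schwarz[of y u] by (simp add: W_def \<psi>_0[OF u])
    have "exp (\<delta> * t) * (c * norm (\<psi> t u)) \<le> norm y * norm u"
      by (rule order_trans[OF mult_left_mono[OF lower[OF \<psi>_psd[OF u t]] exp_ge_zero] W])
    then have "exp (- (\<delta> * t)) * (exp (\<delta> * t) * (c * norm (\<psi> t u))) \<le> exp (- (\<delta> * t)) * (norm y * norm u)"
      by (intro mult_left_mono) auto
    moreover have "exp (- (\<delta> * t)) * (exp (\<delta> * t) * (c * norm (\<psi> t u))) = c * norm (\<psi> t u)"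
      by (simp flip: mult.assoc exp_add)
    ultimately have "norm (\<psi> t u) \<le> exp (- (\<delta> * t)) * (norm y * norm u) / c"
      using c(1) by (simp add: pos_le_divide_eq mult.commute)
    then show "norm (\<psi> t u) \<le> norm y / c * norm u * exp (- (\<delta> * t))"
      by (simp add: mult_ac)
  qed (use ny c \<delta> in auto)
qed

end

section \<open>Boundedness of the cumulant integral\<close>

text \<open>Splitting at x = 1 matches the two integrability conditions on m: ln (1 + z) \<le> z
  serves the small jumps, 1 + a x \<le> (1 + a) x the large ones.\<close>

lemma ln_moment_bound:
  fixes a x :: real
  assumes "0 \<le> a" "0 < x"
  shows "0 \<le> ln (1 + a * x)" "ln (1 + a * x) \<le> a * min x 1 + ln x * indicator {1<..} x"
proof -
  show "0 \<le> ln (1 + a * x)" using assms by simp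
  show "ln (1 + a * x) \<le> a * min x 1 + ln x * indicator {1<..} x"
  proof (cases "1 < x")
    case True
    have "1 + a * x \<le> (1 + a) * x" using True by (simp add: distrib_right)
    then have "ln (1 + a * x) \<le> ln ((1 + a) * x)"
      using assms by (subst ln_le_cancel_iff) (auto intro!: add_pos_nonneg mult_pos_pos)
    also have "\<dots> = ln (1 + a) + ln x" using assms by (intro ln_mult_pos) auto
    finally show ?thesis using True ln_add_one_self_le_self[OF assms(1)] by simp
  next
    case False
    then show ?thesis using assms ln_add_one_self_le_self[of "a * x"] by simp
  qed
qed

lemma jump_bounds:
  fixes u \<xi> :: "real^'n^'n"
  assumes "u \<in> psd_cone" "\<xi> \<in> psd_cone"
  shows "0 \<le> 1 - exp (- (u \<bullet> \<xi>))" "1 - exp (- (u \<bullet> \<xi>)) \<le> min 1 (norm u * norm \<xi>)"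
proof -
  show "0 \<le> 1 - exp (- (u \<bullet> \<xi>))" using inner_psd_nonneg[OF assms] by simp
  show "1 - exp (- (u \<bullet> \<xi>)) \<le> min 1 (norm u * norm \<xi>)"
    using inner_psd_bound(1)[OF assms] by simp
qed

text \<open>Of g only its sign and its being a derivative are assumed, not continuity. Measurability
  comes from difference quotients, the integrals over [0, n] from the fundamental theorem, and the
  half-line from monotone convergence.\<close>

lemma integral_halfline_FTC:
  fixes f g :: "real \<Rightarrow> real"
  assumes deriv: "\<And>t. 0 \<le> t \<Longrightarrow> (f has_real_derivative g t) (at t within {0..})"
    and nonneg: "\<And>t. 0 \<le> t \<Longrightarrow> 0 \<le> g t" and f0: "f 0 = 0" and lim: "(f \<longlongrightarrow> T) at_top"
  shows "set_integrable lborel {0..} g" "(LINT s:{0..}|lborel. g s) = T"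
proof -
  define G where "G s = indicator {0..} s * g s" for s
  \<comment> \<open>Continuing f as a constant to the left of 0 makes the difference quotients
    continuous on the whole line.\<close>
  have cont: "continuous_on UNIV (\<lambda>s. f (max 0 s))"
  proof (rule continuous_on_compose2[of "{0..}" f])
    show "continuous_on {0..} f" using deriv by (intro DERIV_continuous_on) auto
  qed (auto intro!: continuous_intros)
  have G_meas: "G \<in> borel_measurable borel"
  proof (rule borel_measurable_LIMSEQ_real)
    fix s :: real
    show "(\<lambda>n. indicator {0..} s * ((f (max 0 (s + 1 / real (Suc n))) - f (max 0 s)) / (1 / real (Suc n)))) \<longlonglongrightarrow> G s"
    proof (cases "0 \<le> s")
      case True
      have "filterlim (\<lambda>n. s + 1 / real (Suc n)) (at s within {0..}) sequentially"
      proof -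
        have "(\<lambda>n. s + 1 / real (Suc n)) \<longlonglongrightarrow> s + 0"
          by (intro tendsto_add tendsto_const LIMSEQ_Suc[OF lim_1_over_n])
        then show ?thesis unfolding filterlim_at using True by auto
      qed
      from filterlim_compose[OF _ this] deriv[OF True]
      have "(\<lambda>n. (f (s + 1 / real (Suc n)) - f s) / (s + 1 / real (Suc n) - s)) \<longlonglongrightarrow> g s"
        unfolding has_field_derivative_iff by blast
      moreover have "max 0 (s + 1 / real (Suc n)) = s + 1 / real (Suc n)" for n using True by (simp add: max_def)
      ultimately show ?thesis using True by (simp add: G_def max_def)
    qed (simp add: G_def)
  next
    fix n
    show "(\<lambda>s. indicator {0..} s * ((f (max 0 (s + 1 / real (Suc n))) - f (max 0 s)) / (1 / real (Suc n)))) \<in> borel_measurable borel"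
      by (intro borel_measurable_times borel_measurable_divide borel_measurable_diff borel_measurable_indicator
          borel_measurable_const borel_measurable_continuous_onI continuous_on_compose2[OF cont] continuous_intros) auto
  qed
  have G_nonneg: "0 \<le> G s" for s using nonneg[of s] by (simp add: G_def indicator_def)
  have FTC: "(\<integral>\<^sup>+s. ennreal (G s) * indicator {0..t} s \<partial>lborel) = ennreal (f t)" if t: "0 \<le> t" for t
  proof -
    have "(g has_integral f t - f 0) {0..t}"
      using t
      by (intro fundamental_theorem_of_calculus)
         (auto simp flip: has_real_derivative_iff_has_vector_derivative intro!: DERIV_subset[OF deriv])
    then have "(\<integral>\<^sup>+s. ennreal (g s) * indicator {0..t} s \<partial>lborel) = ennreal (f t)"
      using nonneg by (subst nn_integral_has_integral_lebesgue') (auto simp: f0)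
    moreover have "ennreal (G s) * indicator {0..t} s = ennreal (g s) * indicator {0..t} s" for s
      by (simp add: G_def indicator_def)
    ultimately show ?thesis by simp
  qed
  have "(\<integral>\<^sup>+s. ennreal (G s) \<partial>lborel) = ennreal T"
  proof -
    have mono: "incseq (\<lambda>n s. ennreal (G s) * indicator {0..real n} s)"
      by (auto simp: incseq_def le_fun_def indicator_def)
    have "(SUP n. ennreal (G s) * indicator {0..real n} s) = ennreal (G s)" for s
    proof (rule antisym)
      show "(SUP n. ennreal (G s) * indicator {0..real n} s) \<le> ennreal (G s)"
        by (intro SUP_least) (auto simp: indicator_def)
      obtain n :: nat where "s \<le> real n" using real_arch_simple by blast
      then have "ennreal (G s) \<le> ennreal (G s) * indicator {0..real n} s"
        by (auto simp: G_def indicator_def)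
      then show "ennreal (G s) \<le> (SUP n. ennreal (G s) * indicator {0..real n} s)"
        by (rule SUP_upper2[rotated]) simp
    qed
    then have "(\<integral>\<^sup>+s. ennreal (G s) \<partial>lborel) = (SUP n. \<integral>\<^sup>+s. ennreal (G s) * indicator {0..real n} s \<partial>lborel)"
      using nn_integral_monotone_convergence_SUP[OF mono, of lborel] G_meas by simp
    then have "(\<integral>\<^sup>+s. ennreal (G s) \<partial>lborel) = (SUP n. ennreal (f (real n)))"
      by (simp add: FTC)
    moreover have "incseq (\<lambda>n. ennreal (f (real n)))"
    proof -
      have "f (real k) \<le> f (real n)" if "k \<le> n" for k n
        using nonincreasing_halfline[of "\<lambda>t. - f t" "\<lambda>t. - g t" "real k" "real n"] deriv nonneg that
        by (auto intro!: DERIV_minus)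
      then show ?thesis by (auto simp: incseq_def intro!: ennreal_leI)
    qed
    then have "(\<lambda>n. ennreal (f (real n))) \<longlonglongrightarrow> (SUP n. ennreal (f (real n)))" by (rule LIMSEQ_SUP)
    moreover have "(\<lambda>n. ennreal (f (real n))) \<longlonglongrightarrow> ennreal T"
      using filterlim_compose[OF lim filterlim_real_sequentially] by (rule tendsto_ennrealI)
    ultimately show ?thesis using LIMSEQ_unique by metis
  qed
  moreover have "0 \<le> T"
  proof (rule tendsto_lowerbound[OF lim])
    show "\<forall>\<^sub>F t in at_top. 0 \<le> f t"
      using eventually_ge_at_top[of 0]
    proof eventually_elim
      case (elim t)
      then show ?case
        using nonincreasing_halfline[of "\<lambda>t. - f t" "\<lambda>t. - g t" 0 t] deriv nonneg f0
        by (auto intro!: DERIV_minus)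
    qed
  qed simp
  ultimately have "has_bochner_integral lborel G T"
    using G_meas G_nonneg by (intro has_bochner_integral_nn_integral) auto
  then show "set_integrable lborel {0..} g" "(LINT s:{0..}|lborel. g s) = T"
    by (simp_all add: set_integrable_def set_lebesgue_integral_def G_def[abs_def] has_bochner_integral_iff)
qed

section \<open>Integrability of the jump terms and bounds on F\<close>

context affine_process
begin

lemma sets_m: "sets m = sets psd0_borel"
  and m_moment: "(\<integral>\<^sup>+\<xi>. ennreal (min (norm \<xi>) 1) \<partial>m) < \<infinity>"
  using adm by (auto simp: admissible_def)

lemma space_m: "space m = psd_cone - {0}"
  using sets_eq_imp_space_eq[OF sets_m] by (simp add: space_restrict_space)

lemma measurable_m: "f \<in> borel_measurable borel \<Longrightarrow> f \<in> borel_measurable m"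
  unfolding measurable_cong_sets[OF sets_m refl] by (rule measurable_restrict_space1)

text \<open>On the punctured cone the minimum of norm and 1 is positive with finite integral, so its
  superlevel sets have finite mass and exhaust the space. The exchange of integrals in
  \<open>\<phi>_bound\<close> relies on this.\<close>

lemma sigma_finite_m: "sigma_finite_measure m"
proof
  define A where "A n = {\<xi> \<in> space m. 1 / real (Suc n) \<le> min (norm \<xi>) 1}" for n
  have meas: "(\<lambda>\<xi>. min (norm \<xi>) 1) \<in> borel_measurable m" by (rule measurable_m) simp
  then have A: "A n \<in> sets m" for n unfolding A_def by measurable
  have "emeasure m (A n) \<noteq> \<infinity>" for n
  proof -
    have "ennreal (1 / real (Suc n)) * emeasure m (A n) = (\<integral>\<^sup>+\<xi>. ennreal (1 / real (Suc n)) * indicator (A n) \<xi> \<partial>m)"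
      using A by (simp add: nn_integral_cmult_indicator)
    also have "\<dots> \<le> (\<integral>\<^sup>+\<xi>. ennreal (min (norm \<xi>) 1) \<partial>m)"
      by (intro nn_integral_mono) (auto simp: A_def indicator_def intro!: ennreal_leI)
    also have "\<dots> < \<infinity>" by (rule m_moment)
    finally show ?thesis by (auto simp: ennreal_mult_eq_top_iff)
  qed
  moreover have "(\<Union>n. A n) = space m"
  proof -
    have "\<exists>n. \<xi> \<in> A n" if "\<xi> \<in> space m" for \<xi>
    proof -
      have "0 < min (norm \<xi>) 1" using that by (simp add: space_m)
      from nat_approx_posE[OF this] obtain n where "1 / real (Suc n) < min (norm \<xi>) 1" by auto
      then show ?thesis using that by (auto simp: A_def intro!: exI[of _ n])
    qed
    then show ?thesis by (auto simp: A_def)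
  qed
  ultimately show "\<exists>A. countable A \<and> A \<subseteq> sets m \<and> \<Union> A = space m \<and> (\<forall>a\<in>A. emeasure m a \<noteq> \<infinity>)"
    using A by (intro exI[of _ "range A"]) auto
qed

lemma integrable_min: "integrable m (\<lambda>\<xi>. min (norm \<xi>) 1)"
  using m_moment by (intro integrableI_nonneg measurable_m) auto

lemma integrable_jump:
  assumes u: "u \<in> psd_cone"
  shows "integrable m (\<lambda>\<xi>. 1 - exp (- (u \<bullet> \<xi>)))"
proof (rule Bochner_Integration.integrable_bound)
  show "integrable m (\<lambda>\<xi>. (1 + norm u) * min (norm \<xi>) 1)"
    using integrable_min by simp
  have le: "min 1 (norm u * norm \<xi>) \<le> (1 + norm u) * min (norm \<xi>) 1" for \<xi> :: "real^'n^'n"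
  proof (cases "norm \<xi> \<le> 1")
    case True
    have "norm u * norm \<xi> \<le> (1 + norm u) * norm \<xi>" by (intro mult_right_mono) auto
    then show ?thesis using True by (simp add: min_def)
  qed (simp add: min.coboundedI1)
  have "\<bar>1 - exp (- (u \<bullet> \<xi>))\<bar> \<le> (1 + norm u) * min (norm \<xi>) 1" if "\<xi> \<in> space m" for \<xi>
  proof -
    have "\<xi> \<in> psd_cone" using that by (simp add: space_m)
    from jump_bounds[OF u this] le[of \<xi>] show ?thesis by linarith
  qed
  then show "AE \<xi> in m. norm (1 - exp (- (u \<bullet> \<xi>))) \<le> norm ((1 + norm u) * min (norm \<xi>) 1)"
    by (intro AE_I2, unfold real_norm_def) (rule order_trans[OF _ abs_ge_self])
qed (intro measurable_m, simp)

lemma F_fun_eq: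
  "F_fun b m u = b \<bullet> u + (\<integral>\<xi>. 1 - exp (- (u \<bullet> \<xi>)) \<partial>m)"
proof -
  have "(\<integral>\<xi>. exp (- (u \<bullet> \<xi>)) - 1 \<partial>m) = (\<integral>\<xi>. - (1 - exp (- (u \<bullet> \<xi>))) \<partial>m)" by simp
  also have "\<dots> = - (\<integral>\<xi>. 1 - exp (- (u \<bullet> \<xi>)) \<partial>m)" by (rule Bochner_Integration.integral_minus)
  finally show ?thesis by (simp add: F_fun_def)
qed

text \<open>The sign makes \<phi> increasing in time. The upper bound is left as an integral over
  jumps so that time can be integrated out first.\<close>

lemma F_fun_bounds:
  assumes u: "u \<in> psd_cone"
  shows "0 \<le> F_fun b m u"
    and "ennreal (F_fun b m u) \<le> ennreal (norm b * norm u) + (\<integral>\<^sup>+\<xi>. ennreal (min 1 (norm u * norm \<xi>)) \<partial>m)"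
proof -
  have b: "0 \<le> b \<bullet> u" using adm u by (auto simp: admissible_def intro: inner_psd_nonneg)
  have pos: "AE \<xi> in m. 0 \<le> 1 - exp (- (u \<bullet> \<xi>))"
    by (rule AE_I2, rule jump_bounds[OF u]) (simp add: space_m)
  have I: "0 \<le> (\<integral>\<xi>. 1 - exp (- (u \<bullet> \<xi>)) \<partial>m)" by (rule integral_nonneg_AE[OF pos])
  show "0 \<le> F_fun b m u" using b I by (simp add: F_fun_eq)
  have "ennreal (F_fun b m u) = ennreal (b \<bullet> u) + (\<integral>\<^sup>+\<xi>. ennreal (1 - exp (- (u \<bullet> \<xi>))) \<partial>m)"
    using b I by (simp add: F_fun_eq nn_integral_eq_integral[OF integrable_jump[OF u] pos])
  also have "\<dots> \<le> ennreal (norm b * norm u) + (\<integral>\<^sup>+\<xi>. ennreal (min 1 (norm u * norm \<xi>)) \<partial>m)"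
    using jump_bounds(2)[OF u]
    by (intro add_mono nn_integral_mono ennreal_leI norm_cauchy_schwarz) (simp add: space_m)
  finally show "ennreal (F_fun b m u) \<le> ennreal (norm b * norm u) + (\<integral>\<^sup>+\<xi>. ennreal (min 1 (norm u * norm \<xi>)) \<partial>m)" .
qed

end

section \<open>Time integrals under exponential decay\<close>

lemma exp_decay_tendsto:
  fixes \<delta> :: real
  assumes "0 < \<delta>"
  shows "((\<lambda>s. exp (- (\<delta> * s))) \<longlongrightarrow> 0) at_top"
proof (rule filterlim_compose[OF exp_at_bot])
  show "filterlim (\<lambda>s. - (\<delta> * s)) at_bot at_top"
    using assms by (simp add: filterlim_uminus_at_bot filterlim_tendsto_pos_mult_at_top[OF tendsto_const _ filterlim_ident])
qed

text \<open>The integrand is minus the derivative of (2 / \<delta>) ln (1 + r exp (- \<delta> s)),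
  which is how the logarithm appears. The factor 2 belongs to the estimate min 1 x \<le> 2 x / (1 +
  x).\<close>

lemma nn_integral_saturating_exp:
  fixes r \<delta> :: real
  assumes "0 \<le> r" "0 < \<delta>"
  shows "(\<integral>\<^sup>+s. ennreal (2 * (r * exp (- (\<delta> * s))) / (1 + r * exp (- (\<delta> * s)))) * indicator {0..} s \<partial>lborel)
    = ennreal (2 / \<delta> * ln (1 + r))"
proof -
  have pos: "0 < 1 + r * exp (- (\<delta> * s))" for s using assms(1) by (simp add: add_pos_nonneg)
  have "((\<lambda>s. - (2 / \<delta>) * ln (1 + r * exp (- (\<delta> * s)))) \<longlongrightarrow> - (2 / \<delta>) * ln (1 + r * 0)) at_top"
  proof (intro tendsto_intros)
    show "((\<lambda>s. exp (- (\<delta> * s))) \<longlongrightarrow> 0) at_top" by (rule exp_decay_tendsto[OF assms(2)])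
  qed simp
  then have "(\<integral>\<^sup>+s. ennreal (2 * (r * exp (- (\<delta> * s))) / (1 + r * exp (- (\<delta> * s)))) * indicator {0..} s \<partial>lborel)
    = ennreal (- (2 / \<delta>) * ln (1 + r * 0) - (- (2 / \<delta>) * ln (1 + r * exp (- (\<delta> * 0)))))"
  proof (rule nn_integral_FTC_atLeast[rotated 3])
    fix s :: real
    show "((\<lambda>s. - (2 / \<delta>) * ln (1 + r * exp (- (\<delta> * s)))) has_real_derivative
        2 * (r * exp (- (\<delta> * s))) / (1 + r * exp (- (\<delta> * s)))) (at s)"
    proof -
      define e where "e = exp (- (\<delta> * s))"
      have "((\<lambda>s. ln (1 + r * exp (- (\<delta> * s)))) has_real_derivative
          1 / (1 + r * e) * (r * (e * - \<delta>))) (at s)"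
        using pos[of s] by (auto intro!: derivative_eq_intros simp: e_def)
      from DERIV_cmult[OF this, of "- (2 / \<delta>)"] show ?thesis
        using assms(2) by (simp add: e_def[symmetric])
    qed
    show "0 \<le> 2 * (r * exp (- (\<delta> * s))) / (1 + r * exp (- (\<delta> * s)))"
      using pos[of s] assms(1) by simp
  qed simp
  then show ?thesis by simp
qed

lemma nn_integral_exp_decay:
  fixes c \<delta> :: real
  assumes "0 \<le> c" "0 < \<delta>"
  shows "(\<integral>\<^sup>+s. ennreal (c * exp (- (\<delta> * s))) * indicator {0..} s \<partial>lborel) = ennreal (c / \<delta>)"
proof -
  have "((\<lambda>s. - (c / \<delta>) * exp (- (\<delta> * s))) \<longlongrightarrow> - (c / \<delta>) * 0) at_top"
  proof (intro tendsto_intros)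
    show "((\<lambda>s. exp (- (\<delta> * s))) \<longlongrightarrow> 0) at_top" by (rule exp_decay_tendsto[OF assms(2)])
  qed
  then have "(\<integral>\<^sup>+s. ennreal (c * exp (- (\<delta> * s))) * indicator {0..} s \<partial>lborel)
    = ennreal (- (c / \<delta>) * 0 - (- (c / \<delta>) * exp (- (\<delta> * 0))))"
  proof (rule nn_integral_FTC_atLeast[rotated 3])
    fix s :: real
    show "((\<lambda>s. - (c / \<delta>) * exp (- (\<delta> * s))) has_real_derivative c * exp (- (\<delta> * s))) (at s)"
      using assms(2) by (auto intro!: derivative_eq_intros)
  qed (use assms in auto)
  then show ?thesis by simp
qed

section \<open>Boundedness and limit of \<phi>, and vanishing of \<psi>\<close>

context affine_process
begin

lemma integrable_ln_moment: "integrable m (\<lambda>\<xi>. ln (norm \<xi>) * indicator {1<..} (norm \<xi>))"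
proof (rule integrableI_nonneg)
  show "(\<lambda>\<xi>. ln (norm \<xi>) * indicator {1<..} (norm \<xi>)) \<in> borel_measurable m"
    by (rule measurable_m) measurable
  have "(\<integral>\<^sup>+\<xi>. ennreal (ln (norm \<xi>) * indicator {1<..} (norm \<xi>)) \<partial>m)
      = (\<integral>\<^sup>+\<xi>\<in>{\<xi>. norm \<xi> > 1}. ennreal (ln (norm \<xi>)) \<partial>m)"
    by (intro nn_integral_cong) (simp add: indicator_def)
  then show "(\<integral>\<^sup>+\<xi>. ennreal (ln (norm \<xi>) * indicator {1<..} (norm \<xi>)) \<partial>m) < \<infinity>"
    using log_moment by simp
qed (auto simp: indicator_def)

lemma integrable_ln:
  assumes "0 \<le> a"
  shows "integrable m (\<lambda>\<xi>. ln (1 + a * norm \<xi>))"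
proof (rule Bochner_Integration.integrable_bound)
  show "integrable m (\<lambda>\<xi>. a * min (norm \<xi>) 1 + ln (norm \<xi>) * indicator {1<..} (norm \<xi>))"
    using integrable_min integrable_ln_moment by simp
  show "(\<lambda>\<xi>. ln (1 + a * norm \<xi>)) \<in> borel_measurable m" by (rule measurable_m) measurable
  show "AE \<xi> in m. norm (ln (1 + a * norm \<xi>)) \<le> norm (a * min (norm \<xi>) 1 + ln (norm \<xi>) * indicator {1<..} (norm \<xi>))"
  proof (rule AE_I2)
    fix \<xi> assume "\<xi> \<in> space m"
    then have "0 < norm \<xi>" by (simp add: space_m)
    from ln_moment_bound[OF assms this]
    show "norm (ln (1 + a * norm \<xi>)) \<le> norm (a * min (norm \<xi>) 1 + ln (norm \<xi>) * indicator {1<..} (norm \<xi>))"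
      by simp
  qed
qed

text \<open>Tonelli's theorem exchanges time and jumps. The second property of K is stated along c /
  (n + 1) because tightness is tested with the identity matrix divided by n + 1.\<close>

lemma \<phi>_bound:
  obtains K where "\<And>u t. u \<in> psd_cone \<Longrightarrow> 0 \<le> t \<Longrightarrow> \<phi> t u \<le> K (norm u)"
    "\<And>c. 0 \<le> c \<Longrightarrow> (\<lambda>n. K (c / real (Suc n))) \<longlonglongrightarrow> 0"
proof -
  obtain C \<delta> where C: "0 < C" and \<delta>: "0 < \<delta>"
    and decay: "\<And>u t. u \<in> psd_cone \<Longrightarrow> 0 \<le> t \<Longrightarrow> norm (\<psi> t u) \<le> C * norm u * exp (- (\<delta> * t))"
    using \<psi>_decay by blast
  define K where "K v = norm b * (C * v) / \<delta> + 2 / \<delta> * (\<integral>\<xi>. ln (1 + C * v * norm \<xi>) \<partial>m)" for v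
  show thesis
  proof
    fix u :: "real^'n^'n" and t :: real assume u: "u \<in> psd_cone" and t: "0 \<le> t"
    define a where "a = C * norm u"
    have a: "0 \<le> a" using C by (simp add: a_def)
    define g where "g s \<xi> = ennreal (2 * (a * norm \<xi> * exp (- (\<delta> * s))) / (1 + a * norm \<xi> * exp (- (\<delta> * s)))) * indicator {0..} s"
      for s and \<xi> :: "real^'n^'n"
    interpret m: sigma_finite_measure m by (rule sigma_finite_m)
    interpret pair_sigma_finite lborel m by unfold_locales
    have [measurable]: "norm \<in> borel_measurable m" by (rule measurable_m) simp
    have g_meas: "case_prod g \<in> borel_measurable (lborel \<Otimes>\<^sub>M m)"
      unfolding g_def split_beta' by measurable
    have "(F_fun b m \<circ> (\<lambda>s. \<psi> s u) has_integral \<phi> t u - \<phi> 0 u) {0..t}"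
      using \<phi>_deriv[OF u] t
      by (intro fundamental_theorem_of_calculus)
         (auto simp flip: has_real_derivative_iff_has_vector_derivative intro!: DERIV_subset[OF \<phi>_deriv[OF u]])
    then have "ennreal (\<phi> t u) = (\<integral>\<^sup>+s. ennreal (F_fun b m (\<psi> s u)) * indicator {0..t} s \<partial>lborel)"
      using F_fun_bounds(1)[OF \<psi>_psd[OF u]]
      by (subst nn_integral_has_integral_lebesgue') (auto simp: \<phi>_0[OF u] comp_def)
    also have "\<dots> \<le> (\<integral>\<^sup>+s. ennreal (norm b * a * exp (- (\<delta> * s))) * indicator {0..} s + (\<integral>\<^sup>+\<xi>. g s \<xi> \<partial>m) \<partial>lborel)"
    proof (rule nn_integral_mono)
      fix s :: real
      show "ennreal (F_fun b m (\<psi> s u)) * indicator {0..t} s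
          \<le> ennreal (norm b * a * exp (- (\<delta> * s))) * indicator {0..} s + (\<integral>\<^sup>+\<xi>. g s \<xi> \<partial>m)"
      proof (cases "s \<in> {0..t}")
        case True
        then have s: "0 \<le> s" by simp
        define n where "n = norm (\<psi> s u)"
        have n: "0 \<le> n" "n \<le> a * exp (- (\<delta> * s))" using decay[OF u s] by (simp_all add: n_def a_def)
        have "ennreal (F_fun b m (\<psi> s u)) \<le> ennreal (norm b * n) + (\<integral>\<^sup>+\<xi>. ennreal (min 1 (n * norm \<xi>)) \<partial>m)"
          using F_fun_bounds(2)[OF \<psi>_psd[OF u s]] by (simp add: n_def)
        also have "\<dots> \<le> ennreal (norm b * a * exp (- (\<delta> * s))) + (\<integral>\<^sup>+\<xi>. g s \<xi> \<partial>m)"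
        proof (intro add_mono nn_integral_mono)
          show "ennreal (norm b * n) \<le> ennreal (norm b * a * exp (- (\<delta> * s)))"
            using mult_left_mono[OF n(2), of "norm b"] by (intro ennreal_leI) (simp add: mult.assoc)
          fix \<xi> :: "real^'n^'n"
          define x where "x = a * norm \<xi> * exp (- (\<delta> * s))"
          have "n * norm \<xi> \<le> x"
            using mult_right_mono[OF n(2), of "norm \<xi>"] by (simp add: x_def mult_ac)
          moreover have "0 \<le> n * norm \<xi>" using n(1) by simp
          ultimately have x: "0 \<le> x" "min 1 (n * norm \<xi>) \<le> min 1 x" by auto
          \<comment> \<open>For x \<le> 1 the left side is x + x x, and for larger x it is 1 +
            x.\<close>
          have "min 1 x * (1 + x) \<le> 2 * x"
            using x(1) by (cases "x \<le> 1") (auto simp: min_def distrib_left mult_left_le)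
          then have "min 1 x \<le> 2 * x / (1 + x)" using x(1) by (simp add: pos_le_divide_eq)
          then show "ennreal (min 1 (n * norm \<xi>)) \<le> g s \<xi>"
            using x s by (simp add: g_def x_def[symmetric] ennreal_leI)
        qed
        finally show ?thesis using True by simp
      qed simp
    qed
    also have "\<dots> = (\<integral>\<^sup>+s. ennreal (norm b * a * exp (- (\<delta> * s))) * indicator {0..} s \<partial>lborel)
        + (\<integral>\<^sup>+s. \<integral>\<^sup>+\<xi>. g s \<xi> \<partial>m \<partial>lborel)"
      by (rule nn_integral_add) (use m.borel_measurable_nn_integral[OF g_meas] in auto)
    also have "(\<integral>\<^sup>+s. ennreal (norm b * a * exp (- (\<delta> * s))) * indicator {0..} s \<partial>lborel) = ennreal (norm b * a / \<delta>)"
      using a \<delta> by (intro nn_integral_exp_decay) auto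
    also have "(\<integral>\<^sup>+s. \<integral>\<^sup>+\<xi>. g s \<xi> \<partial>m \<partial>lborel) = (\<integral>\<^sup>+\<xi>. \<integral>\<^sup>+s. g s \<xi> \<partial>lborel \<partial>m)"
      using Fubini'[OF g_meas] by simp
    also have "\<dots> = (\<integral>\<^sup>+\<xi>. ennreal (2 / \<delta> * ln (1 + a * norm \<xi>)) \<partial>m)"
      unfolding g_def using a \<delta> by (intro nn_integral_cong nn_integral_saturating_exp) auto
    also have "\<dots> = ennreal (\<integral>\<xi>. 2 / \<delta> * ln (1 + a * norm \<xi>) \<partial>m)"
      using integrable_ln[OF a] a \<delta> by (intro nn_integral_eq_integral AE_I2) auto
    also have "ennreal (norm b * a / \<delta>) + \<dots> = ennreal (K (norm u))"
      using a \<delta> by (subst ennreal_plus[symmetric]) (auto simp: K_def a_def intro!: integral_nonneg)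
    finally show "\<phi> t u \<le> K (norm u)"
    proof (rule ennreal_le_iff[THEN iffD1, rotated])
      show "0 \<le> K (norm u)"
        unfolding K_def a_def[symmetric] using a \<delta>
        by (intro add_nonneg_nonneg mult_nonneg_nonneg divide_nonneg_nonneg integral_nonneg) auto
    qed
  next
    fix c :: real assume c: "0 \<le> c"
    have z: "(\<lambda>n. c / real (Suc n)) \<longlonglongrightarrow> 0"
      using tendsto_mult_right_zero[OF LIMSEQ_Suc[OF lim_1_over_n], of c] by simp
    \<comment> \<open>The integrand for n = 0, where the argument is c itself, dominates all the
      others.\<close>
    have "(\<lambda>n. \<integral>\<xi>. ln (1 + C * (c / real (Suc n)) * norm \<xi>) \<partial>m) \<longlonglongrightarrow> (\<integral>\<xi>. 0 \<partial>m)"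
    proof (rule integral_dominated_convergence[where w = "\<lambda>\<xi>. ln (1 + C * c * norm \<xi>)"])
      show "integrable m (\<lambda>\<xi>. ln (1 + C * c * norm \<xi>))" using c C by (intro integrable_ln) simp
      show "(\<lambda>\<xi>. ln (1 + C * (c / real (Suc n)) * norm \<xi>)) \<in> borel_measurable m" for n
        by (rule measurable_m) measurable
      have "(\<lambda>n. ln (1 + C * (c / real (Suc n)) * norm \<xi>)) \<longlonglongrightarrow> ln (1 + C * 0 * norm \<xi>)" for \<xi> :: "real^'n^'n"
        by (intro tendsto_intros z) simp
      then show "AE \<xi> in m. (\<lambda>n. ln (1 + C * (c / real (Suc n)) * norm \<xi>)) \<longlonglongrightarrow> 0" by simp
      have "norm (ln (1 + C * (c / real (Suc n)) * norm \<xi>)) \<le> ln (1 + C * c * norm \<xi>)" for n and \<xi> :: "real^'n^'n"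
      proof -
        have "c / real (Suc n) \<le> c" using c by (simp add: divide_le_eq mult_le_cancel_left1)
        then have 1: "C * (c / real (Suc n)) * norm \<xi> \<le> C * c * norm \<xi>"
          using C by (intro mult_right_mono mult_left_mono) auto
        have 0: "0 \<le> C * (c / real (Suc n)) * norm \<xi>" using c C by simp
        show ?thesis using 0 1 by simp
      qed
      then show "AE \<xi> in m. norm (ln (1 + C * (c / real (Suc n)) * norm \<xi>)) \<le> ln (1 + C * c * norm \<xi>)" for n by simp
    qed simp
    then have "(\<lambda>n. K (c / real (Suc n))) \<longlonglongrightarrow> norm b * (C * 0) / \<delta> + 2 / \<delta> * (\<integral>\<xi>. 0 \<partial>m)"
      unfolding K_def using \<delta> by (intro tendsto_intros z) auto
    then show "(\<lambda>n. K (c / real (Suc n))) \<longlonglongrightarrow> 0" by simp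
  qed
qed

lemma \<phi>_mono:
  assumes u: "u \<in> psd_cone" and st: "0 \<le> s" "s \<le> t"
  shows "\<phi> s u \<le> \<phi> t u"
proof -
  have "- \<phi> t u \<le> - \<phi> s u"
    by (rule nonincreasing_halfline[OF DERIV_minus[OF \<phi>_deriv[OF u]] _ st])
       (simp_all add: F_fun_bounds(1)[OF \<psi>_psd[OF u]])
  then show ?thesis by simp
qed

text \<open>A divergent integral would default to 0, so \<open>\<phi>_tendsto\<close> proves
  integrability along with the convergence of \<phi> to this value.\<close>

definition \<phi>_lim :: "real^'n^'n \<Rightarrow> real" where
  "\<phi>_lim u = (LINT s:{0..}|lborel. F_fun b m (\<psi> s u))"

lemma \<phi>_tendsto:
  assumes u: "u \<in> psd_cone"
  shows "set_integrable lborel {0..} (\<lambda>s. F_fun b m (\<psi> s u))" "((\<lambda>t. \<phi> t u) \<longlongrightarrow> \<phi>_lim u) at_top"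
proof -
  define T where "T = (SUP t\<in>{0..}. \<phi> t u)"
  have bdd: "bdd_above ((\<lambda>t. \<phi> t u) ` {0..})" 
  proof (rule \<phi>_bound)
    fix K assume "\<And>u t. u \<in> psd_cone \<Longrightarrow> 0 \<le> t \<Longrightarrow> \<phi> t u \<le> K (norm u)"
    then show ?thesis using u by (intro bdd_aboveI2[of _ _ "K (norm u)"]) auto
  qed
  have lim: "((\<lambda>t. \<phi> t u) \<longlongrightarrow> T) at_top"
  proof (rule increasing_tendsto)
    show "\<forall>\<^sub>F t in at_top. \<phi> t u \<le> T"
      using eventually_ge_at_top[of 0] by eventually_elim (auto simp: T_def intro!: cSUP_upper bdd)
    fix x assume "x < T"
    then obtain s where s: "0 \<le> s" "x < \<phi> s u" unfolding T_def using less_cSUP_iff[OF _ bdd] by auto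
    show "\<forall>\<^sub>F t in at_top. x < \<phi> t u"
      using eventually_ge_at_top[of s]
      by eventually_elim (use s \<phi>_mono[OF u s(1)] in \<open>auto intro: less_le_trans\<close>)
  qed
  note FTC = integral_halfline_FTC[OF \<phi>_deriv[OF u] F_fun_bounds(1)[OF \<psi>_psd[OF u]] \<phi>_0[OF u] lim]
  show "set_integrable lborel {0..} (\<lambda>s. F_fun b m (\<psi> s u))" by (rule FTC(1))
  show "((\<lambda>t. \<phi> t u) \<longlongrightarrow> \<phi>_lim u) at_top" using lim FTC(2) by (simp add: \<phi>_lim_def)
qed

lemma \<psi>_tendsto:
  assumes u: "u \<in> psd_cone"
  shows "((\<lambda>t. \<psi> t u) \<longlongrightarrow> 0) at_top"
proof -
  obtain C \<delta> where C: "0 < C" and \<delta>: "0 < \<delta>"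
    and decay: "\<And>u t. u \<in> psd_cone \<Longrightarrow> 0 \<le> t \<Longrightarrow> norm (\<psi> t u) \<le> C * norm u * exp (- (\<delta> * t))"
    using \<psi>_decay by blast
  from exp_decay_tendsto[OF \<delta>] have "((\<lambda>t. C * norm u * exp (- (\<delta> * t))) \<longlongrightarrow> 0) at_top" by (rule tendsto_mult_right_zero)
  then show ?thesis
    by (rule Lim_null_comparison[rotated])
       (use eventually_ge_at_top[of 0] in \<open>rule eventually_mono\<close>, use decay[OF u] in auto)
qed

end

section \<open>The stationary law\<close>

context affine_process
begin

lemma p_measurable: "0 \<le> t \<Longrightarrow> p t \<in> psd_borel \<rightarrow>\<^sub>M prob_algebra psd_borel"
  and p_Chapman: "0 \<le> s \<Longrightarrow> 0 \<le> t \<Longrightarrow> x \<in> psd_cone \<Longrightarrow> p (s + t) x = p s x \<bind> p t"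
  and p_laplace: "0 \<le> t \<Longrightarrow> x \<in> psd_cone \<Longrightarrow> u \<in> psd_cone \<Longrightarrow>
    (\<integral>\<xi>. exp (- (u \<bullet> \<xi>)) \<partial>(p t x)) = exp (- \<phi> t u - \<psi> t u \<bullet> x)"
  using kernel by (auto simp: affine_kernel_def transition_kernel_def)

lemma p_prob:
  assumes "0 \<le> t" "x \<in> psd_cone"
  shows "prob_space (p t x)" "sets (p t x) = sets psd_borel"
proof -
  have "p t x \<in> space (prob_algebra psd_borel)"
    using measurable_space[OF p_measurable[OF assms(1)], of x] assms(2) by (simp add: space_restrict_space)
  then show "prob_space (p t x)" "sets (p t x) = sets psd_borel" by (auto simp: space_prob_algebra)
qed

text \<open>The affine formula is exponential in the starting point, so \<psi> acts on the argument
  of the Laplace transform and \<phi> contributes a factor. The flow property, invariance and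
  uniqueness are all read off from this.\<close>

lemma bind_laplace:
  assumes M: "prob_space M" "sets M = sets psd_borel" and t: "0 \<le> t" and u: "u \<in> psd_cone"
  shows "(\<integral>\<xi>. exp (- (u \<bullet> \<xi>)) \<partial>(M \<bind> p t)) = exp (- \<phi> t u) * (\<integral>x. exp (- (\<psi> t u \<bullet> x)) \<partial>M)"
proof -
  have pt: "p t \<in> M \<rightarrow>\<^sub>M subprob_algebra psd_borel"
    unfolding measurable_cong_sets[OF M(2) refl] by (rule measurable_prob_algebraD[OF p_measurable[OF t]])
  have "(\<integral>\<xi>. exp (- (u \<bullet> \<xi>)) \<partial>(M \<bind> p t)) = (\<integral>x. \<integral>\<xi>. exp (- (u \<bullet> \<xi>)) \<partial>p t x \<partial>M)"
  proof (rule integral_bind[OF _ _ pt, where B' = 1 and B = 1])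
    show "(\<lambda>\<xi>. exp (- (u \<bullet> \<xi>))) \<in> borel_measurable psd_borel"
      by (rule borel_measurable_psd_borel) auto
    show "\<bar>exp (- (u \<bullet> \<xi>))\<bar> \<le> 1" if "\<xi> \<in> space psd_borel" for \<xi>
      using that inner_psd_nonneg[OF u] by (simp add: space_restrict_space)
    show "finite_measure M" using M(1) by (simp add: prob_space_def)
    show "AE x in M. emeasure (p t x) (space (p t x)) \<le> ennreal 1"
      using p_prob(1)[OF t] by (intro AE_I2) (simp add: space_psd_borel[OF M(2)] prob_space.emeasure_space_1)
  qed
  also have "\<dots> = (\<integral>x. exp (- \<phi> t u) * exp (- (\<psi> t u \<bullet> x)) \<partial>M)"
    by (intro Bochner_Integration.integral_cong refl)
       (simp add: space_psd_borel[OF M(2)] p_laplace[OF t _ u] mult_exp_exp)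
  finally show ?thesis by simp
qed

text \<open>Starting at 0 removes the \<psi>-term from the exponent, and injectivity of exp leaves
  an identity for \<phi> alone.\<close>

lemma \<phi>_flow:
  assumes t: "0 \<le> t" and s: "0 \<le> s" and u: "u \<in> psd_cone"
  shows "\<phi> (s + t) u = \<phi> t u + \<phi> s (\<psi> t u)"
proof -
  have "exp (- \<phi> (s + t) u) = exp (- \<phi> t u) * exp (- \<phi> s (\<psi> t u))"
    using bind_laplace[OF p_prob[OF s psd_cone_0] t u] p_laplace[OF s psd_cone_0 \<psi>_psd[OF u t]]
      p_laplace[OF _ psd_cone_0 u, of "s + t"] s t
    by (simp add: p_Chapman[OF s t psd_cone_0])
  then have "exp (- \<phi> (s + t) u) = exp (- (\<phi> t u + \<phi> s (\<psi> t u)))" by (simp add: exp_add[symmetric])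
  then show ?thesis by simp
qed

text \<open>Letting s tend to infinity in the flow identity. Under exp it says that the kernel
  preserves the limiting Laplace transform.\<close>

lemma \<phi>_lim_flow:
  assumes t: "0 \<le> t" and u: "u \<in> psd_cone"
  shows "\<phi>_lim u = \<phi> t u + \<phi>_lim (\<psi> t u)"
proof -
  have "((\<lambda>s. \<phi> t u + \<phi> s (\<psi> t u)) \<longlongrightarrow> \<phi> t u + \<phi>_lim (\<psi> t u)) at_top"
    by (intro tendsto_intros \<phi>_tendsto(2) \<psi>_psd u t)
  moreover have "((\<lambda>s. \<phi> (s + t) u) \<longlongrightarrow> \<phi>_lim u) at_top"
    by (rule filterlim_compose[OF \<phi>_tendsto(2)[OF u]])
       (rule filterlim_at_top_mono[OF filterlim_ident], use t in simp)
  then have "((\<lambda>s. \<phi> t u + \<phi> s (\<psi> t u)) \<longlongrightarrow> \<phi>_lim u) at_top"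
    by (rule Lim_transform_eventually)
       (use eventually_ge_at_top[of 0] in \<open>eventually_elim, simp add: \<phi>_flow[OF t _ u]\<close>)
  ultimately show ?thesis using tendsto_unique[OF trivial_limit_at_top_linorder] by blast
qed

lemma p_laplace_tendsto:
  assumes x: "x \<in> psd_cone" and u: "u \<in> psd_cone"
  shows "((\<lambda>t. \<integral>\<xi>. exp (- (u \<bullet> \<xi>)) \<partial>(p t x)) \<longlongrightarrow> exp (- \<phi>_lim u)) at_top"
proof -
  have "((\<lambda>t. exp (- \<phi> t u - \<psi> t u \<bullet> x)) \<longlongrightarrow> exp (- \<phi>_lim u - 0 \<bullet> x)) at_top"
    by (intro tendsto_intros \<phi>_tendsto(2) \<psi>_tendsto u)
  then have "((\<lambda>t. exp (- \<phi> t u - \<psi> t u \<bullet> x)) \<longlongrightarrow> exp (- \<phi>_lim u)) at_top" by simp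
  then show ?thesis
    by (rule Lim_transform_eventually)
       (use eventually_ge_at_top[of 0] in \<open>eventually_elim, simp add: p_laplace[OF _ x u]\<close>)
qed

text \<open>Markov's inequality for 1 - exp (- z) with z = \<open>u \<bullet> \<xi>\<close>. For u
  the identity divided by n + 1, z is the trace over n + 1 and exceeds 1 once the norm exceeds n +
  1. The expectation is at most \<phi> + \<open>\<psi> t u \<bullet> x\<close>, small uniformly in
  time for some n.\<close>

lemma p_tight:
  assumes x: "x \<in> psd_cone" and e: "0 < e"
  shows "\<exists>r. \<forall>t\<ge>0. measure (p t x) {\<xi> \<in> psd_cone. r < norm \<xi>} < e"
proof (rule \<phi>_bound)
  fix K assume K: "\<And>u t. u \<in> psd_cone \<Longrightarrow> 0 \<le> t \<Longrightarrow> \<phi> t u \<le> K (norm u)"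
    and K0: "\<And>c. 0 \<le> c \<Longrightarrow> (\<lambda>n. K (c / real (Suc n))) \<longlonglongrightarrow> 0"
  obtain C \<delta> where C: "0 < C" and \<delta>: "0 < \<delta>"
    and decay: "\<And>u t. u \<in> psd_cone \<Longrightarrow> 0 \<le> t \<Longrightarrow> norm (\<psi> t u) \<le> C * norm u * exp (- (\<delta> * t))"
    using \<psi>_decay by blast
  define c where "c = norm (mat 1 :: real^'n^'n)"
  define D where "D n = K (c / real (Suc n)) + C * (c / real (Suc n)) * norm x" for n
  have z: "(\<lambda>n. c / real (Suc n)) \<longlonglongrightarrow> 0"
    using tendsto_mult_right_zero[OF LIMSEQ_Suc[OF lim_1_over_n], of c] by simp
  have "(\<lambda>n. D n) \<longlonglongrightarrow> 0 + C * 0 * norm x"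
    unfolding D_def
    by (intro tendsto_intros K0 z) (simp add: c_def)
  then have "D \<longlonglongrightarrow> 0" by simp
  then have "\<forall>\<^sub>F n in sequentially. D n < e / 2" by (rule order_tendstoD) (use e in simp)
  \<comment> \<open>Half of e, because on the tail the integrand is only bounded below by 1/2, from
    exp (- 1) \<le> 1/2.\<close>
  then obtain n where n: "D n < e / 2" by (auto simp: eventually_sequentially)
  define u :: "real^'n^'n" where "u = (1 / real (Suc n)) *\<^sub>R mat 1"
  have u: "u \<in> psd_cone" unfolding u_def by (intro psd_cone_scaleR mat_1_psd) simp
  have nu: "norm u = c / real (Suc n)" by (simp add: u_def c_def)
  have "measure (p t x) {\<xi> \<in> psd_cone. real (Suc n) < norm \<xi>} < e" if t: "0 \<le> t" for t
  proof -
    let ?A = "{\<xi> \<in> psd_cone. real (Suc n) < norm \<xi>}"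
    note P = p_prob[OF t x]
    interpret prob_space "p t x" by (rule P)
    have A: "?A \<in> sets (p t x)"
      unfolding P(2) sets_psd_borel using borel_closed[OF closed_psd_cone]
      by (auto simp: Collect_conj_eq intro!: sets.Int)
    have int: "integrable (p t x) (\<lambda>\<xi>. exp (- (u \<bullet> \<xi>)))" by (rule integrable_psd_exp[OF P u])
    have "1 / 2 * measure (p t x) ?A = (\<integral>\<xi>. 1 / 2 * indicator ?A \<xi> \<partial>p t x)"
      using A by simp
    also have "\<dots> \<le> (\<integral>\<xi>. 1 - exp (- (u \<bullet> \<xi>)) \<partial>p t x)"
    proof (rule integral_mono)
      show "integrable (p t x) (\<lambda>\<xi>. 1 / 2 * indicator ?A \<xi> :: real)"
        using A by (auto intro!: integrable_real_indicator simp: emeasure_eq_measure)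
      show "integrable (p t x) (\<lambda>\<xi>. 1 - exp (- (u \<bullet> \<xi>)))" using int by simp
      fix \<xi> assume "\<xi> \<in> space (p t x)"
      then have \<xi>: "\<xi> \<in> psd_cone" by (simp add: space_psd_borel[OF P(2)])
      show "1 / 2 * indicator ?A \<xi> \<le> 1 - exp (- (u \<bullet> \<xi>))"
      proof (cases "\<xi> \<in> ?A")
        case True
        have "u \<bullet> \<xi> = trace \<xi> / real (Suc n)"
          by (simp add: u_def inner_commute[of "mat 1"] mat_1_inner)
        moreover have "real (Suc n) < trace \<xi>" using True norm_le_trace[OF \<xi>] by auto
        ultimately have "1 < u \<bullet> \<xi>" by (simp add: less_divide_eq)
        then have "exp (- (u \<bullet> \<xi>)) \<le> exp (- 1)" by simp
        also have "\<dots> \<le> 1 / (2::real)"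
          using exp_ge_add_one_self[of "1::real"] by (simp add: exp_minus field_simps)
        finally show ?thesis using True by simp
      next
        case False
        then show ?thesis using inner_psd_nonneg[OF u \<xi>] by simp
      qed
    qed
    also have "\<dots> = 1 - exp (- \<phi> t u - \<psi> t u \<bullet> x)"
      using int by (simp add: p_laplace[OF t x u] prob_space)
    also have "\<dots> \<le> \<phi> t u + \<psi> t u \<bullet> x"
      using exp_ge_add_one_self[of "- \<phi> t u - \<psi> t u \<bullet> x"] by linarith
    also have "\<phi> t u \<le> K (c / real (Suc n))" using K[OF u t] by (simp add: nu)
    also have "\<psi> t u \<bullet> x \<le> C * (c / real (Suc n)) * norm x"
    proof -
      have "\<psi> t u \<bullet> x \<le> norm (\<psi> t u) * norm x" by (rule norm_cauchy_schwarz)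
      also have "norm (\<psi> t u) \<le> C * norm u * 1"
        by (rule order_trans[OF decay[OF u t] mult_left_mono]) (use C \<delta> t in auto)
      finally show ?thesis by (simp add: nu mult_right_mono)
    qed
    finally show ?thesis using n by (simp add: D_def)
  qed
  then show ?thesis by blast
qed

text \<open>Prescribing the Laplace transform leaves at most one candidate; weak limits of the
  kernel and invariant laws are each shown to meet it.\<close>

definition stationary :: "(real^'n^'n) measure \<Rightarrow> bool" where
  "stationary \<pi> \<longleftrightarrow> prob_space \<pi> \<and> sets \<pi> = sets psd_borel \<and>
     (\<forall>u\<in>psd_cone. (\<integral>x. exp (- (u \<bullet> x)) \<partial>\<pi>) = exp (- \<phi>_lim u))"

lemma stationary_unique: "stationary \<pi> \<Longrightarrow> stationary \<pi>' \<Longrightarrow> \<pi> = \<pi>'"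
  unfolding stationary_def by (intro psd_laplace_unique) auto

text \<open>Tightness prevents loss of mass. The exponentials are bounded and continuous on the
  cone, so the limit inherits the limiting Laplace transform.\<close>

lemma subsequence_stationary:
  assumes x: "x \<in> psd_cone" and T: "filterlim T at_top sequentially" "\<And>n. 0 \<le> T n"
  obtains r \<pi> where "strict_mono (r :: nat \<Rightarrow> nat)" "stationary \<pi>"
    "\<And>f::real^'n^'n \<Rightarrow> real. continuous_on psd_cone f \<Longrightarrow> bounded (f ` psd_cone) \<Longrightarrow>
       (\<lambda>n. \<integral>\<xi>. f \<xi> \<partial>p (T (r n)) x) \<longlonglongrightarrow> (\<integral>\<xi>. f \<xi> \<partial>\<pi>)"
proof (rule prokhorov_closed_convex[of psd_cone "\<lambda>n. p (T n) x"])
  show "closed (psd_cone :: (real^'n^'n) set)" "convex (psd_cone :: (real^'n^'n) set)"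
    by (rule closed_psd_cone convex_psd_cone)+
  show "(psd_cone :: (real^'n^'n) set) \<noteq> {}" using psd_cone_0 by blast
  show "prob_space (p (T n) x)" "sets (p (T n) x) = sets psd_borel" for n
    using p_prob[OF T(2) x] by auto
  show "\<exists>r. \<forall>n. measure (p (T n) x) {\<xi> \<in> psd_cone. r < norm \<xi>} < e" if "0 < e" for e
    using p_tight[OF x that] T(2) by blast
next
  fix r N
  assume r: "strict_mono (r :: nat \<Rightarrow> nat)" and N: "prob_space N" "sets N = sets psd_borel"
    and conv: "\<And>f::real^'n^'n \<Rightarrow> real. continuous_on psd_cone f \<Longrightarrow> bounded (f ` psd_cone) \<Longrightarrow>
       (\<lambda>n. \<integral>\<xi>. f \<xi> \<partial>p (T (r n)) x) \<longlonglongrightarrow> (\<integral>\<xi>. f \<xi> \<partial>N)"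
  have "stationary N"
    unfolding stationary_def
  proof (intro conjI N ballI)
    fix u :: "real^'n^'n" assume u: "u \<in> psd_cone"
    have "(\<lambda>n. \<integral>\<xi>. exp (- (u \<bullet> \<xi>)) \<partial>p (T (r n)) x) \<longlonglongrightarrow> (\<integral>\<xi>. exp (- (u \<bullet> \<xi>)) \<partial>N)"
    proof (rule conv)
      show "bounded ((\<lambda>\<xi>. exp (- (u \<bullet> \<xi>))) ` psd_cone)"
        unfolding bounded_iff using inner_psd_nonneg[OF u] by (intro exI[of _ 1]) auto
    qed (intro continuous_intros)
    moreover have "(\<lambda>n. \<integral>\<xi>. exp (- (u \<bullet> \<xi>)) \<partial>p (T (r n)) x) \<longlonglongrightarrow> exp (- \<phi>_lim u)"
      by (rule filterlim_compose[OF p_laplace_tendsto[OF x u]])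
         (rule filterlim_compose[OF T(1) filterlim_subseq[OF r]])
    ultimately show "(\<integral>x. exp (- (u \<bullet> x)) \<partial>N) = exp (- \<phi>_lim u)" by (rule LIMSEQ_unique)
  qed
  from that[OF r this conv] show thesis by blast
qed

lemma stationary_exists: "\<exists>\<pi>. stationary \<pi>"
  by (rule subsequence_stationary[OF psd_cone_0 filterlim_real_sequentially]) auto

text \<open>Subsequence principle: a deviation persisting along times tending to infinity would
  survive in a convergent subsequence, whose limit has to be \<pi> again.\<close>

lemma stationary_weak_limit:
  assumes \<pi>: "stationary \<pi>" and x: "x \<in> psd_cone"
  shows "weakly_tendsto (\<lambda>t. p t x) \<pi> at_top"
  unfolding weakly_tendsto_def
proof (intro allI impI, elim conjE)
  fix f :: "real^'n^'n \<Rightarrow> real" assume f: "continuous_on psd_cone f" "bounded (f ` psd_cone)"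
  show "((\<lambda>t. \<integral>\<xi>. f \<xi> \<partial>p t x) \<longlongrightarrow> (\<integral>\<xi>. f \<xi> \<partial>\<pi>)) at_top"
  proof (rule ccontr)
    assume "\<not> ?thesis"
    then obtain e where e: "0 < e" and "\<not> (\<forall>\<^sub>F t in at_top. dist (\<integral>\<xi>. f \<xi> \<partial>p t x) (\<integral>\<xi>. f \<xi> \<partial>\<pi>) < e)"
      unfolding tendsto_iff by blast
    then have "\<exists>t\<ge>N. e \<le> dist (\<integral>\<xi>. f \<xi> \<partial>p t x) (\<integral>\<xi>. f \<xi> \<partial>\<pi>)" for N
      unfolding eventually_at_top_linorder by (auto simp: not_less)
    then have "\<forall>n. \<exists>t. real n \<le> t \<and> e \<le> dist (\<integral>\<xi>. f \<xi> \<partial>p t x) (\<integral>\<xi>. f \<xi> \<partial>\<pi>)" by blast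
    then obtain T where T: "\<And>n. real n \<le> T n" "\<And>n. e \<le> dist (\<integral>\<xi>. f \<xi> \<partial>p (T n) x) (\<integral>\<xi>. f \<xi> \<partial>\<pi>)"
      by metis
    have lim: "filterlim T at_top sequentially"
      by (rule filterlim_at_top_mono[OF filterlim_real_sequentially]) (use T(1) in simp)
    have pos: "0 \<le> T n" for n using T(1)[of n] of_nat_0_le_iff[of n] by (rule order_trans[rotated])
    show False
    proof (rule subsequence_stationary[OF x lim pos])
      fix r \<pi>' assume st: "stationary \<pi>'"
        and conv: "\<And>f::real^'n^'n \<Rightarrow> real. continuous_on psd_cone f \<Longrightarrow> bounded (f ` psd_cone) \<Longrightarrow>
          (\<lambda>n. \<integral>\<xi>. f \<xi> \<partial>p (T (r n)) x) \<longlonglongrightarrow> (\<integral>\<xi>. f \<xi> \<partial>\<pi>')"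
      have "(\<lambda>n. \<integral>\<xi>. f \<xi> \<partial>p (T (r n)) x) \<longlonglongrightarrow> (\<integral>\<xi>. f \<xi> \<partial>\<pi>)"
        using conv[OF f] stationary_unique[OF st \<pi>] by simp
      from tendstoD[OF this e] obtain n where "dist (\<integral>\<xi>. f \<xi> \<partial>p (T (r n)) x) (\<integral>\<xi>. f \<xi> \<partial>\<pi>) < e"
        by (auto simp: eventually_sequentially)
      then show False using T(2)[of "r n"] by simp
    qed
  qed
qed

lemma stationary_invariant:
  assumes "stationary \<pi>"
  shows "invariant_distribution p \<pi>"
  unfolding invariant_distribution_def
proof (intro conjI allI impI)
  show \<pi>: "prob_space \<pi>" "sets \<pi> = sets psd_borel" using assms by (auto simp: stationary_def)
  fix t :: real assume t: "0 \<le> t"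
  have pt: "p t \<in> \<pi> \<rightarrow>\<^sub>M prob_algebra psd_borel"
    unfolding measurable_cong_sets[OF \<pi>(2) refl] by (rule p_measurable[OF t])
  have "stationary (\<pi> \<bind> p t)"
    unfolding stationary_def
  proof (intro conjI ballI)
    show "prob_space (\<pi> \<bind> p t)"
      by (rule prob_space.prob_space_bind[OF \<pi>(1) AE_I2 measurable_prob_algebraD[OF pt]])
         (simp add: space_psd_borel[OF \<pi>(2)] p_prob(1)[OF t])
    show "sets (\<pi> \<bind> p t) = sets psd_borel"
      by (rule sets_bind_measurable[OF measurable_prob_algebraD[OF pt]])
         (use space_psd_borel[OF \<pi>(2)] psd_cone_0 in auto)
    fix u :: "real^'n^'n" assume u: "u \<in> psd_cone"
    have "(\<integral>\<xi>. exp (- (u \<bullet> \<xi>)) \<partial>(\<pi> \<bind> p t)) = exp (- \<phi> t u) * exp (- \<phi>_lim (\<psi> t u))"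
      using bind_laplace[OF \<pi> t u] assms \<psi>_psd[OF u t] by (simp add: stationary_def)
    also have "\<dots> = exp (- \<phi>_lim u)"
      by (simp add: \<phi>_lim_flow[OF t u] exp_add[symmetric])
    finally show "(\<integral>\<xi>. exp (- (u \<bullet> \<xi>)) \<partial>(\<pi> \<bind> p t)) = exp (- \<phi>_lim u)" .
  qed
  then show "\<pi> \<bind> p t = \<pi>" using assms by (rule stationary_unique)
qed

text \<open>Invariance writes the Laplace transform of \<pi>, which does not depend on t, as exp (-
  \<phi> t u) times an integral that tends to 1 because \<psi> t u vanishes for large t.\<close>

lemma invariant_stationary:
  assumes inv: "invariant_distribution p \<pi>"
  shows "stationary \<pi>"
  unfolding stationary_def
proof (intro conjI ballI)
  show \<pi>: "prob_space \<pi>" "sets \<pi> = sets psd_borel" using inv by (auto simp: invariant_distribution_def)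
  interpret prob_space \<pi> by (rule \<pi>)
  fix u :: "real^'n^'n" assume u: "u \<in> psd_cone"
  have "(\<lambda>n. \<integral>x. exp (- (\<psi> (real n) u \<bullet> x)) \<partial>\<pi>) \<longlonglongrightarrow> (\<integral>x. 1 \<partial>\<pi>)"
  proof (rule integral_dominated_convergence[where w = "\<lambda>_. 1"])
    show "(\<lambda>x. exp (- (\<psi> (real n) u \<bullet> x))) \<in> borel_measurable \<pi>" for n
      by (rule borel_measurable_psd_borel[OF \<pi>(2)]) simp
    have "(\<lambda>n. exp (- (\<psi> (real n) u \<bullet> x))) \<longlonglongrightarrow> exp (- (0 \<bullet> x))" for x
      by (intro tendsto_intros filterlim_compose[OF \<psi>_tendsto[OF u] filterlim_real_sequentially])
    then show "AE x in \<pi>. (\<lambda>n. exp (- (\<psi> (real n) u \<bullet> x))) \<longlonglongrightarrow> 1" by simp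
    show "AE x in \<pi>. norm (exp (- (\<psi> (real n) u \<bullet> x))) \<le> 1" for n
      by (rule AE_I2) (simp add: space_psd_borel[OF \<pi>(2)] inner_psd_nonneg \<psi>_psd[OF u])
  qed auto
  then have "(\<lambda>n. exp (- \<phi> (real n) u) * (\<integral>x. exp (- (\<psi> (real n) u \<bullet> x)) \<partial>\<pi>)) \<longlonglongrightarrow> exp (- \<phi>_lim u) * 1"
    by (intro tendsto_intros filterlim_compose[OF \<phi>_tendsto(2)[OF u] filterlim_real_sequentially])
       (simp add: prob_space)
  moreover have "exp (- \<phi> (real n) u) * (\<integral>x. exp (- (\<psi> (real n) u \<bullet> x)) \<partial>\<pi>) = (\<integral>x. exp (- (u \<bullet> x)) \<partial>\<pi>)" for n
    using bind_laplace[OF \<pi> _ u, of "real n"] inv by (simp add: invariant_distribution_def)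
  ultimately show "(\<integral>x. exp (- (u \<bullet> x)) \<partial>\<pi>) = exp (- \<phi>_lim u)" by (simp add: LIMSEQ_const_iff)
qed

end

theorem theorem2p5:
  fixes \<alpha> b :: "real^'n^'n"
    and B :: "real^'n^'n \<Rightarrow> real^'n^'n"
    and m :: "(real^'n^'n) measure"
    and \<mu> :: "(real^'n^'n) set \<Rightarrow> real^'n^'n"
    and \<phi> :: "real \<Rightarrow> real^'n^'n \<Rightarrow> real"
    and \<psi> :: "real \<Rightarrow> real^'n^'n \<Rightarrow> real^'n^'n"
    and p :: "real \<Rightarrow> real^'n^'n \<Rightarrow> (real^'n^'n) measure"
  assumes "CARD('n) \<ge> 2"
    and "admissible \<alpha> b B m \<mu>"
    and "affine_kernel \<alpha> b B m \<mu> \<phi> \<psi> p"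
    and "subcritical B \<mu>"
    and "(\<integral>\<^sup>+\<xi>\<in>{\<xi>. norm \<xi> > 1}. ennreal (ln (norm \<xi>)) \<partial>m) < \<infinity>"
  shows "\<exists>\<pi>. invariant_distribution p \<pi> \<and>
           (\<forall>\<pi>'. invariant_distribution p \<pi>' \<longrightarrow> \<pi>' = \<pi>) \<and>
           (\<forall>x\<in>psd_cone. weakly_tendsto (\<lambda>t. p t x) \<pi> at_top) \<and>
           (\<forall>u\<in>psd_cone.
              set_integrable lborel {0..} (\<lambda>s. F_fun b m (\<psi> s u)) \<and>
              (\<integral>x. exp (- (u \<bullet> x)) \<partial>\<pi>)
                = exp (- (LINT s:{0..}|lborel. F_fun b m (\<psi> s u))))"
proof -
  interpret affine_process \<alpha> b B m \<mu> \<phi> \<psi> p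
    using assms(2-) by unfold_locales (auto simp: admissible_def)
  obtain \<pi> where \<pi>: "stationary \<pi>" using stationary_exists by blast
  show ?thesis
  proof (intro exI[of _ \<pi>] conjI allI impI ballI)
    show "invariant_distribution p \<pi>" by (rule stationary_invariant[OF \<pi>])
    show "\<pi>' = \<pi>" if "invariant_distribution p \<pi>'" for \<pi>'
      by (rule stationary_unique[OF invariant_stationary[OF that] \<pi>])
    show "weakly_tendsto (\<lambda>t. p t x) \<pi> at_top" if "x \<in> psd_cone" for x
      by (rule stationary_weak_limit[OF \<pi> that])
    fix u :: "real^'n^'n" assume u: "u \<in> psd_cone"
    show "set_integrable lborel {0..} (\<lambda>s. F_fun b m (\<psi> s u))" by (rule \<phi>_tendsto(1)[OF u])
    show "(\<integral>x. exp (- (u \<bullet> x)) \<partial>\<pi>) = exp (- (LINT s:{0..}|lborel. F_fun b m (\<psi> s u)))"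
      using \<pi> u by (simp add: stationary_def \<phi>_lim_def)
  qed
qed

end
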